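(* For every $\varepsilon>0$ there exist $\gamma>0$ and $n_0$ such that the following holds. Let $\mathcal H$ be a 3-graph on $n$ vertices, where $n\ge n_0$ and $4\mid n$. If $\mathcal H$ is not $\varepsilon$-extremal and $\delta_1(\mathcal H)\ge\left(\frac7{16}-\gamma\right)\binom n2$, then $\mathcal H$ contains a perfect $\mathcal C_4^3$-tiling.
   Context: A 3-graph consists of a vertex set $V$ and an edge set $E\subseteq\binom V3$; $\delta_1(\mathcal H)$ is the minimum over vertices $v$ of the number of edges containing $v$. $\mathcal C_4^3$ denotes the (unique up to isomorphism) 3-graph on four vertices with exactly two edges; a 3-graph is $\mathcal C_4^3$-free if it contains no copy of $\mathcal C_4^3$. For $\varepsilon>0$, a 3-graph $\mathcal H$ on $n$ vertices is $\varepsilon$-extremal if there is a set $S\subseteq V(\mathcal H)$ with $|S|\ge(1-\varepsilon)\frac{3n}{4}$ such that the induced subgraph $\mathcal H[S]$ is $\mathcal C_4^3$-free. A perfect $\mathcal C_4^3$-tiling of $\mathcal H$ is a collection of vertex-disjoint copies of $\mathcal C_4^3$ in $\mathcal H$ covering all vertices. *)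

theory Defs
  imports Complex_Main "HOL-Library.Ramsey" "HOL-Library.Disjoint_Sets"
begin

definition three_graph :: "'a set \<Rightarrow> 'a set set \<Rightarrow> bool" where
  "three_graph V E \<longleftrightarrow> finite V \<and> E \<subseteq> nsets V 3"

definition vertex_degree :: "'a set set \<Rightarrow> 'a \<Rightarrow> nat" where
  "vertex_degree E v = card {e \<in> E. v \<in> e}"

text \<open>Only meaningful for nonempty vertex sets.\<close>
definition min_vertex_degree :: "'a set \<Rightarrow> 'a set set \<Rightarrow> nat" where
  "min_vertex_degree V E = Min (vertex_degree E ` V)"

definition is_C43 :: "'a set \<Rightarrow> 'a set set \<Rightarrow> bool" where
  "is_C43 V E \<longleftrightarrow> three_graph V E \<and> card V = 4 \<and> card E = 2"

text \<open>Copies are subgraphs, not necessarily induced ones: the vertex set of a copy may span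
  further edges of the host graph.\<close>
definition C43_copy_in :: "'a set \<Rightarrow> 'a set set \<Rightarrow> 'a set \<Rightarrow> 'a set set \<Rightarrow> bool" where
  "C43_copy_in W F V E \<longleftrightarrow> is_C43 W F \<and> W \<subseteq> V \<and> F \<subseteq> E"

definition C43_free :: "'a set \<Rightarrow> 'a set set \<Rightarrow> bool" where
  "C43_free V E \<longleftrightarrow> \<not> (\<exists>W F. C43_copy_in W F V E)"

definition induced_edges :: "'a set set \<Rightarrow> 'a set \<Rightarrow> 'a set set" where
  "induced_edges E S = {e \<in> E. e \<subseteq> S}"

definition extremal :: "real \<Rightarrow> 'a set \<Rightarrow> 'a set set \<Rightarrow> bool" where
  "extremal \<epsilon> V E \<longleftrightarrow>
     (\<exists>S \<subseteq> V. real (card S) \<ge> (1 - \<epsilon>) * (3 * real (card V) / 4) \<and> C43_free S (induced_edges E S))"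

text \<open>A tiling is a set of pairs (vertex set, edge set), one pair for each copy.\<close>
definition perfect_C43_tiling :: "('a set \<times> 'a set set) set \<Rightarrow> 'a set \<Rightarrow> 'a set set \<Rightarrow> bool" where
  "perfect_C43_tiling T V E \<longleftrightarrow>
     (\<forall>(W, F) \<in> T. C43_copy_in W F V E) \<and> disjoint_family_on fst T \<and> (\<Union>(W, F) \<in> T. W) = V"

end

theory Submission
  imports Defs
begin

text \<open>The proof combines an absorbing set with an almost perfect tiling.

  Two vertices are close if their links share a positive proportion of all pairs. Every pair of vertices
  outside a small exceptional set is connected by many constant-size sets \<open>S\<close> such that both \<open>S + x\<close> and
  \<open>S + y\<close> are tileable; if the closeness graph falls apart into two cliques \<open>A\<close> and \<open>B\<close>, the dense edges
  between them yield copies whose numbers of vertices in \<open>A\<close> differ by one. A small set absorbing every small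
  leftover is then selected greedily with a potential function.

  For the almost perfect tiling, take a maximum family of \<open>m\<close> disjoint copies with uncovered set \<open>U\<close>. Call a
  pair of covered vertices heavy if it forms edges with many vertices of \<open>U\<close>; a set of more than \<open>k\<close> disjoint
  heavy pairs inside \<open>k\<close> tiles would give a larger family. So almost any two tiles span at most seven heavy
  pairs, with equality only if these are all pairs touching one of two centres. The degree condition
  forces equality for nearly all pairs of tiles, and the centre depends only on the tile. The vertices
  that are not centres number about \<open>3n/4\<close>; they span a copy because the hypergraph is not extremal, and this
  copy can be used to enlarge the family.\<close>

subsection \<open>Copies and tileable sets\<close>

text \<open>The order of the constants makes absorption and tiling compatible. The absorbing set A
  is removed before the almost perfect tiling is sought, so A must be small enough for V - A to
  inherit, with slightly worse constants, the degree condition and non-extremality. The fraction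
  \<alpha> of leftover that A can absorb is smaller still and is fixed only afterwards. This is not
  circular: \<gamma> depends on \<epsilon> alone, and \<alpha> enters the count for the maximum
  family only through a term m^2 / |U|, which becomes linear in n once |U| \<ge> \<alpha> n and is
  then swallowed by taking n large. Non-extremality is spent entirely on the almost perfect tiling;
  absorption asks only that each link contain 2/5 of all pairs. A copy is two edges sharing a pair,
  so any pair with two neighbours yields one. Hence convexity suffices to count copies, and neither
  a regularity lemma nor supersaturation results are invoked.\<close>

definition quad :: "'a set set \<Rightarrow> 'a set \<Rightarrow> bool" where
  "quad E W \<longleftrightarrow> card W = 4 \<and> (\<exists>e\<in>E. \<exists>f\<in>E. e \<noteq> f \<and> e \<subseteq> W \<and> f \<subseteq> W)"

inductive tileable :: "'a set set \<Rightarrow> 'a set \<Rightarrow> bool" for E where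
  tileable_empty: "tileable E {}"
| tileable_insert: "quad E W \<Longrightarrow> tileable E S \<Longrightarrow> W \<inter> S = {} \<Longrightarrow> tileable E (W \<union> S)"

lemma quad_finite: "quad E W \<Longrightarrow> finite W"
  unfolding quad_def by (metis card.infinite zero_neq_numeral)

lemma quad_tileable: "quad E W \<Longrightarrow> tileable E W"
  using tileable_insert[OF _ tileable_empty, of E W] by simp

lemma tileable_finite: "tileable E S \<Longrightarrow> finite S"
  by (induction rule: tileable.induct) (auto dest: quad_finite)

lemma tileable_Un:
  assumes "tileable E S" "tileable E T" "S \<inter> T = {}"
  shows "tileable E (S \<union> T)"
  using assms
proof (induction rule: tileable.induct)
  case (tileable_insert W S)
  then have "tileable E (S \<union> T)" "W \<inter> (S \<union> T) = {}" by auto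
  with tileable_insert(1) have "tileable E (W \<union> (S \<union> T))" by (rule tileable.tileable_insert)
  then show ?case by (simp add: Un_assoc)
qed simp

lemma tileable_UN:
  assumes "finite I" "\<And>i. i \<in> I \<Longrightarrow> tileable E (A i)" "disjoint_family_on A I"
  shows "tileable E (\<Union>i\<in>I. A i)"
  using assms
proof (induction I rule: finite_induct)
  case (insert i I)
  then have "tileable E (\<Union>i\<in>I. A i)" by (auto simp: disjoint_family_on_def)
  moreover have "A i \<inter> (\<Union>i\<in>I. A i) = {}"
    using insert.prems(2) insert.hyps(2) by (fastforce simp: disjoint_family_on_def)
  ultimately show ?case using insert.prems by (auto intro!: tileable_Un)
qed (simp add: tileable_empty)

lemma quadI:
  assumes "e \<in> E" "f \<in> E" "e \<noteq> f" "W = e \<union> f" "card W = 4"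
  shows "quad E W"
  using assms unfolding quad_def by blast

lemma quad_two_edges:
  assumes "{a, b, c} \<in> E" "{a, b, d} \<in> E" "distinct [a, b, c, d]"
  shows "quad E {a, b, c, d}"
proof (rule quadI[OF assms(1,2)])
  show "{a, b, c} \<noteq> {a, b, d}" using assms(3) by auto
  show "{a, b, c, d} = {a, b, c} \<union> {a, b, d}" by auto
  show "card {a, b, c, d} = 4" using assms(3) by (auto simp: card_insert_if)
qed

lemma quad_copy:
  assumes "three_graph V E" "quad E W" "W \<subseteq> V"
  obtains F where "C43_copy_in W F V E"
proof -
  obtain e f where ef: "e \<in> E" "f \<in> E" "e \<noteq> f" "e \<subseteq> W" "f \<subseteq> W"
    using assms(2) unfolding quad_def by auto
  have E: "E \<subseteq> nsets V 3" and fV: "finite V" using assms(1) by (auto simp: three_graph_def)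
  have fW: "finite W" using fV assms(3) by (rule rev_finite_subset)
  have "e \<in> nsets W 3" "f \<in> nsets W 3" using E ef by (auto simp: nsets_def)
  then have "three_graph W {e, f}" using fW by (simp add: three_graph_def)
  then have "C43_copy_in W {e, f} V E"
    using ef assms(2,3) unfolding C43_copy_in_def is_C43_def quad_def by simp
  then show ?thesis using that by blast
qed

lemma copy_quad:
  assumes "C43_copy_in W F V E"
  shows "quad E W"
proof -
  have "card F = 2" "card W = 4" "F \<subseteq> E" "F \<subseteq> nsets W 3"
    using assms unfolding C43_copy_in_def is_C43_def three_graph_def by auto
  then obtain e f where "F = {e, f}" "e \<noteq> f" by (auto simp: card_2_iff)
  then have "e \<in> E" "f \<in> E" "e \<subseteq> W" "f \<subseteq> W"
    using \<open>F \<subseteq> E\<close> \<open>F \<subseteq> nsets W 3\<close> by (auto simp: nsets_def)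
  then show ?thesis using \<open>card W = 4\<close> \<open>e \<noteq> f\<close> unfolding quad_def by blast
qed

locale tgraph =
  fixes V :: "'a set" and E :: "'a set set"
  assumes tg: "three_graph V E"
begin

lemma finV: "finite V"
  using tg by (simp add: three_graph_def)

lemma edge_sub: "e \<in> E \<Longrightarrow> e \<subseteq> V" and edge_card: "e \<in> E \<Longrightarrow> card e = 3"
  using tg by (auto simp: three_graph_def nsets_def)

lemma edge_distinct:
  assumes "{x, y, z} \<in> E" shows "x \<noteq> y" "y \<noteq> z" "x \<noteq> z"
  using edge_card[OF assms] by (auto simp: card_insert_if split: if_splits)

lemma edge_in_V:
  assumes "{x, y, z} \<in> E" shows "x \<in> V" "y \<in> V" "z \<in> V"
  using edge_sub[OF assms] by auto

text \<open>Two distinct triples inside a four-set cover it, and edges lie in \<open>V\<close>. This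
  is why \<open>quad\<close> can be stated without a vertex set.\<close>

lemma quad_sub: 
  assumes "quad E W" shows "W \<subseteq> V"
proof -
  obtain e f where ef: "e \<in> E" "f \<in> E" "e \<noteq> f" "e \<subseteq> W" "f \<subseteq> W" and W: "card W = 4"
    using assms unfolding quad_def by auto
  have fW: "finite W" using quad_finite[OF assms] .
  have "card e = 3" "card f = 3" using ef edge_card by auto
  have "\<not> f \<subseteq> e"
    using card_subset_eq[of e f] ef finite_subset[OF ef(4) fW] \<open>card e = 3\<close> \<open>card f = 3\<close> by auto
  then have "e \<subset> e \<union> f" by auto
  moreover have fU: "finite (e \<union> f)" using finite_subset[OF _ fW, of "e \<union> f"] ef by auto
  ultimately have "card e < card (e \<union> f)" by (rule psubset_card_mono[rotated])
  then have "card W \<le> card (e \<union> f)" using W \<open>card e = 3\<close> by simp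
  then have "e \<union> f = W" using card_seteq[OF fW, of "e \<union> f"] ef by auto
  then show ?thesis using ef edge_sub by auto
qed

lemma tileable_perfect:
  assumes "tileable E V" shows "\<exists>T. perfect_C43_tiling T V E"
proof -
  have "\<exists>T. (\<forall>(W, F) \<in> T. C43_copy_in W F V E) \<and> disjoint_family_on fst T \<and> (\<Union>(W, F) \<in> T. W) = S"
    if "tileable E S" for S
    using that
  proof (induction rule: tileable.induct)
    case tileable_empty
    show ?case by (rule exI[of _ "{}"]) (auto simp: disjoint_family_on_def)
  next
    case (tileable_insert W S)
    then obtain T where T: "\<forall>(W, F) \<in> T. C43_copy_in W F V E" "disjoint_family_on fst T"
      "(\<Union>(W, F) \<in> T. W) = S" using tileable_insert.IH by blast
    obtain F where F: "C43_copy_in W F V E"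
      using quad_copy[OF tg tileable_insert(1) quad_sub[OF tileable_insert(1)]] .
    have sub: "fst p \<subseteq> S" if "p \<in> T" for p using that T(3) by (cases p) auto
    have "disjoint_family_on fst (insert (W, F) T)"
      unfolding disjoint_family_on_def
    proof (intro ballI impI)
      fix p q assume pq: "p \<in> insert (W, F) T" "q \<in> insert (W, F) T" "p \<noteq> q"
      show "fst p \<inter> fst q = {}"
      proof (cases "p \<in> T \<and> q \<in> T")
        case True
        then show ?thesis using T(2) pq(3) by (auto simp: disjoint_family_on_def)
      next
        case False
        then show ?thesis using pq sub tileable_insert(3) by fastforce
      qed
    qed
    then show ?case using T F by (intro exI[of _ "insert (W, F) T"]) auto
  qed
  then show ?thesis using assms unfolding perfect_C43_tiling_def by blast
qed

text \<open>Link size in ordered pairs, twice the vertex degree. Ordered pairs turn the link into a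
  relation on \<open>V\<close>, the form in which cherries and codegrees are counted below.\<close>

definition pdeg :: "'a \<Rightarrow> nat" where
  "pdeg v = card {(x, y) \<in> V \<times> V. {v, x, y} \<in> E}"

lemma pdeg_eq: "pdeg v = 2 * vertex_degree E v"
proof -
  let ?D = "{e \<in> E. v \<in> e}"
  let ?F = "\<lambda>e. {(x, y). {v, x, y} = e}"
  have fE: "finite E" using tg finV unfolding three_graph_def
    by (meson finite_imp_finite_nsets finite_subset)
  have F: "finite (?F e) \<and> card (?F e) = 2" if e: "e \<in> ?D" for e
  proof -
    have "card (e - {v}) = 2" using e edge_card[of e] by auto
    then obtain a b where ab: "e - {v} = {a, b}" "a \<noteq> b" by (auto simp: card_2_iff)
    then have "e = {v, a, b}" "a \<noteq> v" "b \<noteq> v" using e by auto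
    then have "{v, x, y} = e \<longleftrightarrow> x = a \<and> y = b \<or> x = b \<and> y = a" for x y
      using ab(2) by (smt (verit) insert_iff empty_iff insert_commute)
    then have "?F e = {(a, b), (b, a)}" by auto
    then show ?thesis using ab(2) by simp
  qed
  have "{(x, y) \<in> V \<times> V. {v, x, y} \<in> E} = (\<Union>e\<in>?D. ?F e)"
    (is "?L = ?R")
  proof
    show "?L \<subseteq> ?R" by auto
    show "?R \<subseteq> ?L"
    proof
      fix p assume "p \<in> ?R"
      then obtain x y where "p = (x, y)" "{v, x, y} \<in> E" by auto
      then show "p \<in> ?L" using edge_in_V[of v x y] by simp
    qed
  qed
  then have "pdeg v = (\<Sum>e\<in>?D. card (?F e))"
    unfolding pdeg_def using fE F by (subst card_UN_disjoint[symmetric]) auto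
  also have "\<dots> = (\<Sum>e\<in>?D. 2)" using F by (intro sum.cong) auto
  finally show ?thesis unfolding vertex_degree_def by simp
qed

lemma pdeg_lower:
  assumes "real (min_vertex_degree V E) \<ge> c * real (card V choose 2)" "v \<in> V"
  shows "real (pdeg v) \<ge> c * real (card V) * (real (card V) - 1)"
proof -
  have min: "min_vertex_degree V E \<le> vertex_degree E v"
    unfolding min_vertex_degree_def using assms(2) finV by (intro Min_le) auto
  have ch: "real (card V choose 2) = real (card V) * (real (card V) - 1) / 2"
  proof -
    have "V \<noteq> {}" using assms(2) by auto
    then have "card V \<ge> 1" using finV by (simp add: Suc_leI card_gt_0_iff)
    moreover have "2 * (card V choose 2) = card V * (card V - 1)"
      unfolding choose_two by (rule dvd_mult_div_cancel) (cases "card V"; simp)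
    then have "2 * real (card V choose 2) = real (card V) * real (card V - 1)"
      by (metis of_nat_mult of_nat_numeral)
    ultimately show ?thesis by (simp add: of_nat_diff)
  qed
  have "c * real (card V) * (real (card V) - 1) = 2 * (c * real (card V choose 2))"
    unfolding ch by simp
  also have "\<dots> \<le> 2 * real (vertex_degree E v)" using assms(1) min by linarith
  finally show ?thesis unfolding pdeg_eq by simp
qed

end

lemma induced_tgraph:
  assumes "three_graph V E" "S \<subseteq> V"
  shows "three_graph S (induced_edges E S)"
  using assms finite_subset[OF assms(2)] unfolding three_graph_def induced_edges_def
  by (auto simp: nsets_def)

lemma quad_induced: "quad (induced_edges E S) W \<Longrightarrow> quad E W"
  unfolding quad_def induced_edges_def by blast

lemma tileable_induced: "tileable (induced_edges E S) W \<Longrightarrow> tileable E W"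
  by (induction rule: tileable.induct) (auto intro: tileable.intros quad_induced)

subsection \<open>Robust properties of vertex sets\<close>

text \<open>Cauchy-Schwarz against the constant function, obtained from the non-negativity of the
  variance around the mean \<open>m\<close>.\<close>

lemma sum_power2_ge:
  fixes d :: "'b \<Rightarrow> real"
  assumes "finite I" "I \<noteq> {}"
  shows "(\<Sum>i\<in>I. d i)\<^sup>2 / real (card I) \<le> (\<Sum>i\<in>I. (d i)\<^sup>2)"
proof -
  define e where "e = (\<Sum>i\<in>I. d i)"
  define m where "m = e / real (card I)"
  have c: "real (card I) > 0" using assms by (simp add: card_gt_0_iff)
  have "0 \<le> (\<Sum>i\<in>I. (d i - m)\<^sup>2)" by (intro sum_nonneg) simp
  also have "\<dots> = (\<Sum>i\<in>I. (d i)\<^sup>2 - 2 * m * d i + m\<^sup>2)"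
    by (intro sum.cong refl) (simp add: power2_diff)
  also have "\<dots> = (\<Sum>i\<in>I. (d i)\<^sup>2) - 2 * m * e + real (card I) * m\<^sup>2"
    by (simp add: sum.distrib sum_subtractf e_def sum_distrib_left)
  also have "\<dots> = (\<Sum>i\<in>I. (d i)\<^sup>2) - e\<^sup>2 / real (card I)"
    using c unfolding m_def by (simp add: field_simps power2_eq_square)
  finally show ?thesis unfolding e_def by simp
qed

lemma card_SIGMA_Collect:
  assumes "finite I" "finite J"
  shows "card {(i, j). i \<in> I \<and> j \<in> J \<and> R i j} = (\<Sum>i\<in>I. card {j\<in>J. R i j})"
proof -
  have "{(i, j). i \<in> I \<and> j \<in> J \<and> R i j} = Sigma I (\<lambda>i. {j\<in>J. R i j})" by auto
  then show ?thesis using assms by simp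
qed

text \<open>Convexity gives at least \<theta>^2 |I| |J|^2 pairs (j, j') with repetition allowed. The
  diagonal has at most |I| |J| of them, which is at most half by the last hypothesis.\<close>

lemma card_cherries:
  assumes "finite I" "finite J" "I \<noteq> {}"
    and "\<theta> * real (card I) * real (card J) \<le> real (card {(i, j). i \<in> I \<and> j \<in> J \<and> R i j})"
    and "0 \<le> \<theta>" "2 \<le> \<theta>\<^sup>2 * real (card J)"
  shows "\<theta>\<^sup>2 / 2 * real (card I) * (real (card J))\<^sup>2
    \<le> real (card {(i, j, j'). i \<in> I \<and> j \<in> J \<and> j' \<in> J \<and> j \<noteq> j' \<and> R i j \<and> R i j'})"
proof -
  define d where "d i = {j\<in>J. R i j}" for i
  let ?N = "{(i, j, j'). i \<in> I \<and> j \<in> J \<and> j' \<in> J \<and> j \<noteq> j' \<and> R i j \<and> R i j'}"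
  have fd: "finite (d i)" "card (d i) \<le> card J" for i
    unfolding d_def using assms(2) by (auto intro: card_mono)
  have e: "real (card {(i, j). i \<in> I \<and> j \<in> J \<and> R i j}) = (\<Sum>i\<in>I. real (card (d i)))"
    using card_SIGMA_Collect[OF assms(1,2), of R] by (simp add: d_def)
  have c: "real (card I) > 0" using assms by (simp add: card_gt_0_iff)
  have N: "?N = Sigma I (\<lambda>i. d i \<times> d i - Id_on (d i))" by (auto simp: d_def)
  have ci: "card (d i \<times> d i - Id_on (d i)) = card (d i) * card (d i) - card (d i)" for i
  proof -
    have "Id_on (d i) = (\<lambda>x. (x, x)) ` d i" by auto
    then have "card (Id_on (d i)) = card (d i)" "finite (Id_on (d i))" using fd(1)[of i]
      by (auto simp: card_image inj_on_def)
    then show ?thesis by (subst card_Diff_subset) (auto simp: card_cartesian_product)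
  qed
  have le: "card (d i) \<le> card (d i) * card (d i)" for i by (cases "card (d i)") auto
  have "real (card ?N) = (\<Sum>i\<in>I. real (card (d i) * card (d i) - card (d i)))"
    unfolding N using assms(1) fd(1) by (subst card_SigmaI) (auto simp: ci)
  also have "\<dots> = (\<Sum>i\<in>I. (real (card (d i)))\<^sup>2 - real (card (d i)))"
    by (intro sum.cong refl) (simp add: of_nat_diff[OF le] power2_eq_square)
  also have "\<dots> = (\<Sum>i\<in>I. (real (card (d i)))\<^sup>2) - (\<Sum>i\<in>I. real (card (d i)))"
    by (simp add: sum_subtractf)
  finally have N': "real (card ?N) = (\<Sum>i\<in>I. (real (card (d i)))\<^sup>2) - (\<Sum>i\<in>I. real (card (d i)))" .
  have "(\<theta> * real (card I) * real (card J))\<^sup>2 \<le> (\<Sum>i\<in>I. real (card (d i)))\<^sup>2"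
    using assms(4,5) e by (intro power_mono) auto
  then have "(\<theta> * real (card I) * real (card J))\<^sup>2 / real (card I) \<le> (\<Sum>i\<in>I. (real (card (d i)))\<^sup>2)"
    using sum_power2_ge[OF assms(1,3), of "\<lambda>i. real (card (d i))"] c
    by (meson divide_right_mono less_imp_le order_trans)
  then have 1: "\<theta>\<^sup>2 * real (card I) * (real (card J))\<^sup>2 \<le> (\<Sum>i\<in>I. (real (card (d i)))\<^sup>2)"
    using c by (simp add: power2_eq_square field_simps)
  have "(\<Sum>i\<in>I. real (card (d i))) \<le> (\<Sum>i\<in>I. real (card J))"
    using fd(2) by (intro sum_mono) simp
  then have 2: "(\<Sum>i\<in>I. real (card (d i))) \<le> real (card I) * real (card J)" by simp
  have "2 * (real (card I) * real (card J)) \<le> \<theta>\<^sup>2 * real (card J) * (real (card I) * real (card J))"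
    using assms(6) by (intro mult_right_mono) auto
  then have "real (card I) * real (card J) \<le> \<theta>\<^sup>2 / 2 * real (card I) * (real (card J))\<^sup>2"
    by (simp add: power2_eq_square algebra_simps)
  then show ?thesis using 1 2 N' by simp
qed

text \<open>Lists may contain vertices that the witness does not use, so that witnesses of different sizes
  can be padded to a common length.\<close>

definition rob :: "'a set \<Rightarrow> real \<Rightarrow> nat \<Rightarrow> ('a set \<Rightarrow> bool) \<Rightarrow> bool" where
  "rob V c k P \<longleftrightarrow>
     c * real (card V) ^ k \<le> real (card {l. set l \<subseteq> V \<and> length l = k \<and> (\<exists>S\<subseteq>set l. P S)})"

lemma finite_lists: "finite V \<Longrightarrow> finite {l. set l \<subseteq> V \<and> length l = k \<and> Q l}"
  by (rule finite_subset[OF _ finite_lists_length_eq[of V k]]) auto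

lemma rob_mono:
  assumes "rob V c k P" "finite V" "c' \<le> c"
    and "\<And>S. S \<subseteq> V \<Longrightarrow> finite S \<Longrightarrow> card S \<le> k \<Longrightarrow> P S \<Longrightarrow> P' S"
  shows "rob V c' k P'"
proof -
  have "c' * real (card V) ^ k \<le> c * real (card V) ^ k"
    using assms(3) by (intro mult_right_mono) auto
  also have "\<dots> \<le> real (card {l. set l \<subseteq> V \<and> length l = k \<and> (\<exists>S\<subseteq>set l. P S)})"
    using assms(1) unfolding rob_def .
  also have "\<dots> \<le> real (card {l. set l \<subseteq> V \<and> length l = k \<and> (\<exists>S\<subseteq>set l. P' S)})"
  proof -
    have "{l. set l \<subseteq> V \<and> length l = k \<and> (\<exists>S\<subseteq>set l. P S)} \<subseteq>
      {l. set l \<subseteq> V \<and> length l = k \<and> (\<exists>S\<subseteq>set l. P' S)}"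
    proof
      fix l assume "l \<in> {l. set l \<subseteq> V \<and> length l = k \<and> (\<exists>S\<subseteq>set l. P S)}"
      then obtain S where l: "set l \<subseteq> V" "S \<subseteq> set l" "P S" "length l = k" by blast
      have "card S \<le> length l" using l(2) by (meson List.finite_set card_length card_mono order_trans)
      moreover have "finite S" using l(2) by (rule finite_subset) simp
      ultimately have "P' S" using l by (intro assms(4)) auto
      then show "l \<in> {l. set l \<subseteq> V \<and> length l = k \<and> (\<exists>S\<subseteq>set l. P' S)}" using l by blast
    qed
    then show ?thesis using finite_lists[OF assms(2)] by (simp add: card_mono)
  qed
  finally show ?thesis unfolding rob_def .
qed

text \<open>Concatenating a list for \<open>P\<close> with a list for \<open>Q\<close> multiplies
  the densities. Each first list gets one fixed witness \<open>f l\<close>, so that the second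
  property may depend on it; disjointness of the two parts is imposed through \<open>Q\<close> when
  needed.\<close>

lemma rob_Un:
  assumes "rob V c k P" "finite V" "0 \<le> c" "0 \<le> d"
    and "\<And>S. S \<subseteq> V \<Longrightarrow> finite S \<Longrightarrow> card S \<le> k \<Longrightarrow> P S \<Longrightarrow> rob V d j (Q S)"
  shows "rob V (c * d) (k + j) (\<lambda>S. \<exists>S1 S2. S = S1 \<union> S2 \<and> P S1 \<and> Q S1 S2)"
proof -
  define A where "A = {l. set l \<subseteq> V \<and> length l = k \<and> (\<exists>S\<subseteq>set l. P S)}"
  define f where "f l = (SOME S. S \<subseteq> set l \<and> P S)" for l
  define B where "B l = {l'. set l' \<subseteq> V \<and> length l' = j \<and> (\<exists>S\<subseteq>set l'. Q (f l) S)}" for l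
  define C where "C = {l. set l \<subseteq> V \<and> length l = k + j \<and>
    (\<exists>S\<subseteq>set l. \<exists>S1 S2. S = S1 \<union> S2 \<and> P S1 \<and> Q S1 S2)}"
  let ?n = "real (card V)"
  have fin: "finite A" "finite (B l)" "finite C" for l
    unfolding A_def B_def C_def by (rule finite_lists[OF assms(2)])+
  have f: "f l \<subseteq> set l" "P (f l)" if "l \<in> A" for l
    using someI_ex[of "\<lambda>S. S \<subseteq> set l \<and> P S"] that unfolding A_def f_def by auto
  have B: "d * ?n ^ j \<le> real (card (B l))" if l: "l \<in> A" for l
  proof -
    have "card (f l) \<le> length l" using f(1)[OF l] by (meson List.finite_set card_length card_mono order_trans)
    then have "rob V d j (Q (f l))"
      using f[OF l] l by (intro assms(5)) (auto simp: A_def intro: finite_subset)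
    then show ?thesis unfolding rob_def B_def .
  qed
  have "c * d * ?n ^ (k + j) = (c * ?n ^ k) * (d * ?n ^ j)" by (simp add: power_add)
  also have "\<dots> \<le> real (card A) * (d * ?n ^ j)"
    using assms(1,4) unfolding rob_def A_def by (intro mult_right_mono) auto
  also have "\<dots> = (\<Sum>l\<in>A. d * ?n ^ j)" by simp
  also have "\<dots> \<le> (\<Sum>l\<in>A. real (card (B l)))" using B by (intro sum_mono) auto
  also have "\<dots> = real (card (Sigma A B))" using fin by (subst card_SigmaI) auto
  also have "\<dots> \<le> real (card C)"
  proof -
    \<comment> \<open>All lists in \<open>A\<close> have length \<open>k\<close>, so a concatenation
      determines its two parts.\<close>
    have "inj_on (\<lambda>(l, l'). l @ l') (Sigma A B)" by (auto simp: inj_on_def A_def)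
    moreover have "(\<lambda>(l, l'). l @ l') ` Sigma A B \<subseteq> C"
    proof (clarsimp)
      fix l l' assume l: "l \<in> A" "l' \<in> B l"
      then obtain S where S: "S \<subseteq> set l'" "Q (f l) S" by (auto simp: B_def)
      have "f l \<union> S \<subseteq> set (l @ l')" using f(1)[OF l(1)] S by auto
      moreover have "\<exists>S1 S2. f l \<union> S = S1 \<union> S2 \<and> P S1 \<and> Q S1 S2" using S f[OF l(1)] by blast
      ultimately have "\<exists>S'\<subseteq>set (l @ l'). \<exists>S1 S2. S' = S1 \<union> S2 \<and> P S1 \<and> Q S1 S2" by blast
      then show "l @ l' \<in> C" using l unfolding C_def A_def B_def by simp
    qed
    ultimately show ?thesis using fin by (metis card_inj_on_le of_nat_le_iff)
  qed
  finally show ?thesis unfolding rob_def C_def by simp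
qed

lemma rob_pad:
  assumes "rob V c k P" "finite V" "0 \<le> c" "k \<le> j"
  shows "rob V c j P"
proof -
  have "rob V 1 (j - k) (\<lambda>S. S = {})"
    unfolding rob_def using card_lists_length_eq[OF assms(2), of "j - k"] by simp
  then have "rob V (c * 1) (k + (j - k)) (\<lambda>S. \<exists>S1 S2. S = S1 \<union> S2 \<and> P S1 \<and> S2 = {})"
    using assms by (intro rob_Un) auto
  then show ?thesis using assms by (auto elim!: rob_mono)
qed

text \<open>By Bernoulli's inequality all but c/2 of the lists of length \<open>k\<close> miss
  \<open>F\<close> altogether. At least half of the good lists are among those, and any witness
  inside them misses \<open>F\<close> too. This factor 1/2 is the price of every disjointness
  requirement below.\<close>

lemma rob_avoid:
  assumes "rob V c k P" "finite V" "V \<noteq> {}" "finite F" "2 * real k * real (card F) \<le> c * real (card V)"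
  shows "rob V (c / 2) k (\<lambda>S. P S \<and> S \<inter> F = {})"
proof -
  define f where "f = card (F \<inter> V)"
  define n where "n = card V"
  define A where "A = {l. set l \<subseteq> V \<and> length l = k \<and> (\<exists>S\<subseteq>set l. P S)}"
  define B where "B = {l. set l \<subseteq> V \<and> length l = k}"
  define D where "D = {l. set l \<subseteq> V - F \<and> length l = k}"
  define C where "C = {l. set l \<subseteq> V \<and> length l = k \<and> (\<exists>S\<subseteq>set l. P S \<and> S \<inter> F = {})}"
  have n: "real n > 0" using assms by (simp add: n_def card_gt_0_iff)
  have f: "f \<le> n" "f \<le> card F" using assms unfolding f_def n_def by (auto intro: card_mono)
  have fin: "finite A" "finite B" "finite C" unfolding A_def B_def C_def
    using assms(2) by (auto intro: finite_lists finite_lists_length_eq)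
  have DB: "D \<subseteq> B" by (auto simp: D_def B_def)
  have cB: "card B = n ^ k" unfolding B_def n_def by (rule card_lists_length_eq[OF assms(2)])
  have "card (V - F) = n - f" unfolding n_def f_def using assms
    by (metis Diff_Int2 Diff_Int_distrib2 Int_absorb2 Int_commute Int_lower2 card_Diff_subset_Int finite_Int)
  then have cD: "card D = (n - f) ^ k" unfolding D_def
    using card_lists_length_eq[of "V - F" k] assms(2) by simp
  have "1 + real k * (- (real f / real n)) \<le> (1 + (- (real f / real n))) ^ k"
    using f n by (intro Bernoulli_inequality) auto
  then have "(1 - real k * (real f / real n)) * real n ^ k \<le> (1 - real f / real n) ^ k * real n ^ k"
    using n by (intro mult_right_mono) auto
  also have "\<dots> = (real n - real f) ^ k"
    using n by (simp add: power_mult_distrib[symmetric] field_simps)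
  also have "\<dots> = real (card D)" using f by (simp add: cD of_nat_diff)
  finally have D: "(1 - real k * (real f / real n)) * real n ^ k \<le> real (card D)" .
  have "2 * real k * real f \<le> 2 * real k * real (card F)" using f(2) by (intro mult_left_mono) auto
  then have "real k * (real f / real n) \<le> c / 2" using assms(5) n unfolding n_def[symmetric]
    by (simp add: field_simps)
  then have "(1 - c / 2) * real n ^ k \<le> (1 - real k * (real f / real n)) * real n ^ k"
    by (intro mult_right_mono) auto
  then have D': "(1 - c / 2) * real n ^ k \<le> real (card D)" using D by simp
  have "A \<subseteq> C \<union> (B - D)"
  proof
    fix l assume l: "l \<in> A"
    show "l \<in> C \<union> (B - D)"
    proof (cases "l \<in> D")
      case True
      then have "set l \<inter> F = {}" by (auto simp: D_def)
      then show ?thesis using l unfolding A_def C_def by blast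
    next
      case False
      then show ?thesis using l by (auto simp: A_def B_def)
    qed
  qed
  then have "card A \<le> card C + card (B - D)"
    using fin by (meson card_Un_le card_mono finite_Diff finite_UnI order_trans)
  then have "real (card A) \<le> real (card C) + real (card (B - D))" by linarith
  also have "real (card (B - D)) = real n ^ k - real (card D)"
    using DB fin cB finite_subset[OF DB fin(2)] card_mono[OF fin(2) DB]
    by (simp add: card_Diff_subset of_nat_diff)
  finally have "real (card A) \<le> real (card C) + real n ^ k - real (card D)" by simp
  moreover have "c * real n ^ k \<le> real (card A)"
    using assms(1) unfolding rob_def A_def n_def .
  ultimately have "c / 2 * real n ^ k \<le> real (card C)" using D' by (simp add: algebra_simps)
  then show ?thesis unfolding rob_def C_def n_def .
qed

lemma robI_inj:
  assumes "finite V" "inj_on g X" "c * real (card V) ^ k \<le> real (card X)"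
    and "\<And>x. x \<in> X \<Longrightarrow> set (g x) \<subseteq> V \<and> length (g x) = k \<and> P (set (g x))"
  shows "rob V c k P"
proof -
  have "card X \<le> card {l. set l \<subseteq> V \<and> length l = k \<and> (\<exists>S\<subseteq>set l. P S)}"
    using assms(4) by (intro card_inj_on_le[OF assms(2) _ finite_lists[OF assms(1)]]) auto
  then show ?thesis using assms(3) unfolding rob_def by linarith
qed

subsection \<open>Connecting vertices\<close>

text \<open>Reachability as in the absorbing method, for sets instead of single vertices, so that
  exchanges on disjoint sets can be added up.\<close>

definition connects :: "'a set set \<Rightarrow> 'a set \<Rightarrow> 'a set \<Rightarrow> 'a set \<Rightarrow> bool" where
  "connects E X Y S \<longleftrightarrow> tileable E (X \<union> S) \<and> tileable E (Y \<union> S) \<and> S \<inter> (X \<union> Y) = {}"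

text \<open>Guarantees in the end that the vertices left for the absorbing set are divisible by four
  in number.\<close>

lemma tileable_card: "tileable E S \<Longrightarrow> 4 dvd card S"
proof (induction rule: tileable.induct)
  case (tileable_insert W S)
  then have "card (W \<union> S) = card W + card S"
    by (intro card_Un_disjoint) (auto dest: quad_finite tileable_finite)
  then show ?case using tileable_insert by (simp add: quad_def)
qed simp

lemma connects_sym: "connects E X Y S \<Longrightarrow> connects E Y X S"
  unfolding connects_def by auto

lemma connects_Un:
  assumes "connects E X1 Y1 S1" "connects E X2 Y2 S2"
    and "(X1 \<union> Y1) \<inter> (X2 \<union> Y2) = {}" "S1 \<inter> (X2 \<union> Y2) = {}" "S2 \<inter> (X1 \<union> Y1 \<union> S1) = {}"
  shows "connects E (X1 \<union> X2) (Y1 \<union> Y2) (S1 \<union> S2)"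
proof -
  note c = assms(1,2)[unfolded connects_def]
  have "(X1 \<union> S1) \<inter> (X2 \<union> S2) = {}" "(Y1 \<union> S1) \<inter> (Y2 \<union> S2) = {}" using c assms(3-5) by auto
  then have "tileable E ((X1 \<union> S1) \<union> (X2 \<union> S2))" "tileable E ((Y1 \<union> S1) \<union> (Y2 \<union> S2))"
    using c by (auto intro: tileable_Un)
  moreover have "(X1 \<union> S1) \<union> (X2 \<union> S2) = (X1 \<union> X2) \<union> (S1 \<union> S2)"
    "(Y1 \<union> S1) \<union> (Y2 \<union> S2) = (Y1 \<union> Y2) \<union> (S1 \<union> S2)" by auto
  moreover have "(S1 \<union> S2) \<inter> ((X1 \<union> X2) \<union> (Y1 \<union> Y2)) = {}" using c assms by auto
  ultimately show ?thesis unfolding connects_def by simp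
qed

text \<open>The middle vertex joins the connecting set: from \<open>x\<close> the tiles are
  \<open>x + S1\<close> and \<open>z + S2\<close>, from \<open>y\<close> they are
  \<open>y + S2\<close> and \<open>z + S1\<close>.\<close>

lemma connects_trans:
  assumes "connects E {x} {z} S1" "connects E {z} {y} S2"
    and "x \<noteq> y" "x \<noteq> z" "y \<noteq> z" "y \<notin> S1" "x \<notin> S2" "S1 \<inter> S2 = {}"
  shows "connects E {x} {y} ({z} \<union> (S1 \<union> S2))"
proof -
  note c = assms(1,2)[unfolded connects_def]
  have "({x} \<union> S1) \<inter> ({z} \<union> S2) = {}" "({y} \<union> S2) \<inter> ({z} \<union> S1) = {}" using c assms(3-8) by auto
  then have "tileable E (({x} \<union> S1) \<union> ({z} \<union> S2))" "tileable E (({y} \<union> S2) \<union> ({z} \<union> S1))"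
    using c tileable_Un[of E "{x} \<union> S1" "{z} \<union> S2"] tileable_Un[of E "{y} \<union> S2" "{z} \<union> S1"] by metis+
  moreover have "({x} \<union> S1) \<union> ({z} \<union> S2) = {x} \<union> ({z} \<union> (S1 \<union> S2))"
    "({y} \<union> S2) \<union> ({z} \<union> S1) = {y} \<union> ({z} \<union> (S1 \<union> S2))" by auto
  moreover have "({z} \<union> (S1 \<union> S2)) \<inter> ({x} \<union> {y}) = {}" using c assms by auto
  ultimately show ?thesis unfolding connects_def by simp
qed

section \<open>Reachability and closeness of vertices\<close>

context tgraph
begin

definition reach :: "real \<Rightarrow> nat \<Rightarrow> 'a set \<Rightarrow> 'a set \<Rightarrow> bool" where
  "reach c k X Y \<longleftrightarrow> rob V c k (connects E X Y)"

text \<open>The threshold 1/20 fits links of density 2/5: three links pairwise sharing less than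
  1/20 would have a union of density above 6/5 - 3/20 > 1.\<close>

definition close :: "'a \<Rightarrow> 'a \<Rightarrow> bool" where
  "close x y \<longleftrightarrow> 1 / 20 * real (card V) * real (card V) \<le>
     real (card {(a, b). a \<in> V \<and> b \<in> V \<and> {x, a, b} \<in> E \<and> {y, a, b} \<in> E})"

lemma reach_sym: "reach c k X Y \<Longrightarrow> reach c k Y X"
proof -
  have "connects E X Y = connects E Y X" by (auto intro!: ext connects_sym)
  then show "reach c k X Y \<Longrightarrow> reach c k Y X" unfolding reach_def by simp
qed

lemma close_sym: "close x y \<Longrightarrow> close y x"
  unfolding close_def by (simp add: conj_commute)

lemma reach_mono:
  assumes "reach c k X Y" "0 \<le> c" "c' \<le> c" "k \<le> k'"
  shows "reach c' k' X Y"
  using rob_mono[OF rob_pad[OF _ finV, of c k _ k'] finV, of "connects E X Y" c' "connects E X Y"] assms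
  unfolding reach_def by blast

lemma rob_cherries:
  assumes "\<theta> * real (card V) * real (card V) \<le> real (card {(b, a). b \<in> V \<and> a \<in> V \<and> R b a})"
    and "0 \<le> \<theta>" "2 \<le> \<theta>\<^sup>2 * real (card V)"
  shows "rob V (\<theta>\<^sup>2 / 2) 3 (\<lambda>S. \<exists>b a c. S = {b, a, c} \<and> a \<noteq> c \<and> R b a \<and> R b c)"
proof -
  have ne: "V \<noteq> {}" using assms(3) by auto
  let ?X = "{(b, a, c). b \<in> V \<and> a \<in> V \<and> c \<in> V \<and> a \<noteq> c \<and> R b a \<and> R b c}"
  have "\<theta>\<^sup>2 / 2 * real (card V) ^ 3 \<le> real (card ?X)"
    using card_cherries[OF finV finV ne assms(1,2,3)] by (simp add: power2_eq_square power3_eq_cube mult.assoc)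
  moreover have "inj_on (\<lambda>(b, a, c). [b, a, c]) ?X" by (auto simp: inj_on_def)
  ultimately show ?thesis
    by (intro robI_inj[OF finV, where X = ?X and g = "\<lambda>(b, a, c). [b, a, c]"]) fastforce+
qed

lemma quad_cherry:
  assumes "{x, b, a} \<in> E" "{x, b, c} \<in> E" "a \<noteq> c"
  shows "quad E (insert x {b, a, c})" "x \<notin> {b, a, c}" "card {b, a, c} = 3"
proof -
  note d = edge_distinct[OF assms(1)] edge_distinct[OF assms(2)]
  show "quad E (insert x {b, a, c})" using quad_two_edges[OF assms(1,2)] d assms(3) by auto
  show "x \<notin> {b, a, c}" using d by auto
  show "card {b, a, c} = 3" using d assms(3) by auto
qed

text \<open>A cherry \<open>b\<close>; \<open>a\<close>, \<open>c\<close> in the common link of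
  \<open>x\<close> and \<open>y\<close> forms a copy with either of them. The constant is (1/20)^2 /
  2 = 1/800.\<close>

lemma close_reach:
  assumes "close x y" "800 \<le> card V"
  shows "reach (1 / 800) 3 {x} {y}"
proof -
  have "rob V ((1 / 20)\<^sup>2 / 2) 3 (\<lambda>S. \<exists>b a c. S = {b, a, c} \<and> a \<noteq> c \<and>
      ({x, b, a} \<in> E \<and> {y, b, a} \<in> E) \<and> ({x, b, c} \<in> E \<and> {y, b, c} \<in> E))"
    using assms by (intro rob_cherries) (auto simp: close_def power2_eq_square)
  then show ?thesis unfolding reach_def
  proof (rule rob_mono[OF _ finV])
    fix S assume "\<exists>b a c. S = {b, a, c} \<and> a \<noteq> c \<and>
      ({x, b, a} \<in> E \<and> {y, b, a} \<in> E) \<and> ({x, b, c} \<in> E \<and> {y, b, c} \<in> E)"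
    then obtain b a c where S: "S = {b, a, c}" "a \<noteq> c" "{x, b, a} \<in> E" "{y, b, a} \<in> E"
      "{x, b, c} \<in> E" "{y, b, c} \<in> E" by blast
    show "connects E {x} {y} S"
      using quad_cherry(2)[OF S(3,5,2)] quad_cherry(2)[OF S(4,6,2)]
        quad_tileable[OF quad_cherry(1)[OF S(3,5,2)]] quad_tileable[OF quad_cherry(1)[OF S(4,6,2)]]
      unfolding connects_def S(1) by (simp add: insert_commute)
  qed (simp add: power2_eq_square)
qed

text \<open>The list starts with a middle vertex \<open>z\<close>, contributing the factor \<eta>.
  The set from \<open>x\<close> to \<open>z\<close> must avoid \<open>y\<close>, and the set from
  \<open>z\<close> to \<open>y\<close> must avoid \<open>x\<close> and the former set; each
  requirement halves a constant \<open>c\<close>.\<close>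

lemma reach_two_step:
  assumes "Z \<subseteq> V" "x \<notin> Z" "y \<notin> Z" "x \<noteq> y" "\<eta> * real (card V) \<le> real (card Z)" "0 \<le> \<eta>"
    and "\<And>z. z \<in> Z \<Longrightarrow> reach c k {x} {z} \<and> reach c k {z} {y}"
    and "0 \<le> c" "2 * real k * real (k + 1) \<le> c * real (card V)" "V \<noteq> {}"
  shows "reach (\<eta> * (c / 2 * (c / 2))) (1 + (k + k)) {x} {y}"
proof -
  have "rob V \<eta> 1 (\<lambda>S. \<exists>z\<in>Z. S = {z})"
    by (rule robI_inj[OF finV, where X = Z and g = "\<lambda>z. [z]"]) (use assms in \<open>auto simp: inj_on_def\<close>)
  then have "rob V (\<eta> * (c / 2 * (c / 2))) (1 + (k + k))
    (\<lambda>S. \<exists>S0 S'. S = S0 \<union> S' \<and> (\<exists>z\<in>Z. S0 = {z}) \<and> 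
      (\<exists>S1 S2. S' = S1 \<union> S2 \<and> (connects E {x} (S0) S1 \<and> S1 \<inter> {y} = {}) \<and>
        connects E (S0) {y} S2 \<and> S2 \<inter> insert x S1 = {}))"
  proof (rule rob_Un[OF _ finV])
    fix S assume "\<exists>z\<in>Z. S = {z}"
    then obtain z where z: "z \<in> Z" "S = {z}" by auto
    show "rob V (c / 2 * (c / 2)) (k + k) (\<lambda>S'. \<exists>S1 S2. S' = S1 \<union> S2 \<and> (connects E {x} S S1 \<and> S1 \<inter> {y} = {}) \<and>
        connects E S {y} S2 \<and> S2 \<inter> insert x S1 = {})"
    proof (rule rob_Un[OF _ finV])
      show "rob V (c / 2) k (\<lambda>S1. connects E {x} S S1 \<and> S1 \<inter> {y} = {})"
        using assms(7)[OF z(1)] unfolding reach_def z(2)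
      proof (intro rob_avoid finV assms)
        have "2 * real k * 1 \<le> 2 * real k * real (k + 1)" by (intro mult_left_mono) auto
        then show "2 * real k * real (card {y}) \<le> c * real (card V)" using assms(9) by simp
      qed auto
    next
      fix S1 :: "'a set" assume S1: "card S1 \<le> k" "finite S1"
      show "rob V (c / 2) k (\<lambda>S2. connects E S {y} S2 \<and> S2 \<inter> insert x S1 = {})"
        using assms(7)[OF z(1)] unfolding reach_def z(2)
      proof (intro rob_avoid finV assms)
        have "card (insert x S1) \<le> k + 1" using S1 by (simp add: card_insert_if)
        then have "2 * real k * real (card (insert x S1)) \<le> 2 * real k * real (k + 1)"
          by (intro mult_left_mono) linarith+
        then show "2 * real k * real (card (insert x S1)) \<le> c * real (card V)" using assms(9) by linarith
      qed (use S1 in auto)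
    qed (use assms in auto)
  qed (use assms in auto)
  then show ?thesis unfolding reach_def
  proof (rule rob_mono[OF _ finV])
    fix S assume "\<exists>S0 S'. S = S0 \<union> S' \<and> (\<exists>z\<in>Z. S0 = {z}) \<and> 
      (\<exists>S1 S2. S' = S1 \<union> S2 \<and> (connects E {x} (S0) S1 \<and> S1 \<inter> {y} = {}) \<and>
        connects E (S0) {y} S2 \<and> S2 \<inter> insert x S1 = {})"
    then obtain z S1 S2 where "S = {z} \<union> (S1 \<union> S2)" "z \<in> Z" "connects E {x} {z} S1" "S1 \<inter> {y} = {}"
      "connects E {z} {y} S2" "S2 \<inter> insert x S1 = {}" by metis
    moreover from this have "x \<noteq> z" "y \<noteq> z" "y \<notin> S1" "x \<notin> S2" "S1 \<inter> S2 = {}" using assms(2,3) by auto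
    ultimately show "connects E {x} {y} S" using assms(4) connects_trans by simp
  qed simp
qed

text \<open>Exchanges on disjoint sets run side by side; both connecting sets have to avoid the
  vertices of the other exchange, which halves both constants.\<close>

lemma reach_Un:
  assumes "reach c k X1 Y1" "reach d j X2 Y2" "0 \<le> c" "0 \<le> d" "V \<noteq> {}"
    and "(X1 \<union> Y1) \<inter> (X2 \<union> Y2) = {}" "finite (X1 \<union> Y1)" "finite (X2 \<union> Y2)"
    and "2 * real k * real (card (X2 \<union> Y2)) \<le> c * real (card V)"
    and "2 * real j * real (card (X1 \<union> Y1) + k) \<le> d * real (card V)"
  shows "reach (c / 2 * (d / 2)) (k + j) (X1 \<union> X2) (Y1 \<union> Y2)"
proof -
  have "rob V (c / 2 * (d / 2)) (k + j) (\<lambda>S. \<exists>S1 S2. S = S1 \<union> S2 \<and>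
    (connects E X1 Y1 S1 \<and> S1 \<inter> (X2 \<union> Y2) = {}) \<and>
    (connects E X2 Y2 S2 \<and> S2 \<inter> (X1 \<union> Y1 \<union> S1) = {}))"
  proof (rule rob_Un[OF _ finV])
    show "rob V (c / 2) k (\<lambda>S1. connects E X1 Y1 S1 \<and> S1 \<inter> (X2 \<union> Y2) = {})"
      using assms by (intro rob_avoid finV) (auto simp: reach_def)
  next
    fix S1 :: "'a set" assume S1: "card S1 \<le> k" "finite S1"
    have "card (X1 \<union> Y1 \<union> S1) \<le> card (X1 \<union> Y1) + k"
      using S1 card_Un_le[of "X1 \<union> Y1" S1] by linarith
    then have "2 * real j * real (card (X1 \<union> Y1 \<union> S1)) \<le> 2 * real j * real (card (X1 \<union> Y1) + k)"
      by (intro mult_left_mono) linarith+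
    then show "rob V (d / 2) j (\<lambda>S2. connects E X2 Y2 S2 \<and> S2 \<inter> (X1 \<union> Y1 \<union> S1) = {})"
      using assms S1 by (intro rob_avoid finV) (auto simp: reach_def)
  qed (use assms in auto)
  then show ?thesis unfolding reach_def
    using assms(6) by (elim rob_mono[OF _ finV]) (auto intro: connects_Un)
qed

text \<open>The elements of \<open>X\<close> and \<open>Y\<close> are paired off arbitrarily. Each
  new pair multiplies the constant by c/4, because \<open>reach_Un\<close> halves both factors.
  \<open>R\<close> is a fixed bound on the size, so that the requirement on \<open>card V\<close>
  stays the same throughout the induction.\<close>

lemma reach_sets:
  assumes "finite X" "finite Y" "card X = r" "card Y = r" "X \<inter> Y = {}" "r \<le> R" "1 \<le> R"
    and "\<And>x y. x \<in> X \<Longrightarrow> y \<in> Y \<Longrightarrow> reach c k {x} {y}"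
    and "0 < c" "c \<le> 1" "V \<noteq> {}" "4 * real k * (real R + 1) * (real k + 2) \<le> (c / 4) ^ R * real (card V)"
  shows "reach ((c / 4) ^ r) (r * k) X Y"
  using assms(1-6,8)
proof (induction r arbitrary: X Y)
  case 0
  have "connects E {} {} {}" by (simp add: connects_def tileable_empty)
  then have "{l. set l \<subseteq> V \<and> length l = 0 \<and> (\<exists>S\<subseteq>set l. connects E {} {} S)} = {[]}" by auto
  then have "rob V 1 0 (connects E {} {})" unfolding rob_def by simp
  then show ?case using 0 unfolding reach_def by simp
next
  case (Suc r)
  obtain x X' where X: "X = insert x X'" "x \<notin> X'" "card X' = r" using Suc.prems(3) by (metis card_Suc_eq)
  obtain y Y' where Y: "Y = insert y Y'" "y \<notin> Y'" "card Y' = r" using Suc.prems(4) by (metis card_Suc_eq)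
  have fin: "finite X'" "finite Y'" using Suc.prems X Y by auto
  have c4: "0 < c / 4" "c / 4 \<le> 1" using assms by auto
  have 1: "(c / 4) ^ R * real (card V) \<le> (c / 4) ^ r * real (card V)"
    using c4 Suc.prems by (intro mult_right_mono power_decreasing) auto
  have "(c / 4) ^ R \<le> (c / 4) ^ 1" using c4 assms by (intro power_decreasing) auto
  then have 2: "(c / 4) ^ R * real (card V) \<le> c * real (card V)"
    using c4 by (intro mult_right_mono) auto
  have cXY: "card ({x} \<union> {y}) \<le> 2" by (rule order_trans[OF card_Un_le]) simp
  have cXY': "card (X' \<union> Y') \<le> 2 * r" using card_Un_le[of X' Y'] X Y by simp
  have rR: "real r \<le> real R" using Suc.prems by simp
  have "2 * real (r * k) * real (card ({x} \<union> {y})) \<le> 2 * (real R * real k) * 2"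
    using cXY rR by (intro mult_mono) (auto simp: mult_mono)
  also have "\<dots> = 4 * real k * (real R) * 1" by simp
  also have "\<dots> \<le> 4 * real k * (real R + 1) * (real k + 2)" by (intro mult_mono) auto
  finally have 3: "2 * real (r * k) * real (card ({x} \<union> {y})) \<le> (c / 4) ^ r * real (card V)"
    using 1 assms by linarith
  have "real (card (X' \<union> Y') + r * k) \<le> 2 * real r + real r * real k"
    using cXY' by (metis of_nat_add of_nat_le_iff of_nat_mult of_nat_numeral add_le_mono1)
  also have "\<dots> = real r * (real k + 2)" by (simp add: algebra_simps)
  also have "\<dots> \<le> (real R + 1) * (real k + 2)" using rR by (intro mult_right_mono) auto
  finally have "2 * real k * real (card (X' \<union> Y') + r * k) \<le> 4 * real k * ((real R + 1) * (real k + 2))"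
    by (intro mult_mono) auto
  then have 4: "2 * real k * real (card (X' \<union> Y') + r * k) \<le> c * real (card V)"
    using 2 assms by (simp add: mult.assoc)
  have "reach ((c / 4) ^ r) (r * k) X' Y'" using Suc.prems X Y fin by (intro Suc.IH) auto
  moreover have "reach c k {x} {y}" using Suc.prems X Y by auto
  ultimately have "reach ((c / 4) ^ r / 2 * (c / 2)) (r * k + k) (X' \<union> {x}) (Y' \<union> {y})"
    using c4 assms fin Suc.prems X Y 3 4 by (intro reach_Un) auto
  then show ?case using X Y by (simp add: mult.commute add.commute)
qed

text \<open>Inclusion-exclusion for the three links. The vertices need not be distinct, so the
  statement also yields that every vertex is close to itself.\<close>

lemma no_three_nonclose:
  assumes "\<And>v. v \<in> V \<Longrightarrow> 2 / 5 * (real (card V))\<^sup>2 \<le> real (pdeg v)" "V \<noteq> {}"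
    and "x \<in> V" "y \<in> V" "z \<in> V"
  shows "close x y \<or> close y z \<or> close x z"
proof (rule ccontr)
  define n where "n = real (card V)"
  define L where "L v = {(a, b). a \<in> V \<and> b \<in> V \<and> {v, a, b} \<in> E}" for v
  assume "\<not> ?thesis"
  moreover have "L u \<inter> L v = {(a, b). a \<in> V \<and> b \<in> V \<and> {u, a, b} \<in> E \<and> {v, a, b} \<in> E}" for u v
    by (auto simp: L_def)
  ultimately have I: "real (card (L x \<inter> L y)) < 1/20 * n * n" "real (card (L y \<inter> L z)) < 1/20 * n * n"
    "real (card (L x \<inter> L z)) < 1/20 * n * n" unfolding close_def n_def by auto
  have n: "n > 0" using assms(2) finV by (simp add: n_def card_gt_0_iff)
  have LV: "L v \<subseteq> V \<times> V" for v by (auto simp: L_def)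
  have fin: "finite (L v)" for v using finite_subset[OF LV] finV by auto
  have "L v = {(x, y) \<in> V \<times> V. {v, x, y} \<in> E}" for v by (auto simp: L_def)
  then have d: "2 / 5 * (n * n) \<le> real (card (L v))" if "v \<in> V" for v
    using assms(1)[OF that] unfolding pdeg_def n_def power2_eq_square by simp
  have "card (L x \<union> L y \<union> L z) \<le> card (V \<times> V)" using LV finV by (intro card_mono) auto
  then have 1: "real (card (L x \<union> L y \<union> L z)) \<le> n * n"
    unfolding n_def card_cartesian_product by (metis of_nat_le_iff of_nat_mult)
  have "card (L x \<union> L y) + card (L x \<inter> L y) = card (L x) + card (L y)"
    using fin by (metis card_Un_Int)
  moreover have "card (L x \<union> L y \<union> L z) + card ((L x \<union> L y) \<inter> L z) = card (L x \<union> L y) + card (L z)"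
    using fin by (metis card_Un_Int finite_UnI)
  moreover have "card ((L x \<union> L y) \<inter> L z) \<le> card (L x \<inter> L z) + card (L y \<inter> L z)"
    by (metis Int_Un_distrib2 card_Un_le)
  ultimately have "card (L x) + card (L y) + card (L z) \<le> card (L x \<union> L y \<union> L z) + card (L x \<inter> L y)
     + card (L x \<inter> L z) + card (L y \<inter> L z)" by linarith
  then have "real (card (L x)) + real (card (L y)) + real (card (L z)) \<le> real (card (L x \<union> L y \<union> L z))
     + real (card (L x \<inter> L y)) + real (card (L x \<inter> L z)) + real (card (L y \<inter> L z))" by linarith
  then have "3 * (2 / 5 * (n * n)) < n * n + 3 * (1/20 * n * n)"
    using d[OF assms(3)] d[OF assms(4)] d[OF assms(5)] I 1 by linarith
  then show False using n by (simp add: zero_less_mult_iff)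
qed

text \<open>Cherries in the incidence graph between ordered pairs and vertices: a pair with two
  vertices completing it. Which two vertices of an edge serve as the pair is left to
  \<open>R\<close>, so the same edges can be read in several ways.\<close>

lemma rob_cherries_pairs:
  assumes "\<theta> * real (card V) ^ 3 \<le> real (card {(p, c). p \<in> V \<times> V \<and> c \<in> V \<and> R p c})"
    and "0 \<le> \<theta>" "2 \<le> \<theta>\<^sup>2 * real (card V)"
  shows "rob V (\<theta>\<^sup>2 / 2) 4 (\<lambda>S. \<exists>a b c c'. S = {a, b, c, c'} \<and> c \<noteq> c' \<and> R (a, b) c \<and> R (a, b) c')"
proof -
  have ne: "V \<times> V \<noteq> {}" using assms(3) by auto
  have cV: "real (card (V \<times> V)) = real (card V) * real (card V)" by (simp add: card_cartesian_product)
  let ?X = "{(p, c, c'). p \<in> V \<times> V \<and> c \<in> V \<and> c' \<in> V \<and> c \<noteq> c' \<and> R p c \<and> R p c'}"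
  have "\<theta>\<^sup>2 / 2 * real (card (V \<times> V)) * (real (card V))\<^sup>2 \<le> real (card ?X)"
    using assms finV ne cV by (intro card_cherries) (auto simp: power3_eq_cube mult.assoc)
  then have "\<theta>\<^sup>2 / 2 * real (card V) ^ 4 \<le> real (card ?X)"
    unfolding cV by (simp add: power2_eq_square power4_eq_xxxx mult.assoc)
  moreover have "inj_on (\<lambda>((a, b), c, c'). [a, b, c, c']) ?X" by (auto simp: inj_on_def)
  ultimately show ?thesis
    by (intro robI_inj[OF finV, where X = ?X and g = "\<lambda>((a, b), c, c'). [a, b, c, c']"]) fastforce+
qed

text \<open>The edges of type \<open>AAB\<close> yield copies meeting \<open>A\<close> in three and copies meeting \<open>A\<close> in two
  vertices; exchanging one of the former for one of the latter connects \<open>A\<close> to \<open>B\<close>.\<close>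

lemma reach_cross:
  assumes AB: "A \<subseteq> V" "B \<subseteq> V" "A \<inter> B = {}"
    and clA: "\<And>x y. x \<in> A \<Longrightarrow> y \<in> A \<Longrightarrow> x \<noteq> y \<Longrightarrow> close x y"
    and clB: "\<And>x y. x \<in> B \<Longrightarrow> y \<in> B \<Longrightarrow> x \<noteq> y \<Longrightarrow> close x y"
    and dense: "\<kappa> * real (card V) ^ 3 \<le> real (card {(a, b, a'). a \<in> A \<and> b \<in> B \<and> a' \<in> A \<and> {a, b, a'} \<in> E})"
    and \<kappa>: "0 \<le> \<kappa>" "96 \<le> \<kappa>\<^sup>2 * real (card V)"
    and n: "10 ^ 13 \<le> card V" and ab: "a \<in> A" "b \<in> B"
  shows "reach (\<kappa>\<^sup>2 / 4 * (\<kappa>\<^sup>2 / 4 * ((1 / 3200) ^ 5 / 4))) 23 {a} {b}"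
proof -
  define P where "P i j S \<longleftrightarrow> quad E S \<and> S \<subseteq> A \<union> B \<and> card (S \<inter> A) = i \<and> card (S \<inter> B) = j" for i j :: nat and S
  let ?D = "{(a, b, a'). a \<in> A \<and> b \<in> B \<and> a' \<in> A \<and> {a, b, a'} \<in> E}"
  have ne: "V \<noteq> {}" using ab AB by auto
  have fD: "finite ?D" using AB finV
    by (intro finite_subset[of ?D "V \<times> V \<times> V"]) auto
  have real_n: "10 ^ 13 \<le> real (card V)" using n by (metis of_nat_le_iff of_nat_numeral of_nat_power)
  have P31: "rob V (\<kappa>\<^sup>2 / 2) 4 (P 3 1)"
  proof -
    \<comment> \<open>An edge of type AAB is read as a vertex of \<open>A\<close> completing a pair
      in A x B. Two completions give a copy with three vertices in \<open>A\<close>.\<close>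
    let ?R = "\<lambda>p c. fst p \<in> A \<and> snd p \<in> B \<and> c \<in> A \<and> {fst p, snd p, c} \<in> E"
    have "{(p, c). p \<in> V \<times> V \<and> c \<in> V \<and> ?R p c} = (\<lambda>(a, b, c). ((a, b), c)) ` ?D"
      using AB by (auto simp: image_iff)
    moreover have "card ((\<lambda>(a, b, c). ((a, b), c)) ` ?D) = card ?D"
      by (rule card_image) (auto simp: inj_on_def)
    ultimately have "rob V (\<kappa>\<^sup>2 / 2) 4 (\<lambda>S. \<exists>a b c c'. S = {a, b, c, c'} \<and> c \<noteq> c' \<and> ?R (a, b) c \<and> ?R (a, b) c')"
      using dense \<kappa> by (intro rob_cherries_pairs) auto
    then show ?thesis
    proof (rule rob_mono[OF _ finV])
      fix S assume "\<exists>a b c c'. S = {a, b, c, c'} \<and> c \<noteq> c' \<and> ?R (a, b) c \<and> ?R (a, b) c'"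
      then obtain a b c c' where S: "S = {a, b, c, c'}" "c \<noteq> c'" "a \<in> A" "b \<in> B" "c \<in> A" "c' \<in> A"
        "{a, b, c} \<in> E" "{a, b, c'} \<in> E" by auto
      note d = edge_distinct[OF S(7)] edge_distinct[OF S(8)]
      have "quad E S" using quad_two_edges[OF S(7,8)] d S by auto
      moreover have "S \<inter> A = {a, c, c'}" "S \<inter> B = {b}" using S AB by auto
      moreover have "card {a, c, c'} = 3" using d S(2) by auto
      ultimately show "P 3 1 S" unfolding P_def using S by auto
    qed simp
  qed
  have P22: "rob V (\<kappa>\<^sup>2 / 2) 4 (P 2 2)"
  proof -
    \<comment> \<open>The same edges, now read as a vertex of \<open>B\<close> completing a pair in
      A x A. Two completions give a copy with two vertices on either side.\<close>
    let ?R = "\<lambda>p c. fst p \<in> A \<and> snd p \<in> A \<and> c \<in> B \<and> {fst p, snd p, c} \<in> E"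
    have "{(p, c). p \<in> V \<times> V \<and> c \<in> V \<and> ?R p c} = (\<lambda>(a, b, c). ((a, c), b)) ` ?D"
      using AB by (auto simp: image_iff insert_commute)
    moreover have "card ((\<lambda>(a, b, c). ((a, c), b)) ` ?D) = card ?D"
      by (rule card_image) (auto simp: inj_on_def)
    ultimately have "rob V (\<kappa>\<^sup>2 / 2) 4 (\<lambda>S. \<exists>a b c c'. S = {a, b, c, c'} \<and> c \<noteq> c' \<and> ?R (a, b) c \<and> ?R (a, b) c')"
      using dense \<kappa> by (intro rob_cherries_pairs) auto
    then show ?thesis
    proof (rule rob_mono[OF _ finV])
      fix S assume "\<exists>a b c c'. S = {a, b, c, c'} \<and> c \<noteq> c' \<and> ?R (a, b) c \<and> ?R (a, b) c'"
      then obtain a b c c' where S: "S = {a, b, c, c'}" "c \<noteq> c'" "a \<in> A" "b \<in> A" "c \<in> B" "c' \<in> B"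
        "{a, b, c} \<in> E" "{a, b, c'} \<in> E" by auto
      note d = edge_distinct[OF S(7)] edge_distinct[OF S(8)]
      have "quad E S" using quad_two_edges[OF S(7,8)] d S by auto
      moreover have "S \<inter> A = {a, b}" "S \<inter> B = {c, c'}" using S AB by auto
      moreover have "card {a, b} = 2" "card {c, c'} = 2" using d S(2) by auto
      ultimately show "P 2 2 S" unfolding P_def using S by auto
    qed simp
  qed
  \<comment> \<open>240 = 4 * 3 * (3 + 1) * (3 + 2) is what \<open>reach_sets\<close> demands for k
    = R = 3. The bound 10^13 on \<open>card V\<close> exceeds 240 * 3200^3.\<close>
  have n240: "240 \<le> (1 / 800 / 4) ^ 3 * real (card V)" using real_n by (simp add: power_divide)
  have n180: "240 \<le> (1 / 800 / 4) ^ 2 * real (card V)" using real_n by (simp add: power_divide)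
  \<comment> \<open>Both \<open>a + S2\<close> and \<open>b + S1\<close> have three vertices in
    \<open>A\<close> and two in \<open>B\<close>. They can therefore be exchanged by five exchanges
    of close vertices within the parts, which gives the constant (1/3200)^5 / 4 and the length
    15.\<close>
  have S3: "rob V ((1 / 3200) ^ 5 / 4) 15 (connects E ({a} \<union> S2) ({b} \<union> S1))"
    if S1: "P 3 1 S1" "S1 \<inter> {a, b} = {}" and S2: "P 2 2 S2" "S2 \<inter> ({a, b} \<union> S1) = {}" for S1 S2
  proof -
    have fin: "finite S1" "finite S2" using S1 S2 by (auto simp: P_def dest: quad_finite)
    note p = S1(1)[unfolded P_def] S2(1)[unfolded P_def]
    have cc: "reach (1 / 800) 3 {x} {y}" if "x \<in> A \<and> y \<in> A \<or> x \<in> B \<and> y \<in> B" "x \<noteq> y" for x y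
      using that clA clB n by (intro close_reach) auto
    have "reach ((1 / 800 / 4) ^ 3) (3 * 3) ({a} \<union> (S2 \<inter> A)) (S1 \<inter> A)"
    proof (rule reach_sets[where R = 3])
      have "a \<notin> S2 \<inter> A" using S2 by auto
      then show "card ({a} \<union> (S2 \<inter> A)) = 3" using p fin by simp
      show "reach (1 / 800) 3 {x} {y}" if "x \<in> {a} \<union> (S2 \<inter> A)" "y \<in> S1 \<inter> A" for x y
        using that S1 S2 ab by (intro cc) auto
    qed (use fin p S1 S2 ne n240 in auto)
    moreover have "reach ((1 / 800 / 4) ^ 2) (2 * 3) (S2 \<inter> B) ({b} \<union> (S1 \<inter> B))"
    proof (rule reach_sets[where R = 3])
      have "b \<notin> S1 \<inter> B" using S1 by auto
      then show "card ({b} \<union> (S1 \<inter> B)) = 2" using p fin by simp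
      show "reach (1 / 800) 3 {x} {y}" if "x \<in> S2 \<inter> B" "y \<in> {b} \<union> (S1 \<inter> B)" for x y
        using that S1 S2 ab by (intro cc) auto
    qed (use fin p S1 S2 ne n240 in auto)
    ultimately have "reach ((1 / 800 / 4) ^ 3 / 2 * ((1 / 800 / 4) ^ 2 / 2)) (3 * 3 + 2 * 3)
      (({a} \<union> (S2 \<inter> A)) \<union> (S2 \<inter> B)) ((S1 \<inter> A) \<union> ({b} \<union> (S1 \<inter> B)))"
    proof (rule reach_Un)
      show "({a} \<union> S2 \<inter> A \<union> S1 \<inter> A) \<inter> (S2 \<inter> B \<union> ({b} \<union> S1 \<inter> B)) = {}"
        using S1 S2 ab AB by auto
      have "card (S2 \<inter> B \<union> ({b} \<union> S1 \<inter> B)) \<le> card (S2 \<inter> B) + (card {b} + card (S1 \<inter> B))"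
        by (meson card_Un_le add_left_mono order_trans)
      then have "real (card (S2 \<inter> B \<union> ({b} \<union> S1 \<inter> B))) \<le> 4" using p by simp
      then show "2 * real (3 * 3) * real (card (S2 \<inter> B \<union> ({b} \<union> S1 \<inter> B))) \<le> (1 / 800 / 4) ^ 3 * real (card V)"
        using n240 by simp
      have "card ({a} \<union> S2 \<inter> A \<union> S1 \<inter> A) \<le> (card {a} + card (S2 \<inter> A)) + card (S1 \<inter> A)"
        by (meson card_Un_le add_right_mono order_trans)
      then have "real (card ({a} \<union> S2 \<inter> A \<union> S1 \<inter> A) + 3 * 3) \<le> 15" using p by simp
      then show "2 * real (2 * 3) * real (card ({a} \<union> S2 \<inter> A \<union> S1 \<inter> A) + 3 * 3) \<le> (1 / 800 / 4)\<^sup>2 * real (card V)"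
        using n180 by simp
    qed (use fin ne in auto)
    moreover have "({a} \<union> (S2 \<inter> A)) \<union> (S2 \<inter> B) = {a} \<union> S2" "(S1 \<inter> A) \<union> ({b} \<union> (S1 \<inter> B)) = {b} \<union> S1"
      using p by auto
    moreover have "(1 / 800 / 4) ^ 3 / 2 * ((1 / 800 / 4) ^ 2 / 2) = (1 / 3200) ^ 5 / (4 :: real)" by (simp add: power_divide)
    ultimately show ?thesis unfolding reach_def by simp
  qed
  have "rob V (\<kappa>\<^sup>2 / 4 * (\<kappa>\<^sup>2 / 4 * ((1 / 3200) ^ 5 / 4))) (4 + (4 + 15))
    (\<lambda>S. \<exists>S1 S'. S = S1 \<union> S' \<and> (P 3 1 S1 \<and> S1 \<inter> {a, b} = {}) \<and>
      (\<exists>S2 S3. S' = S2 \<union> S3 \<and> (P 2 2 S2 \<and> S2 \<inter> ({a, b} \<union> S1) = {}) \<and>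
        connects E ({a} \<union> S2) ({b} \<union> S1) S3))"
  proof (rule rob_Un[OF _ finV])
    have "card {a, b} \<le> 2" by (simp add: card_insert_if)
    then show "rob V (\<kappa>\<^sup>2 / 4) 4 (\<lambda>S1. P 3 1 S1 \<and> S1 \<inter> {a, b} = {})"
      using rob_avoid[OF P31 finV ne, of "{a, b}"] \<kappa> by simp
  next
    fix S1 :: "'a set" assume S1: "finite S1" "card S1 \<le> 4" "P 3 1 S1 \<and> S1 \<inter> {a, b} = {}"
    show "rob V (\<kappa>\<^sup>2 / 4 * ((1 / 3200) ^ 5 / 4)) (4 + 15)
      (\<lambda>S'. \<exists>S2 S3. S' = S2 \<union> S3 \<and> (P 2 2 S2 \<and> S2 \<inter> ({a, b} \<union> S1) = {}) \<and>
        connects E ({a} \<union> S2) ({b} \<union> S1) S3)"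
    proof (rule rob_Un[OF _ finV])
      have "card ({a, b} \<union> S1) \<le> card {a, b} + card S1" by (rule card_Un_le)
      also have "\<dots> \<le> 6" using S1 by (simp add: card_insert_if)
      finally show "rob V (\<kappa>\<^sup>2 / 4) 4 (\<lambda>S2. P 2 2 S2 \<and> S2 \<inter> ({a, b} \<union> S1) = {})"
        using rob_avoid[OF P22 finV ne, of "{a, b} \<union> S1"] \<kappa> S1 by simp
    qed (use S1 S3 \<kappa> in auto)
  qed (use \<kappa> in auto)
  then show ?thesis unfolding reach_def
  proof (rule rob_mono[OF rob_pad[OF _ finV] finV])
    fix S assume "\<exists>S1 S'. S = S1 \<union> S' \<and> (P 3 1 S1 \<and> S1 \<inter> {a, b} = {}) \<and>
      (\<exists>S2 S3. S' = S2 \<union> S3 \<and> (P 2 2 S2 \<and> S2 \<inter> ({a, b} \<union> S1) = {}) \<and>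
        connects E ({a} \<union> S2) ({b} \<union> S1) S3)"
    then obtain S1 S2 S3 where S: "S = S1 \<union> (S2 \<union> S3)" "P 3 1 S1" "S1 \<inter> {a, b} = {}" "P 2 2 S2"
      "S2 \<inter> ({a, b} \<union> S1) = {}" "connects E ({a} \<union> S2) ({b} \<union> S1) S3" by auto
    note c = S(6)[unfolded connects_def]
    have t: "tileable E S1" "tileable E S2" using S by (auto simp: P_def intro: quad_tileable)
    \<comment> \<open>With \<open>a\<close>, the copy \<open>S1\<close> stays and \<open>S2\<close>
      is broken up; with \<open>b\<close>, the copy \<open>S2\<close> stays and \<open>S1\<close> is
      broken up. The set used is the same in both cases.\<close>
    have "S1 \<inter> ({a} \<union> S2 \<union> S3) = {}" "S2 \<inter> ({b} \<union> S1 \<union> S3) = {}" using c S by auto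
    then have "tileable E (S1 \<union> ({a} \<union> S2 \<union> S3))" "tileable E (S2 \<union> ({b} \<union> S1 \<union> S3))"
      using tileable_Un[OF t(1)] tileable_Un[OF t(2)] c by metis+
    moreover have "S1 \<union> ({a} \<union> S2 \<union> S3) = {a} \<union> S" "S2 \<union> ({b} \<union> S1 \<union> S3) = {b} \<union> S" using S(1) by auto
    moreover have "S \<inter> ({a} \<union> {b}) = {}" using S c by auto
    ultimately show "connects E {a} {b} S" unfolding connects_def by simp
  qed (use \<kappa> in auto)
qed

text \<open>As \<open>A\<close> has at most half of the vertices, the links of its vertices cannot
  be filled by pairs inside \<open>A\<close>. Many edges of type AAB or ABB result, and whichever
  type is frequent feeds \<open>reach_cross\<close>, with \<open>A\<close> and \<open>B\<close>
  interchanged in the second case.\<close>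

lemma reach_cross_small:
  assumes AB: "A \<subseteq> V" "B \<subseteq> V" "A \<inter> B = {}"
    and clA: "\<And>x y. x \<in> A \<Longrightarrow> y \<in> A \<Longrightarrow> x \<noteq> y \<Longrightarrow> close x y"
    and clB: "\<And>x y. x \<in> B \<Longrightarrow> y \<in> B \<Longrightarrow> x \<noteq> y \<Longrightarrow> close x y"
    and deg: "\<And>v. v \<in> V \<Longrightarrow> 2 / 5 * (real (card V))\<^sup>2 \<le> real (pdeg v)"
    and cA: "real (card A) \<le> real (card V) / 2" "3 / 40 * real (card V) \<le> real (card A)"
    and cX: "real (card (V - A - B)) \<le> real (card V) / 40"
    and n: "10 ^ 13 \<le> card V" and ab: "a \<in> A" "b \<in> B"
  shows "reach ((1 / 400) ^ 4 / 16 * ((1 / 3200) ^ 5 / 4)) 23 {a} {b}"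
proof -
  define m where "m = real (card V)"
  define X where "X = V - A - B"
  define D where "D S T = {(u, v, w). u \<in> A \<and> v \<in> S \<and> w \<in> T \<and> {u, v, w} \<in> E}" for S T
  define L where "L S T a = {(v, w). v \<in> S \<and> w \<in> T \<and> {a, v, w} \<in> E}" for S T a
  have m: "10 ^ 13 \<le> m" unfolding m_def using n by (metis of_nat_le_iff of_nat_numeral of_nat_power)
  have fin: "finite A" "finite B" "finite X" using AB finV by (auto simp: X_def intro: finite_subset)
  have Lsub: "L S T a \<subseteq> S \<times> T" for S T a by (auto simp: L_def)
  have fL: "finite (L S T a)" if "finite S" "finite T" for S T a using finite_subset[OF Lsub] that by auto
  have cL: "real (card (L S T a)) \<le> real (card S) * real (card T)" if "finite S" "finite T" for S T a
    using card_mono[OF _ Lsub, of S T a] that by (simp add: card_cartesian_product flip: of_nat_mult)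
  have cD: "card (D S T) = (\<Sum>a\<in>A. card (L S T a))" if "finite S" "finite T" for S T
  proof -
    have "D S T = Sigma A (L S T)" by (auto simp: D_def L_def)
    then show ?thesis using fin fL[OF that] by simp
  qed
  \<comment> \<open>Pairs inside \<open>A\<close> account for 1/4 and pairs meeting the exceptional
    set for 2 * 1/40 of all pairs, and 2/5 - 1/4 - 1/20 = 1/10.\<close>
  have one: "m\<^sup>2 / 10 \<le> real (card (L A B a)) + real (card (L B A a)) + real (card (L B B a))" if "a \<in> A" for a
  proof -
    have "L V V a = {(x, y) \<in> V \<times> V. {a, x, y} \<in> E}" by (auto simp: L_def)
    then have d: "2 / 5 * m\<^sup>2 \<le> real (card (L V V a))" using deg[of a] that AB unfolding pdeg_def m_def by auto
    have "L V V a \<subseteq> ((((L A A a \<union> L X V a) \<union> L V X a) \<union> L A B a) \<union> L B A a) \<union> L B B a"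
      by (auto simp: L_def X_def)
    then have "card (L V V a) \<le> card (((((L A A a \<union> L X V a) \<union> L V X a) \<union> L A B a) \<union> L B A a) \<union> L B B a)"
      using fin finV fL by (intro card_mono) auto
    also have "\<dots> \<le> card (L A A a) + card (L X V a) + card (L V X a) + card (L A B a) + card (L B A a) + card (L B B a)"
      by (meson add_right_mono card_Un_le order_trans)
    finally have "real (card (L V V a)) \<le> real (card (L A A a)) + real (card (L X V a)) + real (card (L V X a))
      + real (card (L A B a)) + real (card (L B A a)) + real (card (L B B a))" by linarith
    moreover have "real (card (L A A a)) \<le> m / 2 * (m / 2)"
      using cL[of A A a] fin cA mult_mono[of "real (card A)" "m / 2" "real (card A)" "m / 2"] unfolding m_def by linarith
    moreover have "real (card (L X V a)) \<le> m / 40 * m"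
      using cL[of X V a] fin finV cX mult_right_mono[of "real (card X)" "m / 40" m] unfolding m_def X_def by linarith
    moreover have "real (card (L V X a)) \<le> m * (m / 40)"
      using cL[of V X a] fin finV cX mult_left_mono[of "real (card X)" "m / 40" m] unfolding m_def X_def by linarith
    ultimately show ?thesis using d by (simp add: power2_eq_square)
  qed
  have "real (card A) * (m\<^sup>2 / 10) = (\<Sum>a\<in>A. m\<^sup>2 / 10)" by simp
  also have "\<dots> \<le> (\<Sum>a\<in>A. real (card (L A B a)) + real (card (L B A a)) + real (card (L B B a)))"
    using one by (rule sum_mono)
  also have "\<dots> = real (card (D A B)) + real (card (D B A)) + real (card (D B B))"
    using fin by (simp add: cD sum.distrib)
  finally have s: "real (card A) * (m\<^sup>2 / 10) \<le> real (card (D A B)) + real (card (D B A)) + real (card (D B B))" .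
  have "3 / 40 * m * (m\<^sup>2 / 10) \<le> real (card A) * (m\<^sup>2 / 10)"
    using cA unfolding m_def by (intro mult_right_mono) auto
  \<comment> \<open>Two of the three sums count the same edges of type AAB in different order, so
    three terms share 3/40 * 1/10 and one of them reaches 1/400.\<close>
  then have s2: "3 * (1 / 400 * m ^ 3) \<le> real (card (D A B)) + real (card (D B A)) + real (card (D B B))"
    using s by (simp add: power2_eq_square power3_eq_cube)
  have inj: "inj_on (\<lambda>(u, v, w). (u, w, v)) Y" "inj_on (\<lambda>(u, v, w). (v, u, w)) Y" for Y :: "('a \<times> 'a \<times> 'a) set"
    by (auto simp: inj_on_def)
  have m96: "96 \<le> (1 / 400)\<^sup>2 * real (card V)" using m unfolding m_def by (simp add: power_divide)
  have "D A B = (\<lambda>(u, v, w). (u, w, v)) ` D B A"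
    by (auto simp: D_def image_iff insert_commute)
  then have "card (D A B) = card (D B A)" using card_image[OF inj(1), of "D B A"] by (simp only:)
  then consider "1 / 400 * m ^ 3 \<le> real (card (D B A))" | "1 / 400 * m ^ 3 \<le> real (card (D B B))"
    using s2 by linarith
  then have "reach ((1 / 400)\<^sup>2 / 4 * ((1 / 400)\<^sup>2 / 4 * ((1 / 3200) ^ 5 / 4))) 23 {a} {b}"
  proof cases
    case 1
    show ?thesis
      by (rule reach_cross[OF AB clA clB _ _ m96 n ab]) (use 1 in \<open>simp_all add: D_def m_def\<close>)
  next
    case 2
    have "{(b, a, b'). b \<in> B \<and> a \<in> A \<and> b' \<in> B \<and> {b, a, b'} \<in> E} = (\<lambda>(u, v, w). (v, u, w)) ` D B B"
      by (auto simp: D_def image_iff insert_commute)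
    then have "card {(b, a, b'). b \<in> B \<and> a \<in> A \<and> b' \<in> B \<and> {b, a, b'} \<in> E} = card (D B B)"
      using card_image[OF inj(2), of "D B B"] by (simp only:)
    then have "reach ((1 / 400)\<^sup>2 / 4 * ((1 / 400)\<^sup>2 / 4 * ((1 / 3200) ^ 5 / 4))) 23 {b} {a}"
      using 2 AB(3)
      by (intro reach_cross[OF AB(2,1) _ clB clA _ _ m96 n ab(2,1)]) (simp_all add: m_def Int_commute)
    then show ?thesis by (rule reach_sym)
  qed
  then show ?thesis by (simp add: power_divide)
qed

text \<open>Three links of density above \<open>1/3\<close> cannot be pairwise almost disjoint, so the closeness graph has no
  independent set of size three. Hence either any two vertices that are not close have many common
  neighbours, or closeness is essentially a union of two cliques.\<close>

lemma core_exists: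
  assumes deg: "\<And>v. v \<in> V \<Longrightarrow> 2 / 5 * (real (card V))\<^sup>2 \<le> real (pdeg v)"
    and n: "10 ^ 13 \<le> card V"
  obtains C where "C \<subseteq> V" "real (card (V - C)) \<le> real (card V) / 10"
    "\<And>x y. x \<in> C \<Longrightarrow> y \<in> C \<Longrightarrow> x \<noteq> y \<Longrightarrow> reach ((1 / 400) ^ 4 / 16 * ((1 / 3200) ^ 5 / 4)) 23 {x} {y}"
proof -
  define c0 :: real where "c0 = (1 / 400) ^ 4 / 16 * ((1 / 3200) ^ 5 / 4)"
  have c0: "0 \<le> c0" "c0 \<le> 1 / 800" "c0 \<le> 1 / 40 * (1 / 800 / 2 * (1 / 800 / 2))"
    unfolding c0_def by (simp_all add: power_divide)
  have real_n: "10 ^ 13 \<le> real (card V)" using n by (metis of_nat_le_iff of_nat_numeral of_nat_power)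
  have ne: "V \<noteq> {}" using n by auto
  note three = no_three_nonclose[OF deg ne]
  have cr: "reach c0 23 {x} {y}" if "close x y" for x y
    using reach_mono[OF close_reach[OF that]] c0 n by auto
  define Z where "Z x y = {z \<in> V - {x, y}. close x z \<and> close z y}" for x y
  have two: "reach c0 23 {x} {y}" if "x \<noteq> y" "real (card V) / 40 \<le> real (card (Z x y))" for x y
  proof -
    have "reach (1 / 40 * (1 / 800 / 2 * (1 / 800 / 2))) (1 + (3 + 3)) {x} {y}"
      using that n real_n ne
      by (intro reach_two_step[where Z = "Z x y"]) (auto simp: Z_def intro!: close_reach)
    then show ?thesis by (rule reach_mono) (use c0 in auto)
  qed
  have "\<exists>C\<subseteq>V. real (card (V - C)) \<le> real (card V) / 10 \<and>
    (\<forall>x\<in>C. \<forall>y\<in>C. x \<noteq> y \<longrightarrow> reach c0 23 {x} {y})"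
  \<comment> \<open>In the first case two steps connect any pair that is not close and the core is
    all of \<open>V\<close>; otherwise one violating pair determines a partition.\<close>
  proof (cases "\<forall>x\<in>V. \<forall>y\<in>V. x \<noteq> y \<longrightarrow> \<not> close x y \<longrightarrow> real (card V) / 40 \<le> real (card (Z x y))")
    case True
    then have "\<forall>x\<in>V. \<forall>y\<in>V. x \<noteq> y \<longrightarrow> reach c0 23 {x} {y}" using cr two by blast
    then show ?thesis by (intro exI[of _ V]) simp
  next
    case False
    then obtain x y where xy: "x \<in> V" "y \<in> V" "x \<noteq> y" "\<not> close x y" "real (card (Z x y)) < real (card V) / 40"
      by force
    \<comment> \<open>Here \<open>x\<close> lies in \<open>A\<close> and \<open>y\<close> in
      \<open>B\<close>. Any two members of \<open>A\<close> are close, since neither is close to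
      \<open>y\<close>; likewise for \<open>B\<close> and \<open>x\<close>. A vertex outside both
      parts is close to \<open>x\<close> and to \<open>y\<close>, hence lies in the small set
      \<open>Z x y\<close>.\<close>
    define A where "A = {v \<in> V - {y}. \<not> close v y}"
    define B where "B = {v \<in> V - {x}. \<not> close v x}"
    have AB: "A \<subseteq> V" "B \<subseteq> V" by (auto simp: A_def B_def)
    have disj: "A \<inter> B = {}"
    proof -
      have False if "v \<in> A" "v \<in> B" for v
        using three[of v x y] that xy close_sym by (auto simp: A_def B_def)
      then show ?thesis by auto
    qed
    have clA: "close u v" if "u \<in> A" "v \<in> A" for u v
      using three[of u y v] that xy close_sym by (auto simp: A_def)
    have clB: "close u v" if "u \<in> B" "v \<in> B" for u v
      using three[of u x v] that xy close_sym by (auto simp: B_def)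
    have "V - A - B \<subseteq> Z x y" using xy close_sym by (auto simp: A_def B_def Z_def)
    moreover have "finite (Z x y)" using finV by (simp add: Z_def)
    ultimately have "card (V - A - B) \<le> card (Z x y)" by (intro card_mono)
    then have X: "real (card (V - A - B)) \<le> real (card V) / 40" using xy(5) by linarith
    have fin: "finite A" "finite B" using AB finV by (auto intro: finite_subset)
    have VA: "card (V - A) \<le> card B + card (V - A - B)"
    proof -
      have "V - A \<subseteq> B \<union> (V - A - B)" by auto
      then have "card (V - A) \<le> card (B \<union> (V - A - B))" using fin finV by (intro card_mono) auto
      then show ?thesis using card_Un_le order_trans by blast
    qed
    have VB: "card (V - B) \<le> card A + card (V - A - B)"
    proof -
      have "V - B \<subseteq> A \<union> (V - A - B)" by auto
      then have "card (V - B) \<le> card (A \<union> (V - A - B))" using fin finV by (intro card_mono) auto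
      then show ?thesis using card_Un_le order_trans by blast
    qed
    have cAB: "card A + card B \<le> card V"
      using card_mono[of V "A \<union> B"] finV AB disj fin by (simp add: card_Un_disjoint)
    \<comment> \<open>As 3/40 + 1/40 = 1/10, a part below 3/40 can be discarded together with the
      exceptional vertices, and the other part is the core.\<close>
    consider "real (card A) < 3 / 40 * real (card V)" | "real (card B) < 3 / 40 * real (card V)"
      | "3 / 40 * real (card V) \<le> real (card A)" "3 / 40 * real (card V) \<le> real (card B)" by linarith
    then show ?thesis
    proof cases
      case 1
      then have "real (card (V - B)) \<le> real (card V) / 10" using VB X by linarith
      then show ?thesis using clB cr AB by blast
    next
      case 2
      then have "real (card (V - A)) \<le> real (card V) / 10" using VA X by linarith
      then show ?thesis using clA cr AB by blast
    next
      case 3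
      have cross: "reach c0 23 {u} {v}" if uv: "u \<in> A" "v \<in> B" for u v
      proof (cases "card A \<le> card B")
        case True
        then have "real (card A) \<le> real (card V) / 2" using cAB by linarith
        then show ?thesis unfolding c0_def
          using AB disj clA clB deg 3 X n uv by (intro reach_cross_small[of A B]) auto
      next
        case False
        then have "real (card B) \<le> real (card V) / 2" using cAB by linarith
        moreover have "V - B - A = V - A - B" by auto
        ultimately have "reach c0 23 {v} {u}" unfolding c0_def
          using AB disj clA clB deg 3 X n uv by (intro reach_cross_small[of B A]) auto
        then show ?thesis by (rule reach_sym)
      qed
      have "V - (A \<union> B) = V - A - B" by auto
      then have "real (card (V - (A \<union> B))) \<le> real (card V) / 10" using X by (simp add: divide_right_mono)
      moreover have "reach c0 23 {u} {v}" if "u \<in> A \<union> B" "v \<in> A \<union> B" for u v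
        using that cross[of u v] reach_sym[OF cross[of v u]] cr[OF clA[of u v]] cr[OF clB[of u v]] by auto
      ultimately show ?thesis using AB by (intro exI[of _ "A \<union> B"]) auto
    qed
  qed
  then show ?thesis using that unfolding c0_def by blast
qed

end

subsection \<open>Absorbing sets\<close>

definition absorbs :: "'a set set \<Rightarrow> 'a set \<Rightarrow> 'a set \<Rightarrow> bool" where
  "absorbs E Q A \<longleftrightarrow> tileable E A \<and> tileable E (A \<union> Q) \<and> A \<inter> Q = {}"

context tgraph
begin

text \<open>At most 2 * n/10 * n link pairs meet \<open>V - C\<close>, so the link of
  \<open>v\<close> keeps density 2/5 - 1/5 = 1/5 inside \<open>C\<close>, and cherries have density
  (1/5)^2 / 2 = 1/50. The vertex \<open>v\<close> itself may lie outside \<open>C\<close>.\<close>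

lemma rob_triples:
  assumes deg: "2 / 5 * (real (card V))\<^sup>2 \<le> real (pdeg v)"
    and C: "C \<subseteq> V" "real (card (V - C)) \<le> real (card V) / 10"
    and n: "50 \<le> card V"
  shows "rob V (1 / 50) 3 (\<lambda>S. S \<subseteq> C \<and> card S = 3 \<and> v \<notin> S \<and> quad E (insert v S))"
proof -
  let ?R = "\<lambda>b a. b \<in> C \<and> a \<in> C \<and> {v, b, a} \<in> E"
  let ?L = "{(b, a). b \<in> V \<and> a \<in> V \<and> ?R b a}"
  let ?X = "V - C"
  have "{(x, y) \<in> V \<times> V. {v, x, y} \<in> E} \<subseteq> ?L \<union> (?X \<times> V) \<union> (V \<times> ?X)" by auto
  moreover have fL: "finite ?L" using finV by (intro finite_subset[of ?L "V \<times> V"]) auto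
  ultimately have "pdeg v \<le> card (?L \<union> (?X \<times> V) \<union> (V \<times> ?X))"
    unfolding pdeg_def using finV by (intro card_mono) auto
  also have "\<dots> \<le> card ?L + card (?X \<times> V) + card (V \<times> ?X)"
    by (meson add_right_mono card_Un_le order_trans)
  also have "\<dots> = card ?L + 2 * (card ?X * card V)" by (simp add: card_cartesian_product)
  finally have "real (pdeg v) \<le> real (card ?L + 2 * (card ?X * card V))" by (rule of_nat_mono)
  then have "real (pdeg v) \<le> real (card ?L) + 2 * (real (card ?X) * real (card V))" by simp
  also have "\<dots> \<le> real (card ?L) + 2 * (real (card V) / 10 * real (card V))"
    using C(2) by (intro add_left_mono mult_left_mono mult_right_mono) auto
  finally have "1 / 5 * real (card V) * real (card V) \<le> real (card ?L)"
    using deg by (simp add: power2_eq_square)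
  then have "rob V ((1 / 5)\<^sup>2 / 2) 3 (\<lambda>S. \<exists>b a c. S = {b, a, c} \<and> a \<noteq> c \<and> ?R b a \<and> ?R b c)"
    using n by (intro rob_cherries) (auto simp: power_divide)
  then show ?thesis
  proof (rule rob_mono[OF _ finV])
    fix S assume "\<exists>b a c. S = {b, a, c} \<and> a \<noteq> c \<and> ?R b a \<and> ?R b c"
    then obtain b a c where S: "S = {b, a, c}" "a \<noteq> c" "b \<in> C" "a \<in> C" "c \<in> C"
      "{v, b, a} \<in> E" "{v, b, c} \<in> E" by blast
    show "S \<subseteq> C \<and> card S = 3 \<and> v \<notin> S \<and> quad E (insert v S)"
      using quad_cherry[OF S(6,7,2)] S by simp
  qed (simp add: power_divide)
qed

text \<open>Deals with vertices outside the core: each vertex of \<open>Q\<close> is completed to a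
  copy by its own triple in \<open>C\<close>, so afterwards only vertices of \<open>C\<close> have
  to be exchanged. Every vertex costs 1/2 * 1/50 * 1/2 = 1/200.\<close>

lemma rob_extend:
  assumes deg: "\<And>v. v \<in> V \<Longrightarrow> 2 / 5 * (real (card V))\<^sup>2 \<le> real (pdeg v)"
    and C: "C \<subseteq> V" "real (card (V - C)) \<le> real (card V) / 10"
    and n: "10 ^ 13 \<le> card V" and Q: "Q \<subseteq> V" "card Q = r" "r \<le> 4"
  shows "rob V ((1 / 200) ^ r) (3 * r) (\<lambda>T. T \<subseteq> C \<and> card T = 3 * r \<and> T \<inter> Q = {} \<and> tileable E (Q \<union> T))"
  using Q
proof (induction r arbitrary: Q)
  case 0
  then have "Q = {}" using finV by (metis card_0_eq finite_subset)
  then show ?case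
    by (intro robI_inj[OF finV, where X = "{()}" and g = "\<lambda>_. []"]) (simp_all add: tileable_empty)
next
  case (Suc r)
  obtain q Q' where Q: "Q = insert q Q'" "q \<notin> Q'" "card Q' = r" using Suc.prems(2) by (metis card_Suc_eq)
  have fQ: "finite Q'" using Q Suc.prems finV finite_subset by auto
  have ne: "V \<noteq> {}" using n by auto
  have real_n: "10 ^ 13 \<le> real (card V)" using n by (metis of_nat_le_iff of_nat_numeral of_nat_power)
  have r: "real r \<le> 3" "r \<le> 3" using Suc.prems by auto
  have "(1 / 200 :: real) ^ 3 \<le> (1 / 200) ^ r" using r by (intro power_decreasing) auto
  then have pr: "(1 / 200) ^ 3 * real (card V) \<le> (1 / 200) ^ r * real (card V)"
    by (intro mult_right_mono) auto
  have "rob V ((1 / 200) ^ r / 2 * (1 / 50 / 2)) (3 * r + 3)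
    (\<lambda>S. \<exists>S1 S2. S = S1 \<union> S2 \<and> ((S1 \<subseteq> C \<and> card S1 = 3 * r \<and> S1 \<inter> Q' = {} \<and> tileable E (Q' \<union> S1)) \<and> S1 \<inter> {q} = {}) \<and>
      ((S2 \<subseteq> C \<and> card S2 = 3 \<and> q \<notin> S2 \<and> quad E (insert q S2)) \<and> S2 \<inter> (Q' \<union> S1) = {}))"
  proof (rule rob_Un[OF _ finV])
    show "rob V ((1 / 200) ^ r / 2) (3 * r) (\<lambda>S1. (S1 \<subseteq> C \<and> card S1 = 3 * r \<and> S1 \<inter> Q' = {} \<and> tileable E (Q' \<union> S1)) \<and> S1 \<inter> {q} = {})"
    proof (rule rob_avoid[OF Suc.IH finV ne])
      have "2 * real (3 * r) * real (card {q}) \<le> (1 / 200) ^ 3 * real (card V)"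
        using r real_n by (simp add: power_divide)
      then show "2 * real (3 * r) * real (card {q}) \<le> (1 / 200) ^ r * real (card V)" using pr by linarith
    qed (use Q Suc.prems in auto)
  next
    fix S1 :: "'a set"
    assume S1: "finite S1" "(S1 \<subseteq> C \<and> card S1 = 3 * r \<and> S1 \<inter> Q' = {} \<and> tileable E (Q' \<union> S1)) \<and> S1 \<inter> {q} = {}"
    show "rob V (1 / 50 / 2) 3 (\<lambda>S2. (S2 \<subseteq> C \<and> card S2 = 3 \<and> q \<notin> S2 \<and> quad E (insert q S2)) \<and> S2 \<inter> (Q' \<union> S1) = {})"
    proof (rule rob_avoid[OF rob_triples[OF deg C] finV ne])
      have "card (Q' \<union> S1) \<le> 12" using card_Un_le[of Q' S1] Q S1 r by auto
      then show "2 * real 3 * real (card (Q' \<union> S1)) \<le> 1 / 50 * real (card V)" using real_n by simp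
    qed (use Q Suc.prems S1 fQ n in auto)
  qed auto
  then show ?case
  proof (rule rob_mono[OF rob_pad[OF _ finV] finV])
    fix S assume "\<exists>S1 S2. S = S1 \<union> S2 \<and> ((S1 \<subseteq> C \<and> card S1 = 3 * r \<and> S1 \<inter> Q' = {} \<and> tileable E (Q' \<union> S1)) \<and> S1 \<inter> {q} = {}) \<and>
      ((S2 \<subseteq> C \<and> card S2 = 3 \<and> q \<notin> S2 \<and> quad E (insert q S2)) \<and> S2 \<inter> (Q' \<union> S1) = {})"
    then obtain S1 S2 where S: "S = S1 \<union> S2" "S1 \<subseteq> C" "card S1 = 3 * r" "S1 \<inter> Q' = {}" "tileable E (Q' \<union> S1)"
      "S1 \<inter> {q} = {}" "S2 \<subseteq> C" "card S2 = 3" "q \<notin> S2" "quad E (insert q S2)" "S2 \<inter> (Q' \<union> S1) = {}" by blast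
    have fS: "finite S1" "finite S2" using S C finV by (meson finite_subset)+
    have "insert q S2 \<inter> (Q' \<union> S1) = {}" using S Q by auto
    then have "tileable E (insert q S2 \<union> (Q' \<union> S1))" by (rule tileable.tileable_insert[OF S(10,5)])
    moreover have "insert q S2 \<union> (Q' \<union> S1) = Q \<union> S" using S(1) Q(1) by auto
    moreover have "card S = 3 * Suc r" using S fS by (subst S(1), subst card_Un_disjoint) auto
    ultimately show "S \<subseteq> C \<and> card S = 3 * Suc r \<and> S \<inter> Q = {} \<and> tileable E (Q \<union> S)"
      using S Q by auto
  qed auto
qed

text \<open>An absorber of \<open>Q\<close> consists of twelve vertices \<open>T\<close> completing \<open>Q\<close> to four copies, three more copies
  with vertex set \<open>W\<close>, and a set connecting \<open>T\<close> to \<open>W\<close>.\<close>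

lemma rob_absorbs:
  assumes deg: "\<And>v. v \<in> V \<Longrightarrow> 2 / 5 * (real (card V))\<^sup>2 \<le> real (pdeg v)"
    and C: "C \<subseteq> V" "real (card (V - C)) \<le> real (card V) / 10"
    and reach: "\<And>x y. x \<in> C \<Longrightarrow> y \<in> C \<Longrightarrow> x \<noteq> y \<Longrightarrow> reach c 23 {x} {y}"
    and c: "0 < c" "c \<le> 1"
    and n: "10 ^ 13 \<le> card V" "29900 \<le> (c / 4) ^ 12 * real (card V)"
    and Q: "Q \<subseteq> V" "card Q = 4"
  shows "rob V ((1 / 200) ^ 4 * (1 / 100 * ((1 / 200) ^ 3 / 2) * ((c / 4) ^ 12 / 2))) 300 (absorbs E Q)"
proof -
  define PT where "PT T \<longleftrightarrow> T \<subseteq> C \<and> card T = 12 \<and> T \<inter> Q = {} \<and> tileable E (Q \<union> T)" for T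
  define PW where "PW T W \<longleftrightarrow> W \<subseteq> C \<and> card W = 12 \<and> W \<inter> (Q \<union> T) = {} \<and> tileable E W" for T W
  have ne: "V \<noteq> {}" using n by auto
  have real_n: "10 ^ 13 \<le> real (card V)" using n(1) by (metis of_nat_le_iff of_nat_numeral of_nat_power)
  have fQ: "finite Q" using Q finV finite_subset by auto
  have T: "rob V ((1 / 200) ^ 4) 12 PT"
    using rob_extend[OF deg C n(1) Q] by (simp add: PT_def[abs_def])
  have W: "rob V (1 / 100 * ((1 / 200) ^ 3 / 2)) (3 + 9) (PW T)" if T: "PT T" "finite T" for T
  proof -
    have cQT: "card (Q \<union> T) \<le> 16" using card_Un_le[of Q T] Q T unfolding PT_def by simp
    \<comment> \<open>Any \<open>v\<close> provides a triple \<open>S1\<close> in \<open>C\<close>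
      from its link. Completing the three vertices of \<open>S1\<close> adds nine more, and these
      twelve vertices without \<open>v\<close> form three copies.\<close>
    obtain v where v: "v \<in> V" using ne by auto
    have "rob V (1 / 50 / 2 * ((1 / 200) ^ 3 / 2)) (3 + 9)
      (\<lambda>S. \<exists>S1 S2. S = S1 \<union> S2 \<and>
       ((S1 \<subseteq> C \<and> card S1 = 3 \<and> v \<notin> S1 \<and> quad E (insert v S1)) \<and> S1 \<inter> (Q \<union> T) = {}) \<and>
       ((S2 \<subseteq> C \<and> card S2 = 3 * 3 \<and> S2 \<inter> S1 = {} \<and> tileable E (S1 \<union> S2)) \<and> S2 \<inter> (Q \<union> T) = {}))"
    proof (rule rob_Un[OF _ finV])
      show "rob V (1 / 50 / 2) 3 (\<lambda>S1. (S1 \<subseteq> C \<and> card S1 = 3 \<and> v \<notin> S1 \<and> quad E (insert v S1)) \<and> S1 \<inter> (Q \<union> T) = {})"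
        using cQT real_n v n T fQ by (intro rob_avoid[OF rob_triples[OF deg C] finV ne]) auto
    next
      fix S1 :: "'a set"
      assume S1: "S1 \<subseteq> V" "(S1 \<subseteq> C \<and> card S1 = 3 \<and> v \<notin> S1 \<and> quad E (insert v S1)) \<and> S1 \<inter> (Q \<union> T) = {}"
      have "rob V ((1 / 200) ^ 3 / 2) (3 * 3) (\<lambda>S2. (S2 \<subseteq> C \<and> card S2 = 3 * 3 \<and> S2 \<inter> S1 = {} \<and> tileable E (S1 \<union> S2)) \<and> S2 \<inter> (Q \<union> T) = {})"
        using cQT real_n S1 T fQ
        by (intro rob_avoid[OF rob_extend[OF deg C n(1)] finV ne]) (auto simp: power_divide)
      then show "rob V ((1 / 200) ^ 3 / 2) 9 (\<lambda>S2. (S2 \<subseteq> C \<and> card S2 = 3 * 3 \<and> S2 \<inter> S1 = {} \<and> tileable E (S1 \<union> S2)) \<and> S2 \<inter> (Q \<union> T) = {})"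
        by simp
    qed auto
    then show ?thesis
    proof (rule rob_mono[OF _ finV])
      fix S assume "\<exists>S1 S2. S = S1 \<union> S2 \<and>
       ((S1 \<subseteq> C \<and> card S1 = 3 \<and> v \<notin> S1 \<and> quad E (insert v S1)) \<and> S1 \<inter> (Q \<union> T) = {}) \<and>
       ((S2 \<subseteq> C \<and> card S2 = 3 * 3 \<and> S2 \<inter> S1 = {} \<and> tileable E (S1 \<union> S2)) \<and> S2 \<inter> (Q \<union> T) = {})"
      then obtain S1 S2 where S: "S = S1 \<union> S2" "S1 \<subseteq> C" "card S1 = 3" "S1 \<inter> (Q \<union> T) = {}"
        "S2 \<subseteq> C" "card S2 = 9" "S2 \<inter> S1 = {}" "tileable E (S1 \<union> S2)" "S2 \<inter> (Q \<union> T) = {}" by auto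
      have "finite S1" "finite S2" using S C finV by (meson finite_subset)+
      then have "card S = 12" using S by (subst S(1), subst card_Un_disjoint) auto
      then show "PW T S" unfolding PW_def using S by auto
    qed simp
  qed
  \<comment> \<open>The length is 12 for \<open>T\<close>, 12 for \<open>W\<close>, and 12 * 23 =
    276 for the exchanges between them, in total 300.\<close>
  have "rob V ((1 / 200) ^ 4 * (1 / 100 * ((1 / 200) ^ 3 / 2) * ((c / 4) ^ 12 / 2))) (12 + ((3 + 9) + 12 * 23))
    (\<lambda>S. \<exists>T S'. S = T \<union> S' \<and> PT T \<and> (\<exists>W U. S' = W \<union> U \<and> PW T W \<and> (connects E T W U \<and> U \<inter> Q = {})))"
  proof (rule rob_Un[OF T finV])
    fix T assume T: "finite T" "PT T"
    show "rob V (1 / 100 * ((1 / 200) ^ 3 / 2) * ((c / 4) ^ 12 / 2)) ((3 + 9) + 12 * 23)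
      (\<lambda>S'. \<exists>W U. S' = W \<union> U \<and> PW T W \<and> (connects E T W U \<and> U \<inter> Q = {}))"
    proof (rule rob_Un[OF W[OF T(2,1)] finV])
      fix W assume W: "finite W" "PW T W"
      \<comment> \<open>The bound 29900 = 4 * 23 * (12 + 1) * (23 + 2) is the requirement of
        \<open>reach_sets\<close> for k = 23 and R = 12.\<close>
      have "reach ((c / 4) ^ 12) (12 * 23) T W"
      proof (rule reach_sets[where R = 12])
        show "reach c 23 {x} {y}" if "x \<in> T" "y \<in> W" for x y
          using that T W by (intro reach) (auto simp: PT_def PW_def)
      qed (use T W c n ne in \<open>auto simp: PT_def PW_def\<close>)
      then show "rob V ((c / 4) ^ 12 / 2) (12 * 23) (\<lambda>U. connects E T W U \<and> U \<inter> Q = {})"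
        unfolding reach_def using fQ Q n by (intro rob_avoid finV ne) auto
    qed (use c in auto)
  qed (use c in auto)
  then show ?thesis
  proof (rule rob_mono[OF rob_pad[OF _ finV] finV])
    fix A assume "\<exists>T S'. A = T \<union> S' \<and> PT T \<and> (\<exists>W U. S' = W \<union> U \<and> PW T W \<and> (connects E T W U \<and> U \<inter> Q = {}))"
    then obtain T W U where A: "A = T \<union> (W \<union> U)" and p: "PT T" "PW T W" and u: "connects E T W U" "U \<inter> Q = {}" by blast
    note d = p[unfolded PT_def PW_def] u(1)[unfolded connects_def]
    \<comment> \<open>Without \<open>Q\<close> the tiles are those of \<open>T + U\<close> and of
      \<open>W\<close>; with \<open>Q\<close> they are those of \<open>Q + T\<close> and of
      \<open>W + U\<close>.\<close>
    have "(T \<union> U) \<inter> W = {}" "(Q \<union> T) \<inter> (W \<union> U) = {}" using d u by auto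
    then have "tileable E ((T \<union> U) \<union> W)" "tileable E ((Q \<union> T) \<union> (W \<union> U))"
      using d tileable_Un[of E "T \<union> U" W] tileable_Un[of E "Q \<union> T" "W \<union> U"] by metis+
    moreover have "(T \<union> U) \<union> W = A" "(Q \<union> T) \<union> (W \<union> U) = A \<union> Q" using A by auto
    moreover have "A \<inter> Q = {}" using A d u by auto
    ultimately show "absorbs E Q A" unfolding absorbs_def by simp
  qed (use c in auto)
qed

text \<open>The absorbers are chosen greedily; the potential adds \<open>(1/2) ^ k\<close> for each four-set absorbed by exactly
  \<open>k\<close> of the sets chosen so far, and an average choice decreases it by a constant factor.\<close>

lemma absorber_step:
  assumes QQ: "finite QQ" and w: "\<And>Q. Q \<in> QQ \<Longrightarrow> 0 \<le> w Q"
    and rob: "\<And>Q. Q \<in> QQ \<Longrightarrow> rob V c M (absorbs E Q)" and c: "0 < c"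
    and F: "finite F" "2 * real M * real (card F) \<le> c * real (card V)" and ne: "V \<noteq> {}"
  obtains A where "A \<subseteq> V" "card A \<le> M" "tileable E A" "A \<inter> F = {}"
    "c / 2 ^ (M + 1) * (\<Sum>Q\<in>QQ. w Q) \<le> (\<Sum>Q\<in>{Q\<in>QQ. absorbs E Q A}. w Q)"
proof (rule ccontr)
  define \<tau> where "\<tau> = c / 2 ^ (M + 1)"
  define W where "W = (\<Sum>Q\<in>QQ. w Q)"
  define Ls where "Ls = {l. set l \<subseteq> V \<and> length l = M}"
  \<comment> \<open>The average runs over pairs of a list and a tileable subset of it avoiding
    \<open>F\<close>. A list has at most 2^M such subsets, and each \<open>Q\<close> is absorbed on
    at least c/2 of all lists; this gives the factor c / 2^(M + 1).\<close>
  define Ob where "Ob = Sigma Ls (\<lambda>l. {A. A \<subseteq> set l \<and> tileable E A \<and> A \<inter> F = {}})"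
  define s where "s A = (\<Sum>Q\<in>{Q\<in>QQ. absorbs E Q A}. w Q)" for A
  assume nt: "\<not> thesis"
  note ex = that[folded \<tau>_def W_def s_def]
  have neg: "s A < \<tau> * W" if "A \<subseteq> V" "card A \<le> M" "tileable E A" "A \<inter> F = {}" for A
  proof (rule ccontr)
    assume "\<not> s A < \<tau> * W"
    then have "\<tau> * W \<le> s A" by simp
    then show False using ex[OF that] nt by simp
  qed
  have fLs: "finite Ls" "card Ls = card V ^ M" unfolding Ls_def
    using finite_lists_length_eq[OF finV] card_lists_length_eq[OF finV] by auto
  have fin1: "finite {A. A \<subseteq> set l \<and> tileable E A \<and> A \<inter> F = {}}" for l :: "'a list"
    by (rule finite_subset[of _ "Pow (set l)"]) auto
  then have fOb: "finite Ob" unfolding Ob_def using fLs by auto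
  have neg_Ob: "s (snd z) < \<tau> * W" if "z \<in> Ob" for z
  proof -
    obtain l A where z: "z = (l, A)" by fastforce
    then have l: "set l \<subseteq> V" "length l = M" "A \<subseteq> set l" "tileable E A" "A \<inter> F = {}"
      using that by (auto simp: Ob_def Ls_def)
    have "card A \<le> M" using l(2,3) by (meson List.finite_set card_length card_mono order_trans)
    moreover have "A \<subseteq> V" using l by auto
    ultimately show ?thesis using neg[OF _ _ l(4,5)] z by simp
  qed
  \<comment> \<open>The empty set is an admissible candidate, so the negated claim forces \<tau> W >
    0. The upper bound for \<open>card Ob\<close> can then be multiplied by \<tau> W.\<close>
  have "0 \<le> s {}" unfolding s_def using w by (intro sum_nonneg) auto
  also have "s {} < \<tau> * W" by (intro neg) (auto intro: tileable_empty)
  finally have tW: "0 < \<tau> * W" .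
  have "Ls \<noteq> {}" using fLs ne finV by auto
  then obtain l0 where "l0 \<in> Ls" by auto
  then have "(l0, {}) \<in> Ob" unfolding Ob_def by (auto intro: tileable_empty)
  then have neOb: "Ob \<noteq> {}" by auto
  have "card Ob = (\<Sum>l\<in>Ls. card {A. A \<subseteq> set l \<and> tileable E A \<and> A \<inter> F = {}})"
    unfolding Ob_def using fLs fin1 by simp
  also have "\<dots> \<le> (\<Sum>l\<in>Ls. 2 ^ M)"
  proof (rule sum_mono)
    fix l assume l: "l \<in> Ls"
    have "card {A. A \<subseteq> set l \<and> tileable E A \<and> A \<inter> F = {}} \<le> card (Pow (set l))"
      by (intro card_mono) auto
    also have "\<dots> = 2 ^ card (set l)" by (simp add: card_Pow)
    also have "\<dots> \<le> 2 ^ M" using l card_length[of l] by (intro power_increasing) (auto simp: Ls_def)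
    finally show "card {A. A \<subseteq> set l \<and> tileable E A \<and> A \<inter> F = {}} \<le> 2 ^ M" .
  qed
  also have "\<dots> = card V ^ M * 2 ^ M" by (simp add: fLs)
  finally have "real (card Ob) \<le> real (card V ^ M * 2 ^ M)" by (rule of_nat_mono)
  then have cOb: "real (card Ob) \<le> real (card V) ^ M * 2 ^ M" by simp
  have "(\<Sum>z\<in>Ob. s (snd z)) < (\<Sum>z\<in>Ob. \<tau> * W)"
    using fOb neOb neg_Ob by (intro sum_strict_mono) auto
  also have "\<dots> = real (card Ob) * (\<tau> * W)" by simp
  also have "\<dots> \<le> real (card V) ^ M * 2 ^ M * (\<tau> * W)" using cOb tW by (intro mult_right_mono) auto
  also have "\<dots> = c / 2 * real (card V) ^ M * W" by (simp add: \<tau>_def)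
  finally have up: "(\<Sum>z\<in>Ob. s (snd z)) < c / 2 * real (card V) ^ M * W" .
  have "c / 2 * real (card V) ^ M * W = (\<Sum>Q\<in>QQ. c / 2 * real (card V) ^ M * w Q)"
    unfolding W_def by (simp add: sum_distrib_left)
  also have "\<dots> \<le> (\<Sum>Q\<in>QQ. real (card {z\<in>Ob. absorbs E Q (snd z)}) * w Q)"
  proof (intro sum_mono mult_right_mono w)
    fix Q assume Q: "Q \<in> QQ"
    have "rob V (c / 2) M (\<lambda>A. absorbs E Q A \<and> A \<inter> F = {})"
      using F by (intro rob_avoid[OF rob[OF Q] finV ne]) auto
    then have "c / 2 * real (card V) ^ M \<le>
      real (card {l. set l \<subseteq> V \<and> length l = M \<and> (\<exists>A\<subseteq>set l. absorbs E Q A \<and> A \<inter> F = {})})"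
      unfolding rob_def .
    also have "{l. set l \<subseteq> V \<and> length l = M \<and> (\<exists>A\<subseteq>set l. absorbs E Q A \<and> A \<inter> F = {})}
      \<subseteq> fst ` {z\<in>Ob. absorbs E Q (snd z)}"
    proof
      fix l assume "l \<in> {l. set l \<subseteq> V \<and> length l = M \<and> (\<exists>A\<subseteq>set l. absorbs E Q A \<and> A \<inter> F = {})}"
      then obtain A where "set l \<subseteq> V" "length l = M" "A \<subseteq> set l" "absorbs E Q A" "A \<inter> F = {}" by blast
      then have "(l, A) \<in> {z\<in>Ob. absorbs E Q (snd z)}" by (auto simp: Ob_def Ls_def absorbs_def)
      then show "l \<in> fst ` {z\<in>Ob. absorbs E Q (snd z)}" by force
    qed
    then have "card {l. set l \<subseteq> V \<and> length l = M \<and> (\<exists>A\<subseteq>set l. absorbs E Q A \<and> A \<inter> F = {})}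
      \<le> card {z\<in>Ob. absorbs E Q (snd z)}"
      using fOb by (intro surj_card_le) auto
    finally show "c / 2 * real (card V) ^ M \<le> real (card {z\<in>Ob. absorbs E Q (snd z)})" by simp
  qed
  also have "\<dots> = (\<Sum>Q\<in>QQ. \<Sum>z\<in>{z\<in>Ob. absorbs E Q (snd z)}. w Q)" by simp
  also have "\<dots> = (\<Sum>z\<in>Ob. \<Sum>Q\<in>{Q\<in>QQ. absorbs E Q (snd z)}. w Q)"
    using QQ fOb by (rule sum.swap_restrict)
  also have "\<dots> = (\<Sum>z\<in>Ob. s (snd z))" unfolding s_def ..
  finally show False using up by linarith
qed

text \<open>Each new set halves the weight of at least a fraction c / 2^(M + 1) of the total, hence
  the factor 1 - c / 2^(M + 2). The family is indexed because the empty set may be chosen more than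
  once; the bound on \<open>s\<close> leaves room for every choice to avoid the earlier
  ones.\<close>

lemma absorber_family:
  assumes QQ: "finite QQ" and rob: "\<And>Q. Q \<in> QQ \<Longrightarrow> rob V c M (absorbs E Q)"
    and c: "0 < c" "c \<le> 1" and ne: "V \<noteq> {}"
    and s: "2 * real M * (real s * real M) \<le> c * real (card V)"
  shows "\<exists>A. (\<forall>i<s. A i \<subseteq> V \<and> card (A i) \<le> M \<and> tileable E (A i)) \<and> disjoint_family_on A {..<s} \<and>
    (\<Sum>Q\<in>QQ. (1 / 2) ^ card {i\<in>{..<s}. absorbs E Q (A i)}) \<le> (1 - c / 2 ^ (M + 2)) ^ s * real (card QQ)"
  using s
proof (induction s)
  case 0
  show ?case by (simp add: disjoint_family_on_def)
next
  case (Suc s)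
  have "2 * real M * (real s * real M) \<le> 2 * real M * (real (Suc s) * real M)"
    by (intro mult_left_mono mult_right_mono) auto
  then obtain A where A: "\<And>i. i < s \<Longrightarrow> A i \<subseteq> V \<and> card (A i) \<le> M \<and> tileable E (A i)"
    "disjoint_family_on A {..<s}"
    "(\<Sum>Q\<in>QQ. (1 / 2) ^ card {i\<in>{..<s}. absorbs E Q (A i)}) \<le> (1 - c / 2 ^ (M + 2)) ^ s * real (card QQ)"
    using Suc by fastforce
  define w where "w Q = (1 / 2 :: real) ^ card {i\<in>{..<s}. absorbs E Q (A i)}" for Q
  define F where "F = (\<Union>i<s. A i)"
  have "card F \<le> (\<Sum>i<s. card (A i))" unfolding F_def by (intro card_UN_le) auto
  also have "\<dots> \<le> s * M" using A(1) sum_bounded_above[of "{..<s}" "\<lambda>i. card (A i)" M] by auto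
  finally have "real (card F) \<le> real s * real M" by (simp flip: of_nat_mult)
  also have "\<dots> \<le> real (Suc s) * real M" by (intro mult_right_mono) auto
  finally have "2 * real M * real (card F) \<le> 2 * real M * (real (Suc s) * real M)"
    by (intro mult_left_mono) auto
  then have F: "2 * real M * real (card F) \<le> c * real (card V)" using Suc.prems by linarith
  have fF: "finite F" unfolding F_def using A(1) finV by (auto intro: finite_subset)
  have w0: "0 \<le> w Q" for Q by (simp add: w_def)
  obtain B where B: "B \<subseteq> V" "card B \<le> M" "tileable E B" "B \<inter> F = {}"
    "c / 2 ^ (M + 1) * (\<Sum>Q\<in>QQ. w Q) \<le> (\<Sum>Q\<in>{Q\<in>QQ. absorbs E Q B}. w Q)"
    using absorber_step[OF QQ w0 rob c(1) fF F ne] .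
  define A' where "A' = A(s := B)"
  have "disjoint_family_on A' {..<Suc s}"
    unfolding disjoint_family_on_def
  proof (intro ballI impI)
    fix i j assume ij: "i \<in> {..<Suc s}" "j \<in> {..<Suc s}" "i \<noteq> j"
    have BA: "B \<inter> A k = {}" if "k < s" for k using B(4) that unfolding F_def by auto
    consider "i < s" "j < s" | "i = s" "j < s" | "i < s" "j = s" using ij by (auto simp: less_Suc_eq)
    then show "A' i \<inter> A' j = {}"
    proof cases
      case 1
      then show ?thesis using A(2) ij(3) by (simp add: A'_def disjoint_family_on_def)
    next
      case 2
      then show ?thesis using BA[of j] by (simp add: A'_def)
    next
      case 3
      then show ?thesis using BA[of i] by (simp add: A'_def Int_commute)
    qed
  qed
  moreover have "\<forall>i<Suc s. A' i \<subseteq> V \<and> card (A' i) \<le> M \<and> tileable E (A' i)"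
    using A(1) B unfolding A'_def by (auto simp: less_Suc_eq)
  moreover have "(\<Sum>Q\<in>QQ. (1 / 2) ^ card {i\<in>{..<Suc s}. absorbs E Q (A' i)})
    \<le> (1 - c / 2 ^ (M + 2)) ^ Suc s * real (card QQ)"
  proof -
    have step: "(1 / 2) ^ card {i\<in>{..<Suc s}. absorbs E Q (A' i)} = w Q - (if absorbs E Q B then w Q / 2 else 0)" for Q
    proof -
      have "{i\<in>{..<Suc s}. absorbs E Q (A' i)} = {i\<in>{..<s}. absorbs E Q (A i)} \<union> (if absorbs E Q B then {s} else {})"
        unfolding A'_def by (auto simp: less_Suc_eq)
      then show ?thesis by (simp add: w_def)
    qed
    have "(\<Sum>Q\<in>QQ. (1 / 2) ^ card {i\<in>{..<Suc s}. absorbs E Q (A' i)})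
      = (\<Sum>Q\<in>QQ. w Q) - (\<Sum>Q\<in>QQ. if absorbs E Q B then w Q / 2 else 0)"
      by (simp only: step sum_subtractf)
    also have "(\<Sum>Q\<in>QQ. if absorbs E Q B then w Q / 2 else 0) = (\<Sum>Q\<in>{Q\<in>QQ. absorbs E Q B}. w Q / 2)"
      using QQ by (simp add: sum.inter_filter)
    also have "\<dots> = (\<Sum>Q\<in>{Q\<in>QQ. absorbs E Q B}. w Q) / 2" by (simp add: sum_divide_distrib)
    also have "(\<Sum>Q\<in>QQ. w Q) - (\<Sum>Q\<in>{Q\<in>QQ. absorbs E Q B}. w Q) / 2
      \<le> (\<Sum>Q\<in>QQ. w Q) - (c / 2 ^ (M + 1) * (\<Sum>Q\<in>QQ. w Q)) / 2" using B(5) by simp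
    also have "\<dots> = (1 - c / 2 ^ (M + 2)) * (\<Sum>Q\<in>QQ. w Q)" by (simp add: algebra_simps)
    also have "\<dots> \<le> (1 - c / 2 ^ (M + 2)) * ((1 - c / 2 ^ (M + 2)) ^ s * real (card QQ))"
    proof (rule mult_left_mono)
      have "c / 2 ^ (M + 2) \<le> 1 / 1" using c by (intro frac_le one_le_power) auto
      then show "0 \<le> 1 - c / 2 ^ (M + 2)" by simp
    qed (use A(3) in \<open>simp add: w_def\<close>)
    finally show ?thesis by simp
  qed
  ultimately show ?case by blast
qed

text \<open>Greedy choice: one four-set uses up one absorber, so each remaining four-set still has
  as many absorbers as there are four-sets to be handled.\<close>

lemma absorb_all:
  assumes "finite I" "disjoint_family_on A I" "\<And>i. i \<in> I \<Longrightarrow> tileable E (A i)"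
    and "finite R" "card R = 4 * r" "R \<inter> (\<Union>i\<in>I. A i) = {}"
    and "\<And>Q. Q \<subseteq> R \<Longrightarrow> card Q = 4 \<Longrightarrow> r \<le> card {i\<in>I. absorbs E Q (A i)}"
  shows "tileable E ((\<Union>i\<in>I. A i) \<union> R)"
  using assms
proof (induction r arbitrary: I R)
  case 0
  then show ?case using tileable_UN[of I E A] by simp
next
  case (Suc r)
  have "4 \<le> card R" using Suc.prems(5) by simp
  then obtain Q where Q: "Q \<subseteq> R" "card Q = 4" by (rule obtain_subset_with_card_n)
  have "Suc r \<le> card {i\<in>I. absorbs E Q (A i)}" using Suc.prems(7)[OF Q] .
  then have "card {i\<in>I. absorbs E Q (A i)} \<noteq> 0" by linarith
  then have "{i\<in>I. absorbs E Q (A i)} \<noteq> {}" by (metis card.empty)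
  then obtain j where j: "j \<in> I" "absorbs E Q (A j)" by auto
  have fQ: "finite Q" using Q Suc.prems(4) finite_subset by auto
  let ?I = "I - {j}"
  have "tileable E ((\<Union>i\<in>?I. A i) \<union> (R - Q))"
  proof (rule Suc.IH)
    show "disjoint_family_on A ?I" using Suc.prems(2) by (auto simp: disjoint_family_on_def)
    show "card (R - Q) = 4 * r" using Q Suc.prems fQ by (simp add: card_Diff_subset)
    fix Q' assume Q': "Q' \<subseteq> R - Q" "card Q' = 4"
    then have "Suc r \<le> card {i\<in>I. absorbs E Q' (A i)}" by (intro Suc.prems(7)) auto
    moreover have "{i\<in>?I. absorbs E Q' (A i)} = {i\<in>I. absorbs E Q' (A i)} - {j}" by auto
    moreover have "card {i\<in>I. absorbs E Q' (A i)} - 1 \<le> card ({i\<in>I. absorbs E Q' (A i)} - {j})"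
      by (simp add: card_Diff_singleton_if)
    ultimately show "r \<le> card {i\<in>?I. absorbs E Q' (A i)}" by simp
  qed (use Suc.prems in auto)
  moreover have "tileable E (A j \<union> Q)" using j(2) by (simp add: absorbs_def)
  moreover have "((\<Union>i\<in>?I. A i) \<union> (R - Q)) \<inter> (A j \<union> Q) = {}"
  proof -
    have "A i \<inter> A j = {}" if "i \<in> ?I" for i
      using that j(1) Suc.prems(2) by (auto simp: disjoint_family_on_def)
    moreover have "A i \<inter> R = {}" if "i \<in> I" for i using that Suc.prems(6) by auto
    ultimately show ?thesis using j(1) Q(1) by blast
  qed
  ultimately have "tileable E (((\<Union>i\<in>?I. A i) \<union> (R - Q)) \<union> (A j \<union> Q))" by (rule tileable_Un)
  moreover have "((\<Union>i\<in>?I. A i) \<union> (R - Q)) \<union> (A j \<union> Q) = (\<Union>i\<in>I. A i) \<union> R" using j(1) Q(1) by auto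
  ultimately show ?case by simp
qed

text \<open>If \<open>Q\<close> is absorbed \<open>t\<close> times, its single summand is at least
  exp (- t), while the potential after \<open>s\<close> rounds is at most exp (- s \<tau>) n^4. So t
  \<ge> s \<tau> - 4 ln n, where s \<tau> is about 16 \<delta> n; half of this remains after the
  logarithm and rounding are paid for.\<close>

lemma absorbing_set:
  assumes deg: "\<And>v. v \<in> V \<Longrightarrow> 2 / 5 * (real (card V))\<^sup>2 \<le> real (pdeg v)"
    and rob: "\<And>Q. Q \<subseteq> V \<Longrightarrow> card Q = 4 \<Longrightarrow> rob V c M (absorbs E Q)"
    and c: "0 < c" "c \<le> 1" and M: "0 < M"
    and b: "0 < b" "b * real M \<le> \<beta>" "2 * real M * real M * b \<le> c"
    and \<delta>: "\<delta> = c / 2 ^ (M + 2) * b / 16"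
    and n: "4 \<le> card V" "1 - 4 * ln \<delta> \<le> 4 * \<delta> * real (card V)"
  shows "\<exists>A\<subseteq>V. tileable E A \<and> real (card A) \<le> \<beta> * real (card V) \<and>
    (\<forall>R\<subseteq>V - A. real (card R) \<le> 8 * \<delta> * real (card V) \<longrightarrow> 4 dvd card R \<longrightarrow> tileable E (A \<union> R))"
proof -
  define \<tau> where "\<tau> = c / 2 ^ (M + 2)"
  define m where "m = real (card V)"
  define s where "s = nat \<lfloor>b * m\<rfloor>"
  define QQ where "QQ = {Q. Q \<subseteq> V \<and> card Q = 4}"
  have ne: "V \<noteq> {}" using n by auto
  have m: "4 \<le> m" using n unfolding m_def by simp
  have s: "real s \<le> b * m" "b * m - 1 \<le> real s" unfolding s_def using b m by (simp, linarith)
  have "c / 2 ^ (M + 2) \<le> 1 / 1" using c by (intro frac_le one_le_power) auto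
  then have \<tau>: "0 < \<tau>" "\<tau> \<le> 1" unfolding \<tau>_def using c by auto
  have \<delta>1: "\<delta> = \<tau> * b / 16" using \<delta> unfolding \<tau>_def by simp
  then have \<delta>': "\<delta> = \<tau> * b / 16" "0 < \<delta>" using mult_pos_pos[OF \<tau>(1) b(1)] by simp_all
  have QQ: "finite QQ" unfolding QQ_def using finV by auto
  have "card QQ = card V choose 4" unfolding QQ_def by (rule n_subsets[OF finV])
  also have "\<dots> \<le> card V ^ 4" using n by (intro binomial_le_pow) auto
  finally have cQQ: "real (card QQ) \<le> m ^ 4" unfolding m_def by (simp flip: of_nat_power)
  have "2 * real M * (real s * real M) \<le> 2 * real M * (b * m * real M)"
    using s(1) by (intro mult_left_mono mult_right_mono) auto
  also have "\<dots> = 2 * real M * real M * b * m" by simp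
  also have "\<dots> \<le> c * m" using b(3) m by (intro mult_right_mono) auto
  finally have sM: "2 * real M * (real s * real M) \<le> c * real (card V)" unfolding m_def .
  obtain A where A: "\<forall>i<s. A i \<subseteq> V \<and> card (A i) \<le> M \<and> tileable E (A i)" "disjoint_family_on A {..<s}"
    "(\<Sum>Q\<in>QQ. (1 / 2) ^ card {i\<in>{..<s}. absorbs E Q (A i)}) \<le> (1 - \<tau>) ^ s * real (card QQ)"
    using absorber_family[OF QQ _ c ne sM] rob unfolding QQ_def \<tau>_def by blast
  have many: "8 * \<delta> * m \<le> real (card {i\<in>{..<s}. absorbs E Q (A i)})" if Q: "Q \<in> QQ" for Q
  proof -
    define t where "t = card {i\<in>{..<s}. absorbs E Q (A i)}"
    have "exp (-1 :: real) \<le> 1 / 2"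
      using exp_ge_add_one_self[of 1] by (simp add: exp_minus field_simps)
    then have "exp (- real t) \<le> (1 / 2) ^ t"
      using power_mono[of "exp (-1 :: real)" "1 / 2" t] by (simp add: exp_of_nat_mult[symmetric])
    also have "\<dots> \<le> (\<Sum>Q\<in>QQ. (1 / 2) ^ card {i\<in>{..<s}. absorbs E Q (A i)})"
      unfolding t_def by (rule member_le_sum[OF Q _ QQ]) simp
    also have "\<dots> \<le> (1 - \<tau>) ^ s * real (card QQ)" by (rule A(3))
    also have "\<dots> \<le> exp (- \<tau>) ^ s * m ^ 4"
      using \<tau> cQQ exp_ge_add_one_self[of "- \<tau>"] by (intro mult_mono power_mono) auto
    also have "\<dots> = exp (- (real s * \<tau>) + 4 * ln m)"
    proof -
      have "exp (4 * ln m) = m ^ 4" using exp_of_nat_mult[of 4 "ln m"] m by simp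
      moreover have "exp (- \<tau>) ^ s = exp (- (real s * \<tau>))" using exp_of_nat_mult[of s "- \<tau>"] by simp
      ultimately show ?thesis by (simp only: exp_add)
    qed
    finally have "- real t \<le> - (real s * \<tau>) + 4 * ln m" by simp
    moreover have "(b * m - 1) * \<tau> \<le> real s * \<tau>" using s \<tau> by (intro mult_right_mono) auto
    then have "b * m * \<tau> - \<tau> \<le> real s * \<tau>" by (simp add: left_diff_distrib)
    \<comment> \<open>Applied to \<delta> m instead of m, the bound makes the logarithm a small
      multiple of m. The price is the constant - 4 ln \<delta> in the lower bound on the number of
      vertices.\<close>
    moreover have "ln (\<delta> * m) \<le> \<delta> * m" using \<delta>' m ln_le_minus_one[of "\<delta> * m"] by auto
    then have "ln \<delta> + ln m \<le> \<delta> * m" using \<delta>'(2) m by (simp add: ln_mult)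
    moreover have "b * m * \<tau> = 16 * \<delta> * m" using \<delta>'(1) by (simp add: algebra_simps)
    ultimately show ?thesis using n(2) \<tau> unfolding t_def[symmetric] m_def[symmetric]
      by linarith
  qed
  define U where "U = (\<Union>i<s. A i)"
  have "tileable E U" unfolding U_def using A by (intro tileable_UN) auto
  moreover have "U \<subseteq> V" using A(1) by (auto simp: U_def)
  moreover have "real (card U) \<le> \<beta> * m"
  proof -
    have "card U \<le> (\<Sum>i<s. card (A i))" unfolding U_def by (intro card_UN_le) auto
    also have "\<dots> \<le> s * M" using A(1) sum_bounded_above[of "{..<s}" "\<lambda>i. card (A i)" M] by auto
    finally have "real (card U) \<le> real s * real M" by (simp flip: of_nat_mult)
    also have "\<dots> \<le> b * m * real M" using s by (intro mult_right_mono) auto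
    also have "\<dots> = b * real M * m" by simp
    also have "\<dots> \<le> \<beta> * m" using b m by (intro mult_right_mono) auto
    finally show ?thesis .
  qed
  moreover have "tileable E (U \<union> R)" if R: "R \<subseteq> V - U" "real (card R) \<le> 8 * \<delta> * m" "4 dvd card R" for R
  proof -
    obtain r where r: "card R = 4 * r" using R(3) by auto
    show ?thesis unfolding U_def
    proof (rule absorb_all[where r = r])
      show "finite R" using R finV finite_subset by blast
      show "R \<inter> (\<Union>i<s. A i) = {}" using R(1) by (auto simp: U_def)
      fix Q assume "Q \<subseteq> R" "card Q = 4"
      then have "Q \<in> QQ" using R(1) by (auto simp: QQ_def)
      then have "real r \<le> real (card {i\<in>{..<s}. absorbs E Q (A i)})" using many[of Q] R(2) r by simp
      then show "r \<le> card {i\<in>{..<s}. absorbs E Q (A i)}" by simp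
    qed (use A r in auto)
  qed
  ultimately show ?thesis unfolding m_def by blast
qed

end

text \<open>The robustness constant \<open>c\<close> is absolute, so \<alpha> and \<open>N\<close>
  depend on \<beta> alone.\<close>

theorem absorbing:
  assumes "0 < \<beta>"
  obtains \<alpha> :: real and N :: nat where "0 < \<alpha>"
    "\<And>(V :: 'a set) E. tgraph V E \<Longrightarrow> N \<le> card V \<Longrightarrow>
      (\<And>v. v \<in> V \<Longrightarrow> 2 / 5 * (real (card V))\<^sup>2 \<le> real (tgraph.pdeg V E v)) \<Longrightarrow>
      \<exists>A\<subseteq>V. tileable E A \<and> real (card A) \<le> \<beta> * real (card V) \<and>
        (\<forall>R\<subseteq>V - A. real (card R) \<le> \<alpha> * real (card V) \<longrightarrow> 4 dvd card R \<longrightarrow> tileable E (A \<union> R))"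
proof -
  define c0 :: real where "c0 = (1 / 400) ^ 4 / 16 * ((1 / 3200) ^ 5 / 4)"
  define c where "c = (1 / 200) ^ 4 * (1 / 100 * ((1 / 200) ^ 3 / 2) * ((c0 / 4) ^ 12 / 2))"
  have c0: "0 < c0" "c0 \<le> 1" unfolding c0_def by (simp_all add: power_divide)
  have "(c0 / 4) ^ 12 \<le> 1" using c0 by (intro power_le_one) auto
  then have "c \<le> (1 / 200) ^ 4 * (1 / 100 * ((1 / 200) ^ 3 / 2) * (1 / 2))" unfolding c_def
    by (intro mult_left_mono divide_right_mono) auto
  also have "\<dots> \<le> 1" by (simp add: power_divide)
  finally have c: "0 < c" "c \<le> 1" using c0 by (auto simp: c_def)
  \<comment> \<open>The first bound keeps the union of at most b n sets of size 300 below \<beta> n;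
    the second allows each new set to avoid all earlier ones.\<close>
  define b where "b = min (\<beta> / 300) (c / (2 * 300 * 300))"
  have b: "0 < b" "b * 300 \<le> \<beta>" "2 * 300 * 300 * b \<le> c" unfolding b_def using assms c by auto
  define \<delta> where "\<delta> = c / 2 ^ (300 + 2) * b / 16"
  have \<delta>: "0 < \<delta>" unfolding \<delta>_def using b c by simp
  define N where "N = (10 ^ 13 :: nat) + nat \<lceil>29900 / (c0 / 4) ^ 12\<rceil> + nat \<lceil>(1 - 4 * ln \<delta>) / (4 * \<delta>)\<rceil>"
  show ?thesis
  proof (rule that[of "8 * \<delta>" N])
    show "0 < 8 * \<delta>" using \<delta> by simp
    fix V :: "'a set" and E
    assume tg: "tgraph V E" and n: "N \<le> card V"
      and deg: "\<And>v. v \<in> V \<Longrightarrow> 2 / 5 * (real (card V))\<^sup>2 \<le> real (tgraph.pdeg V E v)"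
    interpret tgraph V E by (rule tg)
    have n1: "10 ^ 13 \<le> card V" using n unfolding N_def by linarith
    have "29900 / (c0 / 4) ^ 12 \<le> real (card V)" using n unfolding N_def by linarith
    then have n2: "29900 \<le> (c0 / 4) ^ 12 * real (card V)" using c0 by (simp add: field_simps)
    have "(1 - 4 * ln \<delta>) / (4 * \<delta>) \<le> real (card V)" using n unfolding N_def by linarith
    then have n3: "1 - 4 * ln \<delta> \<le> 4 * \<delta> * real (card V)" using \<delta> by (simp add: field_simps)
    obtain C where C: "C \<subseteq> V" "real (card (V - C)) \<le> real (card V) / 10"
      "\<And>x y. x \<in> C \<Longrightarrow> y \<in> C \<Longrightarrow> x \<noteq> y \<Longrightarrow> reach c0 23 {x} {y}"
      using core_exists[OF deg n1] unfolding c0_def by blast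
    have rob: "rob V c 300 (absorbs E Q)" if "Q \<subseteq> V" "card Q = 4" for Q
      unfolding c_def using rob_absorbs[OF deg C c0 n1 n2 that] .
    show "\<exists>A\<subseteq>V. tileable E A \<and> real (card A) \<le> \<beta> * real (card V) \<and>
        (\<forall>R\<subseteq>V - A. real (card R) \<le> 8 * \<delta> * real (card V) \<longrightarrow> 4 dvd card R \<longrightarrow> tileable E (A \<union> R))"
      by (rule absorbing_set[OF deg rob c _ b(1) _ _ \<delta>_def _ n3]) (use b n1 in auto)
  qed
qed

subsection \<open>Dense bipartite graphs on four plus four vertices\<close>

text \<open>At least seven pairs meeting two vertices of the same side \<open>X\<close>: all four at
  \<open>a\<close> and all but at most one at \<open>a'\<close>. An arc from \<open>X\<close> to
  \<open>Y\<close> is not an arc from \<open>Y\<close> to \<open>X\<close>.\<close>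

definition arc :: "('a \<Rightarrow> 'a \<Rightarrow> bool) \<Rightarrow> 'a set \<Rightarrow> 'a set \<Rightarrow> bool" where
  "arc R X Y \<longleftrightarrow> (\<exists>a\<in>X. \<exists>a'\<in>X. a \<noteq> a' \<and> (\<forall>y\<in>Y. R a y) \<and> (\<exists>z\<in>Y. \<forall>y\<in>Y - {z}. R a' y))"

text \<open>The 4 + 4 - 1 pairs meeting one chosen vertex on each side; \<open>c\<close> and
  \<open>d\<close> are the centres.\<close>

definition cross :: "('a \<Rightarrow> 'a \<Rightarrow> bool) \<Rightarrow> 'a set \<Rightarrow> 'a set \<Rightarrow> 'a \<Rightarrow> 'a \<Rightarrow> bool" where
  "cross R X Y c d \<longleftrightarrow> c \<in> X \<and> d \<in> Y \<and> (\<forall>x\<in>X. \<forall>y\<in>Y. x = c \<or> y = d \<longrightarrow> R x y)"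

lemma arcI:
  assumes "a \<in> X" "a' \<in> X" "a \<noteq> a'" "\<forall>y\<in>Y. R a y" "\<exists>z\<in>Y. \<forall>y\<in>Y - {z}. R a' y"
  shows "arc R X Y"
  using assms unfolding arc_def by blast

text \<open>Here \<open>bij\<close> stands for a pair from x_i to y_j; the pairs 11 and 22 are
  present and those between {x_3, x_4} and {y_3, y_4} absent. The hypotheses forbid three disjoint
  pairs. This is Koenig's theorem in a small case: two vertices cover all pairs. Both on one side,
  they cover at most eight, and seven already make an arc; on different sides they cover at most
  seven, with equality for a cross. Splitting by whether x_1 and x_2 reach {y_3, y_4} leaves six
  free booleans in each case.\<close>

lemma four_by_four_bool:
  fixes b12 b13 b14 b21 b23 b24 b31 b32 b41 b42 :: bool
  assumes "\<not> (b13 \<and> b31)" "\<not> (b13 \<and> b41)" "\<not> (b14 \<and> b31)" "\<not> (b14 \<and> b41)"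
    and "\<not> (b23 \<and> b32)" "\<not> (b23 \<and> b42)" "\<not> (b24 \<and> b32)" "\<not> (b24 \<and> b42)"
    and "b21 \<Longrightarrow> \<not> ((b13 \<or> b14) \<and> (b32 \<or> b42))" "b12 \<Longrightarrow> \<not> ((b23 \<or> b24) \<and> (b31 \<or> b41))"
    and "s = 2 + (of_bool b12 + of_bool b13 + of_bool b14 + of_bool b21 + of_bool b23 + of_bool b24
      + of_bool b31 + of_bool b32 + of_bool b41 + of_bool b42 :: nat)"
  shows "s \<le> 6 \<or> s \<le> 7 \<and> (b12 \<and> b13 \<and> b14 \<and> b32 \<and> b42 \<or> b21 \<and> b23 \<and> b24 \<and> b31 \<and> b41)
    \<or> s \<le> 8 \<and> (b12 \<and> b13 \<and> b14 \<and> (b23 \<and> b24 \<or> b21 \<and> b24 \<or> b21 \<and> b23) \<or>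
        b21 \<and> b23 \<and> b24 \<and> (b13 \<and> b14 \<or> b12 \<and> b14 \<or> b12 \<and> b13))
    \<or> s \<le> 8 \<and> (b21 \<and> b31 \<and> b41 \<and> (b32 \<and> b42 \<or> b12 \<and> b42 \<or> b12 \<and> b32) \<or>
        b12 \<and> b32 \<and> b42 \<and> (b31 \<and> b41 \<or> b21 \<and> b41 \<or> b21 \<and> b31))"
proof -
  consider "b13 \<or> b14" "b23 \<or> b24" | "b13 \<or> b14" "\<not> b23" "\<not> b24" | "\<not> b13" "\<not> b14" "b23 \<or> b24"
    | "\<not> b13" "\<not> b14" "\<not> b23" "\<not> b24" by blast
  then show ?thesis
  proof cases
    case 1
    then have "\<not> b31" "\<not> b41" "\<not> b32" "\<not> b42" using assms(1-8) by blast+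
    then show ?thesis unfolding assms(11)
      by (cases b12; cases b13; cases b14; cases b21; cases b23; cases b24; simp)
  next
    case 2
    then have "\<not> b31" "\<not> b41" "b21 \<Longrightarrow> \<not> (b32 \<or> b42)" using assms(1-9) by blast+
    then show ?thesis unfolding assms(11) using 2
      by (cases b12; cases b13; cases b14; cases b21; cases b32; cases b42; simp)
  next
    case 3
    then have "\<not> b32" "\<not> b42" "b12 \<Longrightarrow> \<not> (b31 \<or> b41)" using assms(1-8,10) by blast+
    then show ?thesis unfolding assms(11) using 3
      by (cases b12; cases b21; cases b23; cases b24; cases b31; cases b41; simp)
  next
    case 4
    then show ?thesis unfolding assms(11)
      by (cases b12; cases b21; cases b31; cases b32; cases b41; cases b42; simp)
  qed
qed

lemma card_4_obtain:
  assumes "card X = 4" "a \<in> X" "b \<in> X" "a \<noteq> b"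
  obtains c d where "X = {a, b, c, d}" "distinct [a, b, c, d]"
proof -
  have "finite X" using assms(1) by (metis card.infinite zero_neq_numeral)
  then have "card (X - {a, b}) = 2" using assms by (simp add: card_Diff_subset)
  then obtain c d where cd: "X - {a, b} = {c, d}" "c \<noteq> d" by (auto simp: card_2_iff)
  have "X = {a, b} \<union> (X - {a, b})" using assms by auto
  then have "X = {a, b, c, d}" using cd by auto
  moreover have "c \<notin> {a, b}" "d \<notin> {a, b}" using cd by auto
  ultimately show ?thesis using that cd(2) assms(4) by auto
qed

text \<open>The threshold \<open>7/16\<close> originates here: of the sixteen pairs between two tiles, a cross has seven,
  and only an arc can have more, but there are few arcs by \<open>arc_unique\<close> below.\<close>

lemma four_by_four:
  assumes X: "card X = 4" and Y: "card Y = 4"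
    and no3: "\<And>x1 x2 x3 y1 y2 y3. \<lbrakk>x1 \<in> X; x2 \<in> X; x3 \<in> X; y1 \<in> Y; y2 \<in> Y; y3 \<in> Y;
      distinct [x1, x2, x3]; distinct [y1, y2, y3]; R x1 y1; R x2 y2; R x3 y3\<rbrakk> \<Longrightarrow> False"
  defines "s \<equiv> card {(x, y). x \<in> X \<and> y \<in> Y \<and> R x y}"
  shows "s \<le> 6 \<or> s \<le> 7 \<and> (\<exists>c d. cross R X Y c d) \<or> s \<le> 8 \<and> arc R X Y \<or> s \<le> 8 \<and> arc (\<lambda>y x. R x y) Y X"
proof (cases "\<exists>x1\<in>X. \<exists>x2\<in>X. \<exists>y1\<in>Y. \<exists>y2\<in>Y. x1 \<noteq> x2 \<and> y1 \<noteq> y2 \<and> R x1 y1 \<and> R x2 y2")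
  case True
  then obtain x1 x2 y1 y2 where m: "x1 \<in> X" "x2 \<in> X" "y1 \<in> Y" "y2 \<in> Y" "x1 \<noteq> x2" "y1 \<noteq> y2"
    "R x1 y1" "R x2 y2" by blast
  obtain x3 x4 where X': "X = {x1, x2, x3, x4}" "distinct [x1, x2, x3, x4]"
    using card_4_obtain[OF X m(1,2,5)] .
  obtain y3 y4 where Y': "Y = {y1, y2, y3, y4}" "distinct [y1, y2, y3, y4]"
    using card_4_obtain[OF Y m(3,4,6)] .
  have fin: "finite X" "finite Y" unfolding X' Y' by auto
  have "{(x, y). x \<in> X \<and> y \<in> Y \<and> R x y} = Sigma X (\<lambda>x. {y\<in>Y. R x y})" by auto
  then have "s = (\<Sum>x\<in>X. card {y\<in>Y. R x y})" unfolding s_def using fin by simp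
  also have "\<dots> = (\<Sum>x\<in>X. \<Sum>y\<in>Y. of_bool (R x y))"
    using fin by (simp add: of_bool_def sum.If_cases Int_def)
  also have "\<dots> = of_bool (R x1 y1) + of_bool (R x1 y2) + of_bool (R x1 y3) + of_bool (R x1 y4)
    + (of_bool (R x2 y1) + of_bool (R x2 y2) + of_bool (R x2 y3) + of_bool (R x2 y4))
    + (of_bool (R x3 y1) + of_bool (R x3 y2) + of_bool (R x3 y3) + of_bool (R x3 y4))
    + (of_bool (R x4 y1) + of_bool (R x4 y2) + of_bool (R x4 y3) + of_bool (R x4 y4))"
    unfolding X'(1) Y'(1) using X'(2) Y'(2) by (simp add: add.assoc)
  finally have s: "s = \<dots>" .
  have xm: "x3 \<in> X" "x4 \<in> X" "y3 \<in> Y" "y4 \<in> Y" unfolding X'(1) Y'(1) by simp_all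
  have F: "\<not> R x3 y3" "\<not> R x3 y4" "\<not> R x4 y3" "\<not> R x4 y4"
    using no3[of x1 x2 x3 y1 y2 y3] no3[of x1 x2 x3 y1 y2 y4] no3[of x1 x2 x4 y1 y2 y3] no3[of x1 x2 x4 y1 y2 y4]
      xm m X'(2) Y'(2) by auto
  have s': "s = 2 + (of_bool (R x1 y2) + of_bool (R x1 y3) + of_bool (R x1 y4) + of_bool (R x2 y1)
    + of_bool (R x2 y3) + of_bool (R x2 y4) + of_bool (R x3 y1) + of_bool (R x3 y2) + of_bool (R x4 y1) + of_bool (R x4 y2))"
    using s m(7,8) F by simp
  have uy: "u \<in> Y \<and> y1 \<noteq> u \<and> y2 \<noteq> u" if "u \<in> {y3, y4}" for u using that xm Y'(2) by auto
  have vx: "v \<in> X \<and> x1 \<noteq> v \<and> x2 \<noteq> v" if "v \<in> {x3, x4}" for v using that xm X'(2) by auto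
  have 1: "\<not> (R x1 u \<and> R v y1)" if "u \<in> {y3, y4}" "v \<in> {x3, x4}" for u v
  proof
    assume "R x1 u \<and> R v y1"
    with uy[OF that(1)] vx[OF that(2)] m show False by (intro no3[of x1 x2 v u y2 y1]) auto
  qed
  have 2: "\<not> (R x2 u \<and> R v y2)" if "u \<in> {y3, y4}" "v \<in> {x3, x4}" for u v
  proof
    assume "R x2 u \<and> R v y2"
    with uy[OF that(1)] vx[OF that(2)] m show False by (intro no3[of x2 x1 v u y1 y2]) auto
  qed
  have 3: "\<not> (R x2 y1 \<and> R x1 u \<and> R v y2)" if "u \<in> {y3, y4}" "v \<in> {x3, x4}" for u v
  proof
    assume "R x2 y1 \<and> R x1 u \<and> R v y2"
    with uy[OF that(1)] vx[OF that(2)] m show False by (intro no3[of x1 x2 v u y1 y2]) auto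
  qed
  have 4: "\<not> (R x1 y2 \<and> R x2 u \<and> R v y1)" if "u \<in> {y3, y4}" "v \<in> {x3, x4}" for u v
  proof
    assume "R x1 y2 \<and> R x2 u \<and> R v y1"
    with uy[OF that(1)] vx[OF that(2)] m show False by (intro no3[of x2 x1 v u y2 y1]) auto
  qed
  have c1: "\<exists>c d. cross R X Y c d" if "R x1 y2 \<and> R x1 y3 \<and> R x1 y4 \<and> R x3 y2 \<and> R x4 y2"
  proof -
    have "\<forall>y\<in>Y. R x1 y" "\<forall>x\<in>X. R x y2" using that m(7,8) by (simp_all add: X'(1) Y'(1))
    then have "cross R X Y x1 y2" unfolding cross_def using m(1-4) by blast
    then show ?thesis by blast
  qed
  have c2: "\<exists>c d. cross R X Y c d" if "R x2 y1 \<and> R x2 y3 \<and> R x2 y4 \<and> R x3 y1 \<and> R x4 y1"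
  proof -
    have "\<forall>y\<in>Y. R x2 y" "\<forall>x\<in>X. R x y1" using that m(7,8) by (simp_all add: X'(1) Y'(1))
    then have "cross R X Y x2 y1" unfolding cross_def using m(1-4) by blast
    then show ?thesis by blast
  qed
  have miss: "\<exists>z\<in>Y. \<forall>y\<in>Y - {z}. R x y" if "R x u" "R x v" "R x w" "{u, v, w} \<subseteq> Y" "distinct [u, v, w]" for x u v w
  proof -
    have "card (Y - {u, v, w}) = 1" using that Y by (subst card_Diff_subset) auto
    then obtain z where z: "Y - {u, v, w} = {z}" by (auto simp: card_1_singleton_iff)
    then show ?thesis using that by (intro bexI[of _ z]) auto
  qed
  have miss': "\<exists>z\<in>X. \<forall>x\<in>X - {z}. R x y" if "R u y" "R v y" "R w y" "{u, v, w} \<subseteq> X" "distinct [u, v, w]" for y u v w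
  proof -
    have "card (X - {u, v, w}) = 1" using that X by (subst card_Diff_subset) auto
    then obtain z where z: "X - {u, v, w} = {z}" by (auto simp: card_1_singleton_iff)
    then show ?thesis using that by (intro bexI[of _ z]) auto
  qed
  have a1: "arc R X Y" if "R x1 y2 \<and> R x1 y3 \<and> R x1 y4 \<and> (R x2 y3 \<and> R x2 y4 \<or> R x2 y1 \<and> R x2 y4 \<or> R x2 y1 \<and> R x2 y3)"
  proof -
    have i1: "R x2 y3 \<Longrightarrow> R x2 y4 \<Longrightarrow> \<exists>z\<in>Y. \<forall>y\<in>Y - {z}. R x2 y"
      by (rule miss[of x2 y2 y3 y4]) (use m xm Y'(2) in simp_all)
    have i2: "R x2 y1 \<Longrightarrow> R x2 y4 \<Longrightarrow> \<exists>z\<in>Y. \<forall>y\<in>Y - {z}. R x2 y"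
      by (rule miss[of x2 y1 y2 y4]) (use m xm Y'(2) in simp_all)
    have i3: "R x2 y1 \<Longrightarrow> R x2 y3 \<Longrightarrow> \<exists>z\<in>Y. \<forall>y\<in>Y - {z}. R x2 y"
      by (rule miss[of x2 y1 y2 y3]) (use m xm Y'(2) in simp_all)
    have "\<exists>z\<in>Y. \<forall>y\<in>Y - {z}. R x2 y" using that i1 i2 i3 by blast
    moreover have "\<forall>y\<in>Y. R x1 y" using that m(7,8) by (simp add: Y'(1))
    ultimately show ?thesis using m(1-6) by (intro arcI[of x1 X x2 Y R]) simp_all
  qed
  have a2: "arc R X Y" if "R x2 y1 \<and> R x2 y3 \<and> R x2 y4 \<and> (R x1 y3 \<and> R x1 y4 \<or> R x1 y2 \<and> R x1 y4 \<or> R x1 y2 \<and> R x1 y3)"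
  proof -
    have i1: "R x1 y3 \<Longrightarrow> R x1 y4 \<Longrightarrow> \<exists>z\<in>Y. \<forall>y\<in>Y - {z}. R x1 y"
      by (rule miss[of x1 y1 y3 y4]) (use m xm Y'(2) in simp_all)
    have i2: "R x1 y2 \<Longrightarrow> R x1 y4 \<Longrightarrow> \<exists>z\<in>Y. \<forall>y\<in>Y - {z}. R x1 y"
      by (rule miss[of x1 y1 y2 y4]) (use m xm Y'(2) in simp_all)
    have i3: "R x1 y2 \<Longrightarrow> R x1 y3 \<Longrightarrow> \<exists>z\<in>Y. \<forall>y\<in>Y - {z}. R x1 y"
      by (rule miss[of x1 y1 y2 y3]) (use m xm Y'(2) in simp_all)
    have "\<exists>z\<in>Y. \<forall>y\<in>Y - {z}. R x1 y" using that i1 i2 i3 by blast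
    moreover have "\<forall>y\<in>Y. R x2 y" using that m(7,8) by (simp add: Y'(1))
    ultimately show ?thesis using m(1-6) by (intro arcI[of x2 X x1 Y R]) simp_all
  qed
  have a3: "arc (\<lambda>y x. R x y) Y X" if "R x2 y1 \<and> R x3 y1 \<and> R x4 y1 \<and> (R x3 y2 \<and> R x4 y2 \<or> R x1 y2 \<and> R x4 y2 \<or> R x1 y2 \<and> R x3 y2)"
  proof -
    have i1: "R x3 y2 \<Longrightarrow> R x4 y2 \<Longrightarrow> \<exists>z\<in>X. \<forall>x\<in>X - {z}. R x y2"
      by (rule miss'[of x2 y2 x3 x4]) (use m xm X'(2) in simp_all)
    have i2: "R x1 y2 \<Longrightarrow> R x4 y2 \<Longrightarrow> \<exists>z\<in>X. \<forall>x\<in>X - {z}. R x y2"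
      by (rule miss'[of x1 y2 x2 x4]) (use m xm X'(2) in simp_all)
    have i3: "R x1 y2 \<Longrightarrow> R x3 y2 \<Longrightarrow> \<exists>z\<in>X. \<forall>x\<in>X - {z}. R x y2"
      by (rule miss'[of x1 y2 x2 x3]) (use m xm X'(2) in simp_all)
    have "\<exists>z\<in>X. \<forall>x\<in>X - {z}. R x y2" using that i1 i2 i3 by blast
    moreover have "\<forall>x\<in>X. R x y1" using that m(7,8) by (simp add: X'(1))
    ultimately show ?thesis using m(1-6) by (intro arcI[of y1 Y y2 X "\<lambda>y x. R x y"]) simp_all
  qed
  have a4: "arc (\<lambda>y x. R x y) Y X" if "R x1 y2 \<and> R x3 y2 \<and> R x4 y2 \<and> (R x3 y1 \<and> R x4 y1 \<or> R x2 y1 \<and> R x4 y1 \<or> R x2 y1 \<and> R x3 y1)"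
  proof -
    have i1: "R x3 y1 \<Longrightarrow> R x4 y1 \<Longrightarrow> \<exists>z\<in>X. \<forall>x\<in>X - {z}. R x y1"
      by (rule miss'[of x1 y1 x3 x4]) (use m xm X'(2) in simp_all)
    have i2: "R x2 y1 \<Longrightarrow> R x4 y1 \<Longrightarrow> \<exists>z\<in>X. \<forall>x\<in>X - {z}. R x y1"
      by (rule miss'[of x1 y1 x2 x4]) (use m xm X'(2) in simp_all)
    have i3: "R x2 y1 \<Longrightarrow> R x3 y1 \<Longrightarrow> \<exists>z\<in>X. \<forall>x\<in>X - {z}. R x y1"
      by (rule miss'[of x1 y1 x2 x3]) (use m xm X'(2) in simp_all)
    have "\<exists>z\<in>X. \<forall>x\<in>X - {z}. R x y1" using that i1 i2 i3 by blast
    moreover have "\<forall>x\<in>X. R x y2" using that m(7,8) by (simp add: X'(1))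
    ultimately show ?thesis using m(1-6) by (intro arcI[of y2 Y y1 X "\<lambda>y x. R x y"]) simp_all
  qed
  have c3: "R x2 y1 \<Longrightarrow> \<not> ((R x1 y3 \<or> R x1 y4) \<and> (R x3 y2 \<or> R x4 y2))"
    using 3[of y3 x3] 3[of y3 x4] 3[of y4 x3] 3[of y4 x4] by auto
  have c4: "R x1 y2 \<Longrightarrow> \<not> ((R x2 y3 \<or> R x2 y4) \<and> (R x3 y1 \<or> R x4 y1))"
    using 4[of y3 x3] 4[of y3 x4] 4[of y4 x3] 4[of y4 x4] by auto
  have "s \<le> 6 \<or> s \<le> 7 \<and> (R x1 y2 \<and> R x1 y3 \<and> R x1 y4 \<and> R x3 y2 \<and> R x4 y2 \<or> R x2 y1 \<and> R x2 y3 \<and> R x2 y4 \<and> R x3 y1 \<and> R x4 y1)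
    \<or> s \<le> 8 \<and> (R x1 y2 \<and> R x1 y3 \<and> R x1 y4 \<and> (R x2 y3 \<and> R x2 y4 \<or> R x2 y1 \<and> R x2 y4 \<or> R x2 y1 \<and> R x2 y3) \<or>
        R x2 y1 \<and> R x2 y3 \<and> R x2 y4 \<and> (R x1 y3 \<and> R x1 y4 \<or> R x1 y2 \<and> R x1 y4 \<or> R x1 y2 \<and> R x1 y3))
    \<or> s \<le> 8 \<and> (R x2 y1 \<and> R x3 y1 \<and> R x4 y1 \<and> (R x3 y2 \<and> R x4 y2 \<or> R x1 y2 \<and> R x4 y2 \<or> R x1 y2 \<and> R x3 y2) \<or>
        R x1 y2 \<and> R x3 y2 \<and> R x4 y2 \<and> (R x3 y1 \<and> R x4 y1 \<or> R x2 y1 \<and> R x4 y1 \<or> R x2 y1 \<and> R x3 y1))"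
    by (rule four_by_four_bool[OF _ _ _ _ _ _ _ _ c3 c4 s'])
      (use 1[of y3 x3] 1[of y3 x4] 1[of y4 x3] 1[of y4 x4] 2[of y3 x3] 2[of y3 x4] 2[of y4 x3] 2[of y4 x4] in simp_all)
  then show ?thesis using c1 c2 a1 a2 a3 a4 by argo
next
  case False
  have fin: "finite X" "finite Y" using X Y by (metis card.infinite zero_neq_numeral)+
  \<comment> \<open>Without two disjoint pairs all pairs share a vertex.\<close>
  have "s \<le> 4"
  proof (cases "\<exists>x\<in>X. \<exists>y\<in>Y. R x y")
    case True
    then obtain x0 y0 where xy: "x0 \<in> X" "y0 \<in> Y" "R x0 y0" by blast
    have "{(x, y). x \<in> X \<and> y \<in> Y \<and> R x y} \<subseteq> {x0} \<times> Y \<or> {(x, y). x \<in> X \<and> y \<in> Y \<and> R x y} \<subseteq> X \<times> {y0}"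
    proof (rule ccontr)
      assume "\<not> ?thesis"
      then obtain x y x' y' where "x \<in> X" "y \<in> Y" "R x y" "x \<noteq> x0" "x' \<in> X" "y' \<in> Y" "R x' y'" "y' \<noteq> y0" by blast
      then show False using False xy by metis
    qed
    then have "s \<le> card ({x0} \<times> Y) \<or> s \<le> card (X \<times> {y0})"
      unfolding s_def using card_mono[of "{x0} \<times> Y"] card_mono[of "X \<times> {y0}"] fin by blast
    then show ?thesis using X Y by (simp add: card_cartesian_product)
  next
    case False
    then have "{(x, y). x \<in> X \<and> y \<in> Y \<and> R x y} = {}" by auto
    then show ?thesis unfolding s_def by (simp only: card.empty le0)
  qed
  then show ?thesis by simp
qed

subsection \<open>Maximal families of disjoint copies\<close>

text \<open>\<open>P\<close> has maximum cardinality and is not just maximal under inclusion, since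
  several tiles are exchanged at once.\<close>

locale max_tiling = tgraph +
  fixes P :: "'a set set"
  assumes finP: "finite P" and disjP: "disjoint P" and quadP: "\<And>X. X \<in> P \<Longrightarrow> quad E X"
    and maxP: "\<And>P'. finite P' \<Longrightarrow> disjoint P' \<Longrightarrow> (\<And>X. X \<in> P' \<Longrightarrow> quad E X) \<Longrightarrow> card P' \<le> card P"
begin

definition U :: "'a set" where "U = V - \<Union>P"

text \<open>With \<open>32\<close> common neighbours in \<open>U\<close>, up to fourteen disjoint heavy pairs extend greedily to disjoint
  copies that also avoid one further copy (two vertices of \<open>U\<close> for each pair and four more).\<close>

definition heavy :: "'a \<Rightarrow> 'a \<Rightarrow> bool" where
  "heavy x y \<longleftrightarrow> x \<in> \<Union>P \<and> y \<in> \<Union>P \<and> x \<noteq> y \<and> 32 \<le> card {u\<in>U. {u, x, y} \<in> E}"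

lemma heavy_sym: "heavy x y \<longleftrightarrow> heavy y x"
  unfolding heavy_def by (auto simp: insert_commute)

lemma finU: "finite U" and U_sub: "U \<subseteq> V"
  using finV by (auto simp: U_def)

lemma P_sub: "X \<in> P \<Longrightarrow> X \<subseteq> V" and P_card: "X \<in> P \<Longrightarrow> card X = 4" and P_fin: "X \<in> P \<Longrightarrow> finite X"
  using quad_sub[OF quadP] quad_finite[OF quadP] quadP[unfolded quad_def] by auto

lemma P_pick:
  assumes "X \<in> P" "finite F" "card F \<le> 3"
  shows "\<exists>y\<in>X. y \<notin> F"
proof -
  have "card X - card F \<le> card (X - F)" using assms by (intro diff_card_le_card_Diff) auto
  then have "card (X - F) \<noteq> 0" using assms P_card by simp
  then have "X - F \<noteq> {}" by (metis card.empty)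
  then show ?thesis by auto
qed

lemma P_disj: "X \<in> P \<Longrightarrow> Y \<in> P \<Longrightarrow> X \<noteq> Y \<Longrightarrow> X \<inter> Y = {}"
  using disjP by (auto simp: disjoint_def)

lemma P_U: "X \<in> P \<Longrightarrow> X \<inter> U = {}"
  by (auto simp: U_def)

text \<open>The tiles in \<open>P0\<close> are exchanged for \<open>Q\<close>, which stays clear of
  all other tiles. Every structural fact about \<open>P\<close> below is a contradiction to this
  inequality.\<close>

lemma swap:
  assumes "P0 \<subseteq> P" "finite Q" "disjoint Q" "\<And>X. X \<in> Q \<Longrightarrow> quad E X" "\<Union>Q \<subseteq> \<Union>P0 \<union> U"
  shows "card Q \<le> card P0"
proof -
  have fP0: "finite P0" using assms(1) finP finite_subset by auto
  have *: "X \<inter> Y = {}" if "X \<in> P - P0" "Y \<in> Q" for X Y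
  proof -
    have "X \<inter> Z = {}" if "Z \<in> P0" for Z using that \<open>X \<in> P - P0\<close> assms(1) P_disj[of X Z] by blast
    then have "X \<inter> \<Union>P0 = {}" by auto
    moreover have "X \<inter> U = {}" using that P_U by auto
    moreover have "Y \<subseteq> \<Union>P0 \<union> U" using that assms(5) by auto
    ultimately show ?thesis by blast
  qed
  have ne: "X \<noteq> {}" if "X \<in> P" for X using P_card[OF that] by auto
  have "(P - P0) \<inter> Q = {}" using * ne by fastforce
  then have c: "card ((P - P0) \<union> Q) = card (P - P0) + card Q"
    using finP assms(2) by (intro card_Un_disjoint) auto
  have "disjoint ((P - P0) \<union> Q)"
  proof (rule disjoint_union)
    show "disjoint (P - P0)" using disjP by (auto simp: disjoint_def)
    show "\<Union>(P - P0) \<inter> \<Union>Q = {}" using * by blast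
  qed (rule assms(3))
  then have "card ((P - P0) \<union> Q) \<le> card P" using finP assms quadP by (intro maxP) auto
  moreover have "card (P - P0) = card P - card P0" "card P0 \<le> card P"
    using assms(1) fP0 finP by (auto simp: card_Diff_subset card_mono)
  ultimately show ?thesis using c by linarith
qed

lemma no_quad_U: "quad E Z \<Longrightarrow> \<not> Z \<subseteq> U"
  using swap[of "{}" "{Z}"] by (auto simp: disjoint_def)

section \<open>Disjoint heavy pairs and the copies they yield\<close>

definition matching :: "('a \<times> 'a) list \<Rightarrow> bool" where
  "matching ps \<longleftrightarrow> distinct (map fst ps @ map snd ps) \<and> (\<forall>(x, y)\<in>set ps. heavy x y)"

definition verts :: "('a \<times> 'a) list \<Rightarrow> 'a set" where
  "verts ps = fst ` set ps \<union> snd ` set ps"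

text \<open>Each heavy pair takes two vertices of \<open>U\<close> that complete it to edges. With
  \<open>F\<close> and the vertices already taken there are at most 30 forbidden ones when a pair is
  served, so two of the 32 candidates remain.\<close>

lemma matching_extend:
  assumes "matching ps" "finite F" "card F + 2 * length ps \<le> 32"
  shows "\<exists>Q. finite Q \<and> disjoint Q \<and> card Q = length ps \<and> (\<forall>X\<in>Q. quad E X) \<and> \<Union>Q \<subseteq> verts ps \<union> (U - F)"
  using assms
proof (induction ps arbitrary: F)
  case Nil
  show ?case by (rule exI[of _ "{}"]) simp
next
  case (Cons p ps)
  obtain x y where p: "p = (x, y)" by fastforce
  have h: "heavy x y" and m: "matching ps" and nv: "x \<notin> verts ps" "y \<notin> verts ps"
    using Cons.prems(1) unfolding matching_def verts_def p by auto
  define D where "D = {u\<in>U. {u, x, y} \<in> E} - F"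
  have "32 - card F \<le> card D" using h Cons.prems(2) finU unfolding D_def heavy_def
    by (intro order_trans[OF _ diff_card_le_card_Diff]) auto
  then have "2 \<le> card D" using Cons.prems(3) by simp
  then obtain D' where D': "D' \<subseteq> D" "card D' = 2" by (rule obtain_subset_with_card_n)
  then obtain u v where uv: "D' = {u, v}" "u \<noteq> v" by (auto simp: card_2_iff)
  have u: "u \<in> U" "u \<notin> F" "{u, x, y} \<in> E" and v: "v \<in> U" "v \<notin> F" "{v, x, y} \<in> E"
    using D' uv by (auto simp: D_def)
  have "card (F \<union> {u, v}) + 2 * length ps \<le> 32"
    using Cons.prems(3) card_Un_le[of F "{u, v}"] uv by simp
  then obtain Q where Q: "finite Q" "disjoint Q" "card Q = length ps" "\<forall>X\<in>Q. quad E X"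
    "\<Union>Q \<subseteq> verts ps \<union> (U - (F \<union> {u, v}))"
    using Cons.IH[OF m, of "F \<union> {u, v}"] Cons.prems(2) by auto
  have xyU: "x \<notin> U" "y \<notin> U" using h by (auto simp: heavy_def U_def)
  note d = edge_distinct[OF u(3)] edge_distinct[OF v(3)]
  have q: "quad E {x, y, u, v}"
    using quad_two_edges[of x y u E v] u(3) v(3) d uv(2) by (auto simp: insert_commute)
  have vs: "verts (p # ps) = {x, y} \<union> verts ps" unfolding verts_def p by auto
  have vU: "verts ps \<inter> U = {}"
    using m unfolding matching_def verts_def heavy_def U_def by fastforce
  have "{x, y, u, v} \<inter> \<Union>Q = {}" using Q(5) nv xyU vU u(1) v(1) by auto
  moreover from this have "{x, y, u, v} \<notin> Q" by auto
  ultimately have "disjoint (insert {x, y, u, v} Q)" "card (insert {x, y, u, v} Q) = Suc (length ps)"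
    using Q by (auto simp: disjoint_def)
  moreover have "\<Union>(insert {x, y, u, v} Q) \<subseteq> verts (p # ps) \<union> (U - F)"
    unfolding vs using Q(5) u v by auto
  ultimately show ?case using Q q by (intro exI[of _ "insert {x, y, u, v} Q"]) auto
qed

lemma matching_le:
  assumes "matching ps" "verts ps \<subseteq> \<Union>P0" "P0 \<subseteq> P" "length ps \<le> 16"
  shows "length ps \<le> card P0"
proof -
  obtain Q where Q: "finite Q" "disjoint Q" "card Q = length ps" "\<forall>X\<in>Q. quad E X" "\<Union>Q \<subseteq> verts ps \<union> U"
    using matching_extend[OF assms(1), of "{}"] assms(4) by auto
  then show ?thesis using swap[of P0 Q] assms by auto
qed

text \<open>The extra copy \<open>Z\<close> counts as one more tile, and reserving its vertices
  costs four: 4 + 2 * 14 = 32.\<close>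

lemma matching_quad_le:
  assumes "matching ps" "verts ps \<subseteq> \<Union>P0" "P0 \<subseteq> P" "length ps \<le> 14"
    and Z: "quad E Z" "Z \<subseteq> \<Union>P0 \<union> U" "Z \<inter> verts ps = {}"
  shows "length ps < card P0"
proof -
  have cZ: "card Z = 4" "finite Z" using Z quad_finite by (auto simp: quad_def)
  obtain Q where Q: "finite Q" "disjoint Q" "card Q = length ps" "\<forall>X\<in>Q. quad E X" "\<Union>Q \<subseteq> verts ps \<union> (U - Z)"
    using matching_extend[OF assms(1), of Z] assms(4) cZ by auto
  have ZQ: "Z \<inter> \<Union>Q = {}" using Q(5) Z(3) by auto
  have "Z \<notin> Q"
  proof
    assume "Z \<in> Q"
    then have "Z = {}" using ZQ by blast
    then show False using cZ by simp
  qed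
  moreover have "disjoint (insert Z Q)" using Q(2) ZQ by (auto simp: disjoint_def)
  moreover have "\<Union>(insert Z Q) \<subseteq> \<Union>P0 \<union> U" using Q(5) Z(2) assms(2) by blast
  moreover have "quad E X" if "X \<in> insert Z Q" for X using that Z(1) Q(4) by blast
  ultimately have "card (insert Z Q) \<le> card P0" using Q(1) assms(3) by (intro swap) auto
  then show ?thesis using \<open>Z \<notin> Q\<close> Q by simp
qed

section \<open>Heavy pairs between two and three tiles\<close>

abbreviation crossed :: "'a set \<Rightarrow> 'a set \<Rightarrow> bool" where
  "crossed X Y \<equiv> \<exists>c d. cross heavy X Y c d"

lemma cross_sym: "cross heavy X Y c d \<Longrightarrow> cross heavy Y X d c"
  unfolding cross_def using heavy_sym by blast

lemma heavy_no3:
  assumes "X \<in> P" "Y \<in> P" "X \<noteq> Y"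
    and "x1 \<in> X" "x2 \<in> X" "x3 \<in> X" "y1 \<in> Y" "y2 \<in> Y" "y3 \<in> Y"
    "distinct [x1, x2, x3]" "distinct [y1, y2, y3]" "heavy x1 y1" "heavy x2 y2" "heavy x3 y3"
  shows False
proof -
  have "X \<inter> Y = {}" using assms P_disj by auto
  then have "matching [(x1, y1), (x2, y2), (x3, y3)]" using assms unfolding matching_def by auto
  then have "length [(x1, y1), (x2, y2), (x3, y3)] \<le> card {X, Y}"
    by (rule matching_le) (use assms in \<open>auto simp: verts_def\<close>)
  then show False using assms(3) by simp
qed

text \<open>The trichotomy of \<open>four_by_four\<close> as one linear bound, which can be summed
  over all pairs of tiles.\<close>

lemma heavy_pairs:
  assumes "X \<in> P" "Y \<in> P" "X \<noteq> Y"
  shows "card {(x, y). x \<in> X \<and> y \<in> Y \<and> heavy x y}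
    \<le> 6 + of_bool (crossed X Y) + 2 * of_bool (arc heavy X Y) + 2 * of_bool (arc heavy Y X)"
proof -
  have "(\<lambda>y x. heavy x y) = heavy" using heavy_sym by (intro ext) blast
  moreover have "\<And>s. s = card {(x, y). x \<in> X \<and> y \<in> Y \<and> heavy x y} \<Longrightarrow> s \<le> 6 \<or> s \<le> 7 \<and> crossed X Y \<or>
      s \<le> 8 \<and> arc heavy X Y \<or> s \<le> 8 \<and> arc (\<lambda>y x. heavy x y) Y X"
    using four_by_four[OF P_card[OF assms(1)] P_card[OF assms(2)], of heavy] heavy_no3[OF assms] by blast
  ultimately show ?thesis by (auto simp del: split_paired_Ex)
qed

text \<open>Two arcs into \<open>Y\<close> would match their four vertices to the four vertices of
  \<open>Y\<close>: four disjoint heavy pairs in three tiles. The vertices \<open>a'\<close> and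
  \<open>b'\<close>, which may each miss one vertex of \<open>Y\<close>, choose before
  \<open>a\<close> and \<open>b\<close>.\<close>

lemma arc_unique:
  assumes X: "X \<in> P" "X' \<in> P" "Y \<in> P" "X \<noteq> Y" "X' \<noteq> Y" and a: "arc heavy X Y" "arc heavy X' Y"
  shows "X = X'"
proof (rule ccontr)
  assume ne: "X \<noteq> X'"
  obtain a a' z where A: "a \<in> X" "a' \<in> X" "a \<noteq> a'" "\<forall>y\<in>Y. heavy a y" "\<forall>y\<in>Y - {z}. heavy a' y"
    using a(1) unfolding arc_def by blast
  obtain b b' w where B: "b \<in> X'" "b' \<in> X'" "b \<noteq> b'" "\<forall>y\<in>Y. heavy b y" "\<forall>y\<in>Y - {w}. heavy b' y"
    using a(2) unfolding arc_def by blast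
  have cY: "card Y = 4" "finite Y" using X P_card P_fin by auto
  obtain y2 where y2: "y2 \<in> Y" "y2 \<noteq> z" using P_pick[OF X(3), of "{z}"] by auto
  have "card {w, y2} \<le> 3" by (simp add: card_insert_if)
  then obtain y4 where y4: "y4 \<in> Y" "y4 \<noteq> w" "y4 \<noteq> y2" using P_pick[OF X(3), of "{w, y2}"] by auto
  obtain y1 y3 where Y: "Y = {y2, y4, y1, y3}" "distinct [y2, y4, y1, y3]"
    using card_4_obtain[OF cY(1) y2(1) y4(1)] y4(3) by metis
  have d: "X \<inter> X' = {}" "X \<inter> Y = {}" "X' \<inter> Y = {}" using X ne P_disj by auto
  have yy: "y1 \<in> Y" "y3 \<in> Y" using Y by auto
  have h: "heavy a y1" "heavy a' y2" "heavy b y3" "heavy b' y4" using A B y2 y4 yy by auto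
  have "distinct [a, a', b, b', y1, y2, y3, y4]" using A B d y2(1) y4(1) yy Y(2) by auto
  then have "matching [(a, y1), (a', y2), (b, y3), (b', y4)]" using h unfolding matching_def by auto
  then have "length [(a, y1), (a', y2), (b, y3), (b', y4)] \<le> card {X, X', Y}"
    by (rule matching_le) (use X A B y2 y4 yy in \<open>auto simp: verts_def\<close>)
  then show False using card_insert_le_m1 by (simp add: card_insert_if split: if_splits)
qed

text \<open>Two different centres \<open>c\<close>, \<open>d\<close> in \<open>X\<close> would go to
  non-central vertices of \<open>Y\<close> and \<open>Z\<close>, while the other two vertices of
  \<open>X\<close> go to the centres \<open>c'\<close>, \<open>d'\<close>: four disjoint heavy pairs
  in three tiles. If \<open>Y\<close> and \<open>Z\<close> coincide, three disjoint pairs arise in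
  two tiles.\<close>

lemma cross_unique:
  assumes X: "X \<in> P" "Y \<in> P" "Z \<in> P" "X \<noteq> Y" "X \<noteq> Z"
    and c: "cross heavy X Y c c'" "cross heavy X Z d d'"
  shows "c = d"
proof (rule ccontr)
  assume ne: "c \<noteq> d"
  note C = c(1)[unfolded cross_def] c(2)[unfolded cross_def]
  obtain x x' where x: "X = {c, d, x, x'}" "distinct [c, d, x, x']"
    using card_4_obtain[OF P_card[OF X(1)] _ _ ne] C by metis
  have xX: "x \<in> X" "x' \<in> X" using x by auto
  show False
  proof (cases "Y = Z")
    case True
    obtain y where y: "y \<in> Y" "y \<noteq> c'" using P_pick[OF X(2), of "{c'}"] by auto
    have "card {c', y} \<le> 3" by (simp add: card_insert_if)
    then obtain y' where y': "y' \<in> Y" "y' \<noteq> c'" "y' \<noteq> y" using P_pick[OF X(2), of "{c', y}"] by auto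
    show False
      by (rule heavy_no3[OF X(1,2,4), of c d x y y' c']) (use C x xX y y' True in auto)
  next
    case False
    obtain y where y: "y \<in> Y" "y \<noteq> c'" using P_pick[OF X(2), of "{c'}"] by auto
    obtain z where z: "z \<in> Z" "z \<noteq> d'" using P_pick[OF X(3), of "{d'}"] by auto
    have d: "X \<inter> Y = {}" "X \<inter> Z = {}" "Y \<inter> Z = {}" using X False P_disj by auto
    have h: "heavy c y" "heavy d z" "heavy x c'" "heavy x' d'" using C xX y z by auto
    have "distinct [c, d, x, x', y, z, c', d']" using C xX d y z x(2) by auto
    then have "matching [(c, y), (d, z), (x, c'), (x', d')]" using h unfolding matching_def by auto
    then have "length [(c, y), (d, z), (x, c'), (x', d')] \<le> card {X, Y, Z}"
      by (rule matching_le) (use X C xX y z in \<open>auto simp: verts_def\<close>)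
    then show False by (simp add: card_insert_if split: if_splits)
  qed
qed

text \<open>If every vertex of \<open>U - F\<close> had at most one neighbour in
  \<open>U - F\<close> within the link of \<open>x\<close>, that link would have at most |U| + 2 * 3
  * |U| = 7 |U| pairs in \<open>U\<close>.\<close>

lemma cherry_in_U:
  assumes "32 * card U < card {(u, v). u \<in> U \<and> v \<in> U \<and> {x, u, v} \<in> E}" "x \<notin> U" "finite F" "card F \<le> 3"
  obtains S where "quad E S" "S \<subseteq> insert x (U - F)" "x \<in> S"
proof -
  let ?L = "{(u, v). u \<in> U \<and> v \<in> U \<and> {x, u, v} \<in> E}"
  let ?D = "\<lambda>u. {v \<in> U - F. {x, u, v} \<in> E}"
  have "\<exists>u\<in>U - F. 2 \<le> card (?D u)"
  proof (rule ccontr)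
    assume "\<not> ?thesis"
    then have le: "card (?D u) \<le> 1" if "u \<in> U - F" for u using that by force
    have "?L \<subseteq> Sigma (U - F) ?D \<union> (F \<times> U \<union> U \<times> F)" by auto
    then have "card ?L \<le> card (Sigma (U - F) ?D \<union> (F \<times> U \<union> U \<times> F))"
      using finU assms(3) by (intro card_mono) auto
    also have "\<dots> \<le> card (Sigma (U - F) ?D) + (card (F \<times> U) + card (U \<times> F))"
      by (meson add_left_mono card_Un_le order_trans)
    also have "card (Sigma (U - F) ?D) = (\<Sum>u\<in>U - F. card (?D u))" using finU by (intro card_SigmaI) auto
    also have "\<dots> \<le> (\<Sum>u\<in>U - F. 1)" using le by (intro sum_mono) auto
    also have "\<dots> \<le> card U" using finU by (simp add: card_mono)
    also have "card (F \<times> U) + card (U \<times> F) = 2 * card F * card U" by (simp add: card_cartesian_product)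
    also have "\<dots> \<le> 6 * card U" using assms(4) by (intro mult_right_mono) auto
    finally have "card ?L \<le> card U + 6 * card U" by simp
    then show False using assms(1) by simp
  qed
  then obtain u where u: "u \<in> U - F" "2 \<le> card (?D u)" by blast
  obtain D where D: "D \<subseteq> ?D u" "card D = 2" using u(2) by (rule obtain_subset_with_card_n)
  then obtain v w where vw: "D = {v, w}" "v \<noteq> w" by (auto simp: card_2_iff)
  have e: "{x, u, v} \<in> E" "{x, u, w} \<in> E" "v \<in> U - F" "w \<in> U - F" using D vw by auto
  have "quad E {x, u, v, w}" using quad_cherry(1)[OF e(1,2) vw(2)] by simp
  then show ?thesis using that[of "{x, u, v, w}"] e u by auto
qed

text \<open>Otherwise two disjoint copies, one through \<open>x\<close> and one through
  \<open>y\<close>, would replace a single tile. The second copy avoids the three vertices of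
  \<open>U\<close> in the first.\<close>

lemma heavy_vertex_unique:
  assumes X: "X \<in> P" "x \<in> X" "y \<in> X"
    and h: "32 * card U < card {(u, v). u \<in> U \<and> v \<in> U \<and> {x, u, v} \<in> E}"
      "32 * card U < card {(u, v). u \<in> U \<and> v \<in> U \<and> {y, u, v} \<in> E}"
  shows "x = y"
proof (rule ccontr)
  assume ne: "x \<noteq> y"
  have U: "x \<notin> U" "y \<notin> U" using X P_U by auto
  obtain S where S: "quad E S" "S \<subseteq> insert x (U - {})" "x \<in> S" using cherry_in_U[OF h(1) U(1), of "{}"] by auto
  have cS: "card S = 4" "finite S" using S quad_finite by (auto simp: quad_def)
  have "card (S - {x}) \<le> 3" using cS S(3) by simp
  then obtain T where T: "quad E T" "T \<subseteq> insert y (U - (S - {x}))" "y \<in> T"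
    using cherry_in_U[OF h(2) U(2), of "S - {x}"] cS by auto
  have "S \<inter> T = {}" using S T ne U by auto
  moreover have "S \<noteq> T" using calculation S by auto
  ultimately have "card {S, T} = 2" "disjoint {S, T}" by (auto simp: disjoint_def)
  moreover have "card {S, T} \<le> card {X}" using X S T \<open>disjoint {S, T}\<close> by (intro swap) auto
  ultimately show False by simp
qed

section \<open>Counting degrees of uncovered vertices by codegrees\<close>

definition cod :: "'a \<Rightarrow> 'a \<Rightarrow> nat" where
  "cod x y = card {u\<in>U. {u, x, y} \<in> E}"

definition crossings :: nat where
  "crossings = card {(X, Y). X \<in> P \<and> Y \<in> P \<and> X \<noteq> Y \<and> crossed X Y}"

lemma cod_sym: "cod x y = cod y x"
  unfolding cod_def by (simp add: insert_commute)

lemma cod_le: "cod x y \<le> card U"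
  unfolding cod_def using finU by (intro card_mono) auto

lemma sum_cod_vertex: "(\<Sum>x\<in>U. cod x y) = card {(u, v). u \<in> U \<and> v \<in> U \<and> {y, u, v} \<in> E}"
  using card_SIGMA_Collect[OF finU finU, of "\<lambda>u v. {y, u, v} \<in> E"]
  unfolding cod_def by (simp add: insert_commute)

lemma sum_pdeg_U: "(\<Sum>u\<in>U. pdeg u) = (\<Sum>x\<in>V. \<Sum>y\<in>V. cod x y)"
proof -
  have fp: "pdeg u = (\<Sum>p\<in>V \<times> V. of_bool ({u, fst p, snd p} \<in> E))" for u
  proof -
    have "{(x, y) \<in> V \<times> V. {u, x, y} \<in> E} = {p \<in> V \<times> V. {u, fst p, snd p} \<in> E}" by auto
    then show ?thesis unfolding pdeg_def using finV by (simp add: of_bool_def sum.If_cases Int_def)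
  qed
  have "(\<Sum>u\<in>U. pdeg u) = (\<Sum>p\<in>V \<times> V. \<Sum>u\<in>U. of_bool ({u, fst p, snd p} \<in> E))"
    unfolding fp by (rule sum.swap)
  also have "\<dots> = (\<Sum>p\<in>V \<times> V. cod (fst p) (snd p))"
    unfolding cod_def using finU by (simp add: of_bool_def sum.If_cases Int_def)
  also have "\<dots> = (\<Sum>x\<in>V. \<Sum>y\<in>V. cod x y)" by (simp add: sum.cartesian_product case_prod_unfold)
  finally show ?thesis .
qed

lemma cod_U: 
  assumes "x \<in> U" "y \<in> U" shows "cod x y \<le> 1"
proof (rule ccontr)
  assume "\<not> ?thesis"
  then have "2 \<le> card {u\<in>U. {u, x, y} \<in> E}" unfolding cod_def by simp
  then obtain D where "D \<subseteq> {u\<in>U. {u, x, y} \<in> E}" "card D = 2" by (rule obtain_subset_with_card_n)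
  then obtain u v where uv: "u \<in> U" "v \<in> U" "u \<noteq> v" "{u, x, y} \<in> E" "{v, x, y} \<in> E" by (auto simp: card_2_iff)
  note d = edge_distinct[OF uv(4)] edge_distinct[OF uv(5)]
  have "quad E {x, y, u, v}"
    using quad_two_edges[of x y u E v] uv d by (auto simp: insert_commute)
  then show False using no_quad_U assms uv by blast
qed

text \<open>One vertex of the tile may have up to |U|^2 link pairs in \<open>U\<close>; by
  \<open>heavy_vertex_unique\<close> the others have at most 32 |U| each.\<close>

lemma sum_cod_tile:
  assumes "X \<in> P"
  shows "(\<Sum>y\<in>X. \<Sum>x\<in>U. cod x y) \<le> card U * card U + 128 * card U"
proof -
  let ?l = "\<lambda>y. card {(u, v). u \<in> U \<and> v \<in> U \<and> {y, u, v} \<in> E}"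
  have l: "?l y \<le> card U * card U" for y
  proof -
    have "?l y \<le> card (U \<times> U)" using finU by (intro card_mono) auto
    then show ?thesis by (simp add: card_cartesian_product)
  qed
  have fX: "finite X" and cX: "card X = 4" using assms P_fin P_card by auto
  show ?thesis
  proof (cases "\<exists>x\<in>X. 32 * card U < ?l x")
    case True
    then obtain x where x: "x \<in> X" "32 * card U < ?l x" by blast
    have "?l y \<le> 32 * card U" if "y \<in> X - {x}" for y
    proof (rule ccontr)
      assume "\<not> ?thesis"
      then have "32 * card U < ?l y" by simp
      then have "y = x" using heavy_vertex_unique[OF assms _ x(1) _ x(2)] that by auto
      then show False using that by simp
    qed
    then have "(\<Sum>y\<in>X - {x}. ?l y) \<le> (\<Sum>y\<in>X - {x}. 32 * card U)" by (intro sum_mono) auto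
    also have "\<dots> \<le> 128 * card U" using cX x(1) fX by simp
    finally have "(\<Sum>y\<in>X. ?l y) \<le> ?l x + 128 * card U" using x(1) fX by (simp add: sum.remove)
    then show ?thesis using l[of x] unfolding sum_cod_vertex by simp
  next
    case False
    then have "(\<Sum>y\<in>X. ?l y) \<le> (\<Sum>y\<in>X. 32 * card U)" by (intro sum_mono) (auto simp: not_less)
    also have "\<dots> = 128 * card U" using cX by simp
    finally show ?thesis unfolding sum_cod_vertex by simp
  qed
qed

text \<open>A heavy pair counts at most |U|. The at most sixteen others count less than 32 each,
  hence the error 512, which does not grow with |U|.\<close>

lemma sum_cod_two_tiles:
  assumes "X \<in> P" "Y \<in> P" "X \<noteq> Y"
  shows "(\<Sum>x\<in>X. \<Sum>y\<in>Y. cod x y) \<le>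
    card U * (6 + of_bool (crossed X Y) + 2 * of_bool (arc heavy X Y) + 2 * of_bool (arc heavy Y X)) + 512"
proof -
  have d: "X \<inter> Y = {}" using assms P_disj by auto
  have f: "finite X" "finite Y" "card X = 4" "card Y = 4" using assms P_fin P_card by auto
  have c: "cod x y \<le> card U * of_bool (heavy x y) + 32" if "x \<in> X" "y \<in> Y" for x y
  proof (cases "heavy x y")
    case True
    then show ?thesis using cod_le[of x y] by simp
  next
    case False
    have "x \<noteq> y" "x \<in> \<Union>P" "y \<in> \<Union>P" using that d assms by auto
    then have "\<not> 32 \<le> cod x y" using False unfolding heavy_def cod_def by blast
    then show ?thesis by simp
  qed
  have "(\<Sum>x\<in>X. \<Sum>y\<in>Y. cod x y) \<le> (\<Sum>x\<in>X. \<Sum>y\<in>Y. card U * of_bool (heavy x y) + 32)"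
    using c by (intro sum_mono) auto
  also have "\<dots> = card U * (\<Sum>x\<in>X. \<Sum>y\<in>Y. of_bool (heavy x y)) + 512"
    using f by (simp add: sum.distrib sum_distrib_left mult.commute)
  also have "(\<Sum>x\<in>X. \<Sum>y\<in>Y. of_bool (heavy x y)) = (\<Sum>x\<in>X. card {y\<in>Y. heavy x y})"
    using f by (simp add: of_bool_def sum.If_cases Int_def)
  also have "\<dots> = card {(x, y). x \<in> X \<and> y \<in> Y \<and> heavy x y}"
    by (rule card_SIGMA_Collect[OF f(1,2), symmetric])
  also have "card U * card {(x, y). x \<in> X \<and> y \<in> Y \<and> heavy x y} \<le>
    card U * (6 + of_bool (crossed X Y) + 2 * of_bool (arc heavy X Y) + 2 * of_bool (arc heavy Y X))"
    using heavy_pairs[OF assms] by (rule mult_left_mono) simp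
  finally show ?thesis by simp
qed

text \<open>By \<open>arc_unique\<close> each tile receives at most one arc, so pairs of tiles with
  eight heavy pairs are linear in number and do not affect the quadratic main term.\<close>

lemma sum_arcs: "(\<Sum>Y\<in>P. \<Sum>X\<in>P - {Y}. of_bool (arc heavy X Y)) \<le> card P"
proof -
  have "(\<Sum>X\<in>P - {Y}. of_bool (arc heavy X Y)) \<le> (1 :: nat)" if Y: "Y \<in> P" for Y
  proof -
    have "card {X\<in>P - {Y}. arc heavy X Y} \<le> 1"
    proof (rule ccontr)
      assume "\<not> ?thesis"
      then have "2 \<le> card {X\<in>P - {Y}. arc heavy X Y}" by simp
      then obtain D where "D \<subseteq> {X\<in>P - {Y}. arc heavy X Y}" "card D = 2" by (rule obtain_subset_with_card_n)
      then obtain X X' where "X \<in> P - {Y}" "X' \<in> P - {Y}" "X \<noteq> X'" "arc heavy X Y" "arc heavy X' Y"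
        by (auto simp: card_2_iff)
      then show False using arc_unique[of X X' Y] Y by auto
    qed
    then show ?thesis using finP by (simp add: of_bool_def sum.If_cases Int_def)
  qed
  then have "(\<Sum>Y\<in>P. \<Sum>X\<in>P - {Y}. of_bool (arc heavy X Y)) \<le> (\<Sum>Y\<in>P. 1 :: nat)" by (rule sum_mono)
  then show ?thesis by simp
qed

text \<open>Pairs are split by how many of their vertices lie in \<open>U\<close>. The main terms
  are 6 m^2 plus the crossings for pairs of tiles and 2 m |U| for mixed pairs, each times |U|; the
  rest is of lower order.\<close>

lemma sum_pdeg_le:
  "(\<Sum>u\<in>U. pdeg u) \<le> card U * card U + 2 * (card P * (card U * card U + 128 * card U)) + 16 * card U * card P
    + card U * (6 * card P * card P + crossings + 4 * card P) + 512 * card P * card P"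
proof -
  define W where "W = \<Union>P"
  define f where "f S R = (\<Sum>x\<in>S. \<Sum>y\<in>R. cod x y)" for S R
  let ?L = "card U" and ?m = "card P"
  have fW: "finite W" unfolding W_def using finP P_fin by auto
  have VUW: "V = U \<union> W" "U \<inter> W = {}" using P_sub unfolding U_def W_def by auto
  have sumW: "(\<Sum>x\<in>W. g x) = (\<Sum>X\<in>P. \<Sum>x\<in>X. g x)" for g :: "'a \<Rightarrow> nat"
    unfolding W_def using P_fin P_disj by (subst sum.Union_disjoint) auto
  have sumV: "(\<Sum>x\<in>V. g x) = (\<Sum>x\<in>U. g x) + (\<Sum>x\<in>W. g x)" for g :: "'a \<Rightarrow> nat"
    using sum.union_disjoint[OF finU fW VUW(2), of g] sum.cong[OF VUW(1) refl, of g] by simp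
  have split: "f V V = f U U + f U W + f W U + f W W"
    unfolding f_def sumV by (simp add: sum.distrib)
  have WU: "f W U = f U W" unfolding f_def by (subst sum.swap) (simp add: cod_sym)
  have UU: "f U U \<le> ?L * ?L"
  proof -
    have "f U U \<le> (\<Sum>x\<in>U. \<Sum>y\<in>U. 1)" unfolding f_def using cod_U by (intro sum_mono) auto
    then show ?thesis by simp
  qed
  have UW: "f U W \<le> ?m * (?L * ?L + 128 * ?L)"
  proof -
    have "f U W = (\<Sum>y\<in>W. \<Sum>x\<in>U. cod x y)" unfolding f_def by (rule sum.swap)
    also have "\<dots> = (\<Sum>X\<in>P. \<Sum>y\<in>X. \<Sum>x\<in>U. cod x y)" by (rule sumW)
    also have "\<dots> \<le> (\<Sum>X\<in>P. ?L * ?L + 128 * ?L)" using sum_cod_tile by (intro sum_mono)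
    finally show ?thesis by simp
  qed
  have "f W W = (\<Sum>X\<in>P. \<Sum>x\<in>X. \<Sum>Y\<in>P. \<Sum>y\<in>Y. cod x y)" unfolding f_def sumW ..
  also have "\<dots> = (\<Sum>X\<in>P. \<Sum>Y\<in>P. f X Y)" unfolding f_def by (intro sum.cong refl sum.swap)
  also have "\<dots> = (\<Sum>X\<in>P. f X X + (\<Sum>Y\<in>P - {X}. f X Y))"
    using finP by (intro sum.cong refl) (simp add: sum.remove)
  also have "\<dots> \<le> (\<Sum>X\<in>P. 16 * ?L + (\<Sum>Y\<in>P - {X}. ?L * (6 + of_bool (crossed X Y) +
      2 * of_bool (arc heavy X Y) + 2 * of_bool (arc heavy Y X)) + 512))"
  proof (intro sum_mono add_mono)
    fix X assume X: "X \<in> P"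
    have "f X X \<le> (\<Sum>x\<in>X. \<Sum>y\<in>X. ?L)" unfolding f_def using cod_le by (intro sum_mono) auto
    then show "f X X \<le> 16 * ?L" using P_card[OF X] by simp
    fix Y assume "Y \<in> P - {X}"
    then show "f X Y \<le> ?L * (6 + of_bool (crossed X Y) +
      2 * of_bool (arc heavy X Y) + 2 * of_bool (arc heavy Y X)) + 512"
      unfolding f_def using X by (intro sum_cod_two_tiles) auto
  qed
  also have "\<dots> = 16 * ?L * ?m + (\<Sum>X\<in>P. \<Sum>Y\<in>P - {X}. 6 * ?L + 512)
    + ?L * (\<Sum>X\<in>P. \<Sum>Y\<in>P - {X}. of_bool (crossed X Y))
    + 2 * ?L * (\<Sum>X\<in>P. \<Sum>Y\<in>P - {X}. of_bool (arc heavy X Y))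
    + 2 * ?L * (\<Sum>X\<in>P. \<Sum>Y\<in>P - {X}. of_bool (arc heavy Y X))"
  proof -
    have e: "?L * (6 + c + 2 * a + 2 * b) + 512 = (6 * ?L + 512) + ?L * c + 2 * ?L * a + 2 * ?L * b" for a b c :: nat
      by (simp add: algebra_simps)
    have "(\<Sum>X\<in>P. 16 * ?L) = 16 * ?L * ?m" by simp
    then show ?thesis by (simp only: e sum.distrib sum_distrib_left)
  qed
  also have "\<dots> \<le> 16 * ?L * ?m + ?m * (?m * (6 * ?L + 512)) + ?L * crossings + 2 * ?L * ?m + 2 * ?L * ?m"
  proof (intro add_mono mult_left_mono)
    have "(\<Sum>X\<in>P. \<Sum>Y\<in>P - {X}. 6 * ?L + 512) \<le> (\<Sum>X\<in>P. ?m * (6 * ?L + 512))"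
    proof (rule sum_mono)
      fix X
      have "card (P - {X}) \<le> ?m" using finP by (intro card_mono) auto
      then have "card (P - {X}) * (6 * ?L + 512) \<le> ?m * (6 * ?L + 512)" by (rule mult_right_mono) simp
      then show "(\<Sum>Y\<in>P - {X}. 6 * ?L + 512) \<le> ?m * (6 * ?L + 512)" by simp
    qed
    then show "(\<Sum>X\<in>P. \<Sum>Y\<in>P - {X}. 6 * ?L + 512) \<le> ?m * (?m * (6 * ?L + 512))" by simp
    have "{(X, Y). X \<in> P \<and> Y \<in> P \<and> X \<noteq> Y \<and> crossed X Y} = Sigma P (\<lambda>X. {Y\<in>P - {X}. crossed X Y})" by auto
    then have "crossings = (\<Sum>X\<in>P. card {Y\<in>P - {X}. crossed X Y})"
      unfolding crossings_def using finP by simp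
    then show "(\<Sum>X\<in>P. \<Sum>Y\<in>P - {X}. of_bool (crossed X Y)) \<le> crossings"
      using finP by (simp add: of_bool_def sum.If_cases Int_def)
    show "(\<Sum>X\<in>P. \<Sum>Y\<in>P - {X}. of_bool (arc heavy Y X)) \<le> ?m" by (rule sum_arcs)
    have "(\<Sum>X\<in>P. \<Sum>Y\<in>P - {X}. of_bool (arc heavy X Y)) = (\<Sum>Y\<in>P. \<Sum>X\<in>P - {Y}. of_bool (arc heavy X Y) :: nat)"
    proof -
      define g where "g X Y = (of_bool (arc heavy X Y) :: nat)" for X Y
      have "(\<Sum>X\<in>P. \<Sum>Y\<in>P - {X}. g X Y) = (\<Sum>X\<in>P. \<Sum>Y\<in>{Y\<in>P. X \<noteq> Y}. g X Y)"
        by (intro sum.cong refl) auto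
      also have "\<dots> = (\<Sum>Y\<in>P. \<Sum>X\<in>{X\<in>P. X \<noteq> Y}. g X Y)" by (rule sum.swap_restrict[OF finP finP])
      also have "\<dots> = (\<Sum>Y\<in>P. \<Sum>X\<in>P - {Y}. g X Y)" by (intro sum.cong refl) auto
      finally show ?thesis unfolding g_def .
    qed
    then show "(\<Sum>X\<in>P. \<Sum>Y\<in>P - {X}. of_bool (arc heavy X Y)) \<le> ?m" using sum_arcs by simp
  qed auto
  finally have WW: "f W W \<le> 16 * ?L * ?m + ?m * (?m * (6 * ?L + 512)) + ?L * crossings + 2 * ?L * ?m + 2 * ?L * ?m" .
  have "(\<Sum>u\<in>U. pdeg u) = f V V" unfolding f_def by (rule sum_pdeg_U)
  then show ?thesis using split WU UU UW WW by (simp add: algebra_simps)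
qed

lemma crossings_le: "crossings \<le> card P * card P"
proof -
  have "crossings \<le> card (P \<times> P)" unfolding crossings_def using finP by (intro card_mono) auto
  then show ?thesis by (simp add: card_cartesian_product)
qed

lemma card_V: "card V = 4 * card P + card U"
proof -
  have "card (\<Union>P) = (\<Sum>X\<in>P. card X)" using disjP P_fin by (intro card_Union_disjoint) (auto simp: disjoint_def pairwise_def disjnt_def)
  also have "\<dots> = 4 * card P" using P_card by simp
  finally have "card (\<Union>P) = 4 * card P" .
  moreover have "V = \<Union>P \<union> U" "\<Union>P \<inter> U = {}" using P_sub by (auto simp: U_def)
  moreover have "finite (\<Union>P)" using finP P_fin by auto
  ultimately show ?thesis using card_Un_disjoint[of "\<Union>P" U] finU by simp
qed

text \<open>An average uncovered vertex has about 7/16 n^2 link pairs, where n = 4m + |U|. The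
  available 6 m^2 + crossings + 2 m |U| reach this only if nearly all ordered pairs of tiles are
  crossed and \<open>U\<close> is small.\<close>

lemma degree_consequence:
  assumes deg: "\<And>v. v \<in> V \<Longrightarrow> (7 / 16 - \<gamma>) * real (card V) * (real (card V) - 1) \<le> real (pdeg v)"
    and \<gamma>: "0 < \<gamma>" "\<gamma> \<le> 7 / 16" and \<alpha>: "0 < \<alpha>" "\<alpha> * real (card V) \<le> real (card U)"
    and n: "(71 + 32 / \<alpha>) / \<gamma> + 100 \<le> real (card V)"
  shows "(real (card P))\<^sup>2 - real crossings \<le> 2 * \<gamma> * (real (card V))\<^sup>2" "real (card U) \<le> 6 * \<gamma> * real (card V)"
proof -
  define L m n N where "L = real (card U)" and "m = real (card P)" and "n = real (card V)" and "N = real crossings"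
  have nn: "n = 4 * m + L" unfolding n_def m_def L_def using card_V by simp
  have pos: "0 \<le> m" "0 \<le> L" "0 \<le> N" unfolding m_def L_def N_def by simp_all
  have "0 \<le> (71 + 32 / \<alpha>) / \<gamma>" using \<gamma> \<alpha> by simp
  then have n100: "100 \<le> n" using n unfolding n_def by linarith
  have L: "0 < L" "\<alpha> * n \<le> L" using \<alpha> n100 mult_pos_pos[of \<alpha> n] unfolding L_def n_def by linarith+
  have "L * ((7 / 16 - \<gamma>) * n * (n - 1)) = (\<Sum>u\<in>U. (7 / 16 - \<gamma>) * n * (n - 1))" unfolding L_def by simp
  also have "\<dots> \<le> (\<Sum>u\<in>U. real (pdeg u))" using deg U_sub unfolding n_def by (intro sum_mono) auto
  also have "\<dots> = real (\<Sum>u\<in>U. pdeg u)" by simp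
  also have "\<dots> \<le> real (card U * card U + 2 * (card P * (card U * card U + 128 * card U)) + 16 * card U * card P
    + card U * (6 * card P * card P + crossings + 4 * card P) + 512 * card P * card P)"
    by (rule of_nat_mono[OF sum_pdeg_le])
  also have "\<dots> = L * (L + 2 * m * (L + 128) + 16 * m + (6 * m\<^sup>2 + N + 4 * m) + 512 * m\<^sup>2 / L)"
    using L unfolding L_def m_def N_def by (simp add: field_simps power2_eq_square)
  finally have 1: "(7 / 16 - \<gamma>) * n * (n - 1) \<le> L + 2 * m * (L + 128) + 16 * m + (6 * m\<^sup>2 + N + 4 * m) + 512 * m\<^sup>2 / L"
    using L(1) by simp
  \<comment> \<open>The pairs that are not heavy: only |U| \<ge> \<alpha> n makes their share linear
    in n after the division by |U|.\<close>
  have "512 * m\<^sup>2 / L \<le> 32 / \<alpha> * n"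
  proof -
    have "(4 * m)\<^sup>2 \<le> n\<^sup>2" using nn pos by (intro power_mono) auto
    then have "512 * m\<^sup>2 \<le> 32 * n * n" by (simp add: power2_eq_square)
    also have "\<dots> = 32 / \<alpha> * n * (\<alpha> * n)" using \<alpha> by simp
    also have "\<dots> \<le> 32 / \<alpha> * n * L" using L \<alpha> n100 by (intro mult_left_mono) auto
    finally show ?thesis using L(1) by (simp add: field_simps)
  qed
  then have "(7 / 16 - \<gamma>) * n * (n - 1) \<le> 2 * m * L + 6 * m\<^sup>2 + N + (L + 276 * m) + 32 / \<alpha> * n"
    using 1 by (simp add: algebra_simps)
  \<comment> \<open>Here 276 = 2 * 128 + 16 + 4, and n = 4m + |U|.\<close>
  also have "L + 276 * m \<le> 69 * n" using nn pos by simp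
  finally have 2: "(7 / 16 - \<gamma>) * n * (n - 1) \<le> 2 * m * L + 6 * m\<^sup>2 + N + (69 + 32 / \<alpha>) * n"
    by (simp add: algebra_simps)
  define e where "e = (7 / 16 - \<gamma>) * n * (n - 1)"
  have "e = (7 / 16 - \<gamma>) * (n * n) - (7 / 16 - \<gamma>) * n"
    unfolding e_def by (simp add: right_diff_distrib)
  then have "e = 7 / 16 * n\<^sup>2 - \<gamma> * n\<^sup>2 - (7 / 16 - \<gamma>) * n"
    by (simp only: left_diff_distrib power2_eq_square)
  moreover have "(7 / 16 - \<gamma>) * n \<le> 2 * n" using \<gamma> n100 by (intro mult_right_mono) auto
  moreover have "(71 + 32 / \<alpha>) * n = (69 + 32 / \<alpha>) * n + 2 * n" by (simp add: algebra_simps)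
  ultimately have 3: "7 / 16 * n\<^sup>2 - \<gamma> * n\<^sup>2 \<le> 2 * m * L + 6 * m\<^sup>2 + N + (71 + 32 / \<alpha>) * n"
    using 2[folded e_def] by linarith
  have "(71 + 32 / \<alpha>) / \<gamma> \<le> n" using n unfolding n_def by linarith
  then have "71 + 32 / \<alpha> \<le> \<gamma> * n" using \<gamma> by (simp add: field_simps)
  then have "(71 + 32 / \<alpha>) * n \<le> \<gamma> * n * n" using n100 by (intro mult_right_mono) auto
  then have 4: "(7 / 16) * n\<^sup>2 \<le> 2 * m * L + 6 * m\<^sup>2 + N + 2 * \<gamma> * n\<^sup>2" using 3 by (simp add: power2_eq_square)
  have "(7 / 16) * n\<^sup>2 = 7 * m\<^sup>2 + 7 / 2 * m * L + 7 / 16 * L\<^sup>2" unfolding nn by (simp add: power2_eq_square algebra_simps)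
  \<comment> \<open>Comparing 7 m^2 with 6 m^2 leaves m^2 - N. Since N \<le> m^2, no summand on the
    left is negative, so both claims follow from this one inequality.\<close>
  then have 5: "m\<^sup>2 - N + 3 / 2 * m * L + 7 / 16 * L\<^sup>2 \<le> 2 * \<gamma> * n\<^sup>2" using 4 by linarith
  have "0 \<le> m * L" "0 \<le> L\<^sup>2" using pos by auto
  then have "m\<^sup>2 - N \<le> 2 * \<gamma> * n\<^sup>2" using 5 by linarith
  then show "(real (card P))\<^sup>2 - real crossings \<le> 2 * \<gamma> * (real (card V))\<^sup>2"
    unfolding m_def N_def n_def .
  have "N \<le> m\<^sup>2" unfolding N_def m_def power2_eq_square using crossings_le by (simp flip: of_nat_mult)
  moreover have "3 / 2 * m * L + 7 / 16 * L\<^sup>2 \<ge> 3 / 8 * n * L"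
    unfolding nn using \<open>0 \<le> L\<^sup>2\<close> by (simp add: power2_eq_square algebra_simps)
  ultimately have "3 / 8 * n * L \<le> 2 * \<gamma> * n\<^sup>2" using 5 by linarith
  then have "n * (3 / 8 * L) \<le> n * (2 * \<gamma> * n)" by (simp add: power2_eq_square algebra_simps)
  then have "3 / 8 * L \<le> 2 * \<gamma> * n" using n100 by simp
  moreover have "0 \<le> \<gamma> * n" using \<gamma> n100 by simp
  ultimately show "real (card U) \<le> 6 * \<gamma> * real (card V)" unfolding L_def n_def by linarith
qed

section \<open>Centres of tiles and the enlargement of the family\<close>

definition partners :: "'a set \<Rightarrow> 'a set set" where
  "partners X = {Y\<in>P. X \<noteq> Y \<and> crossed X Y}"

text \<open>By \<open>cross_unique\<close> the choice is forced as soon as the tile has a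
  partner.\<close>

definition centre :: "'a set \<Rightarrow> 'a" where
  "centre X = (SOME c. \<exists>Y\<in>partners X. \<exists>d. cross heavy X Y c d)"

lemma centre_eq:
  assumes "X \<in> P" "Y \<in> partners X" "cross heavy X Y c d"
  shows "centre X = c"
proof -
  have "\<exists>Y\<in>partners X. \<exists>d. cross heavy X Y (centre X) d"
    unfolding centre_def using assms(2,3) by (intro someI_ex[where P = "\<lambda>c. \<exists>Y\<in>partners X. \<exists>d. cross heavy X Y c d"]) blast
  then obtain Z e where "Z \<in> partners X" "cross heavy X Z (centre X) e" by blast
  then show ?thesis using cross_unique[of X Z Y "centre X" e c d] assms unfolding partners_def by auto
qed

text \<open>Crossing is symmetric, so both centres of a cross are the canonical ones: a tile uses
  the same centre towards all its partners.\<close>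

lemma partner_cross:
  assumes "X \<in> P" "Y \<in> partners X"
  shows "cross heavy X Y (centre X) (centre Y)"
proof -
  obtain c d where cd: "cross heavy X Y c d" using assms(2) unfolding partners_def by blast
  have Y: "Y \<in> P" "X \<in> partners Y"
    using assms cross_sym[OF cd] unfolding partners_def by auto
  have "centre X = c" using centre_eq[OF assms cd] .
  moreover have "centre Y = d" using centre_eq[OF Y cross_sym[OF cd]] .
  ultimately show ?thesis using cd by simp
qed

text \<open>Each tile met by \<open>Z\<close> is rerouted through two further tiles so that three heavy pairs avoiding
  \<open>Z\<close> replace three tiles.\<close>

lemma reroute:
  assumes G: "G \<subseteq> P" "\<And>X. X \<in> G \<Longrightarrow> 20 \<le> card (partners X \<inter> G)"
    and I: "I \<subseteq> G" "card I \<le> 4" and Z: "\<And>X. X \<in> P \<Longrightarrow> X \<inter> Z \<noteq> {} \<Longrightarrow> X \<in> I \<and> centre X \<notin> Z"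
    and J: "J \<subseteq> I"
  shows "\<exists>P0 ps. P0 \<subseteq> P \<and> P0 \<inter> I = J \<and> card P0 = 3 * card J \<and> matching ps \<and> verts ps \<subseteq> \<Union>P0 \<and>
    verts ps \<inter> Z = {} \<and> length ps = 3 * card J"
proof -
  have fI: "finite I" using I G finP by (meson finite_subset)
  have "finite J" using J fI finite_subset by auto
  then show ?thesis using J
  proof (induction J rule: finite_induct)
    case empty
    show ?case by (intro exI[of _ "{}"] exI[of _ "[]"]) (auto simp: matching_def verts_def)
  next
    case (insert X J)
    then obtain P0 ps where IH: "P0 \<subseteq> P" "P0 \<inter> I = J" "card P0 = 3 * card J" "matching ps" "verts ps \<subseteq> \<Union>P0"
      "verts ps \<inter> Z = {}" "length ps = 3 * card J" by blast
    have fP0: "finite P0" using IH finP finite_subset by auto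
    have "card (insert X J) \<le> 4" using insert.prems I fI by (meson card_mono order_trans)
    then have cJ: "card J \<le> 3" using insert by simp
    have XI: "X \<in> I" "X \<in> G" "X \<in> P" "X \<notin> P0" using insert I G IH by auto
    \<comment> \<open>At most three tiles of \<open>I\<close> were rerouted before, using nine
      tiles, and \<open>I\<close> has four. The tile \<open>T\<close> must also avoid
      \<open>Y\<close>, which makes at most 14 forbidden tiles against 20 partners in
      \<open>G\<close>.\<close>
    have cF: "card (P0 \<union> I) \<le> 13" using card_Un_le[of P0 I] IH(3) cJ I(2) by linarith
    have pick: "\<exists>Y. Y \<in> partners W \<inter> G \<and> Y \<notin> F" if "W \<in> G" "finite F" "card F \<le> 14" for W F
    proof -
      have "card (partners W \<inter> G) - card F \<le> card (partners W \<inter> G - F)" using that by (intro diff_card_le_card_Diff) auto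
      then have "card (partners W \<inter> G - F) \<noteq> 0" using that G(2)[OF that(1)] by linarith
      then have "partners W \<inter> G - F \<noteq> {}" by (metis card.empty)
      then show ?thesis by auto
    qed
    obtain Y where Y: "Y \<in> partners X" "Y \<in> G" "Y \<notin> P0" "Y \<notin> I"
      using pick[OF XI(2), of "P0 \<union> I"] fP0 fI cF by auto
    have "card (insert Y (P0 \<union> I)) \<le> 14" using cF fP0 fI by (simp add: card_insert_if)
    then obtain T where T: "T \<in> partners Y" "T \<in> G" "T \<notin> P0" "T \<notin> I" "T \<noteq> Y"
      using pick[OF Y(2), of "insert Y (P0 \<union> I)"] fP0 fI by auto
    have PYT: "Y \<in> P" "T \<in> P" using Y T G by auto
    have ne: "X \<noteq> Y" "X \<noteq> T" "Y \<noteq> T" using XI Y T by auto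
    note c1 = partner_cross[OF XI(3) Y(1), unfolded cross_def]
    note c2 = partner_cross[OF PYT(1) T(1), unfolded cross_def]
    have "card {centre Y} \<le> 3" by simp
    then obtain y where y: "y \<in> Y" "y \<noteq> centre Y" using P_pick[OF PYT(1), of "{centre Y}"] by auto
    have "card {centre Y, y} \<le> 3" by (simp add: card_insert_if)
    then obtain y' where y': "y' \<in> Y" "y' \<noteq> centre Y" "y' \<noteq> y" using P_pick[OF PYT(1), of "{centre Y, y}"] by auto
    obtain t where t: "t \<in> T" "t \<noteq> centre T" using P_pick[OF PYT(2), of "{centre T}"] by auto
    have h: "heavy (centre X) y" "heavy (centre Y) t" "heavy (centre T) y'"
      using c1 c2 y y' t heavy_sym by blast+
    have d: "X \<inter> Y = {}" "X \<inter> T = {}" "Y \<inter> T = {}" using P_disj XI PYT ne by auto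
    \<comment> \<open>Three heavy pairs for three tiles, of which \<open>X\<close> gives up only its
      centre; its other vertices remain free for \<open>Z\<close>. The third pair exists because
      \<open>Y\<close> has two non-central vertices to serve the centres of both \<open>X\<close>
      and \<open>T\<close>.\<close>
    define qs where "qs = [(centre X, y), (centre Y, t), (centre T, y')]"
    have vq: "verts qs = {centre X, y, centre Y, t, centre T, y'}" unfolding qs_def verts_def by auto
    have mem: "centre X \<in> X" "centre Y \<in> Y" "centre T \<in> T" using c1 c2 by auto
    have "matching qs" unfolding matching_def qs_def using h mem y y' t d by auto
    moreover have "verts ps \<inter> verts qs = {}"
    proof -
      have "W \<inter> A = {}" if "W \<in> P0" "A \<in> {X, Y, T}" for W A
        using that XI Y T PYT IH(1) P_disj[of W A] by auto
      then have "\<Union>P0 \<inter> (X \<union> Y \<union> T) = {}" by auto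
      moreover have "verts qs \<subseteq> X \<union> Y \<union> T" unfolding vq using mem y y' t by auto
      ultimately show ?thesis using IH(5) by blast
    qed
    ultimately have m: "matching (qs @ ps)"
      using IH(4) unfolding matching_def verts_def by auto
    have "Y \<inter> Z = {}" "T \<inter> Z = {}" using Z PYT Y T by blast+
    moreover have "centre X \<notin> Z" using Z[OF XI(3)] mem(1) by auto
    ultimately have qZ: "verts qs \<inter> Z = {}" unfolding vq using mem y y' t by auto
    have v: "verts (qs @ ps) = verts qs \<union> verts ps" unfolding verts_def by auto
    have "verts qs \<subseteq> \<Union>({X, Y, T} \<union> P0)" unfolding vq using mem y y' t by auto
    moreover have "card ({X, Y, T} \<union> P0) = 3 + 3 * card J"
      using XI Y T ne fP0 IH(3) by simp
    moreover have "({X, Y, T} \<union> P0) \<inter> I = insert X J" using IH(2) XI Y T by auto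
    moreover have "{X, Y, T} \<union> P0 \<subseteq> P" using XI PYT IH by auto
    moreover have "length (qs @ ps) = 3 + 3 * card J" using IH(7) by (simp add: qs_def)
    moreover have "card (insert X J) = Suc (card J)" using insert by simp
    ultimately show ?case using m qZ IH(5,6) v
      by (intro exI[of _ "{X, Y, T} \<union> P0"] exI[of _ "qs @ ps"]) auto
  qed
qed

text \<open>A copy avoiding the centres meets at most four tiles. Rerouting these gives 3 |I| \<le>
  12 disjoint heavy pairs within 3 |I| tiles and off \<open>Z\<close>, so the copy \<open>Z\<close>
  is one tile more than before.\<close>

lemma no_quad_avoiding_centres:
  assumes G: "G \<subseteq> P" "\<And>X. X \<in> G \<Longrightarrow> 20 \<le> card (partners X \<inter> G)"
    and Z: "quad E Z" "Z \<subseteq> U \<union> (\<Union>X\<in>G. X - {centre X})"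
  shows False
proof -
  have cZ: "card Z = 4" "finite Z" using Z quad_finite by (auto simp: quad_def)
  define I where "I = {X\<in>P. X \<inter> Z \<noteq> {}}"
  have IG: "X \<in> G \<and> centre X \<notin> Z" if X: "X \<in> P" "X \<inter> Z \<noteq> {}" for X
  proof -
    obtain z where z: "z \<in> X" "z \<in> Z" using X by auto
    then obtain Y where "Y \<in> G" "z \<in> Y" using Z(2) P_U[OF X(1)] by auto
    then have "X = Y" using P_disj[of X Y] X z G by auto
    moreover have "centre X \<notin> Z" if cX: "centre X \<in> X"
    proof
      assume "centre X \<in> Z"
      then obtain W where W: "W \<in> G" "centre X \<in> W - {centre W}" using Z(2) P_U[OF X(1)] cX by blast
      then have "W = X" using P_disj[of W X] X cX G by auto
      then show False using W by auto
    qed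
    moreover have "centre X \<in> X"
    proof -
      have "partners X \<inter> G \<noteq> {}" using G(2)[of X] \<open>X = Y\<close> \<open>Y \<in> G\<close> by force
      then obtain T where "T \<in> partners X" by auto
      then show ?thesis using partner_cross[OF X(1)] by (auto simp: cross_def)
    qed
    ultimately show ?thesis using \<open>Y \<in> G\<close> by auto
  qed
  have "card I \<le> card Z"
  proof (rule card_inj_on_le)
    let ?f = "\<lambda>X. SOME z. z \<in> X \<inter> Z"
    have f: "?f X \<in> X \<inter> Z" if "X \<in> I" for X
    proof -
      have "\<exists>z. z \<in> X \<inter> Z" using that unfolding I_def by auto
      then show ?thesis by (rule someI_ex)
    qed
    show "?f ` I \<subseteq> Z" using f by auto
    show "inj_on ?f I"
    proof (rule inj_onI, rule ccontr)
      fix X Y assume XY: "X \<in> I" "Y \<in> I" "?f X = ?f Y" "X \<noteq> Y"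
      then have "?f X \<in> X \<inter> Y" using f[OF XY(1)] f[OF XY(2)] by simp
      moreover have "X \<inter> Y = {}" using XY(1,2,4) P_disj unfolding I_def by auto
      ultimately show False by simp
    qed
  qed (rule cZ(2))
  then have I4: "card I \<le> 4" using cZ by simp
  have IsG: "I \<subseteq> G" using IG unfolding I_def by auto
  have "\<exists>P0 ps. P0 \<subseteq> P \<and> P0 \<inter> I = I \<and> card P0 = 3 * card I \<and> matching ps \<and> verts ps \<subseteq> \<Union>P0 \<and>
    verts ps \<inter> Z = {} \<and> length ps = 3 * card I"
  proof (rule reroute[OF G(1) _ IsG I4])
    show "20 \<le> card (partners X \<inter> G)" if "X \<in> G" for X using G(2)[OF that] .
    show "X \<in> I \<and> centre X \<notin> Z" if "X \<in> P" "X \<inter> Z \<noteq> {}" for X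
      using IG[OF that] that unfolding I_def by simp
  qed simp
  then obtain P0 ps where p: "P0 \<subseteq> P" "P0 \<inter> I = I" "card P0 = 3 * card I" "matching ps" "verts ps \<subseteq> \<Union>P0"
    "verts ps \<inter> Z = {}" "length ps = 3 * card I" by (elim exE conjE)
  have "Z \<subseteq> \<Union>P0 \<union> U"
  proof
    fix z assume z: "z \<in> Z"
    show "z \<in> \<Union>P0 \<union> U"
    proof (cases "z \<in> U")
      case False
      then obtain X where "X \<in> P" "z \<in> X" using z Z(2) G(1) by blast
      then have "X \<in> I" using z unfolding I_def by auto
      then show ?thesis using p(2) \<open>z \<in> X\<close> by auto
    qed simp
  qed
  then have "length ps < card P0" using p Z(1) I4 by (intro matching_quad_le) auto
  then show False using p by simp
qed

lemma crossings_sum: "crossings = (\<Sum>X\<in>P. card (partners X))"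
proof -
  have "{(X, Y). X \<in> P \<and> Y \<in> P \<and> X \<noteq> Y \<and> crossed X Y} = Sigma P partners" unfolding partners_def by blast
  then show ?thesis unfolding crossings_def using finP by (simp add: partners_def)
qed

text \<open>A large \<open>U\<close> is assumed only to make \<open>degree_consequence\<close>
  available. The contradiction is that a set of almost 3n/4 vertices, found with the help of the
  centres, would span no copy and so make the hypergraph extremal.\<close>

lemma few_uncovered:
  assumes deg: "\<And>v. v \<in> V \<Longrightarrow> (7 / 16 - \<gamma>) * real (card V) * (real (card V) - 1) \<le> real (pdeg v)"
    and \<gamma>: "0 < \<gamma>" "\<gamma> \<le> 1 / 2048" "256 * \<gamma> \<le> \<epsilon>" and \<alpha>: "0 < \<alpha>"
    and n: "(71 + 32 / \<alpha>) / \<gamma> + 1000 \<le> real (card V)"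
    and nonext: "\<not> extremal \<epsilon> V E"
  shows "real (card U) \<le> \<alpha> * real (card V)"
proof (rule ccontr)
  assume "\<not> ?thesis"
  then have U: "\<alpha> * real (card V) \<le> real (card U)" by simp
  define n m where "n = real (card V)" and "m = real (card P)"
  have d: "m\<^sup>2 - real crossings \<le> 2 * \<gamma> * n\<^sup>2" "real (card U) \<le> 6 * \<gamma> * n"
    using degree_consequence[OF deg \<gamma>(1) _ \<alpha> U] \<gamma> n unfolding n_def m_def by auto
  have nn: "n = 4 * m + real (card U)" unfolding n_def m_def using card_V by simp
  have "0 \<le> (71 + 32 / \<alpha>) / \<gamma>" using \<gamma> \<alpha> by simp
  then have n1000: "1000 \<le> n" using n unfolding n_def by linarith
  have "6 * \<gamma> * n \<le> 1 / 2 * n" using \<gamma> n1000 by (intro mult_right_mono) auto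
  then have nm: "n \<le> 8 * m" using d(2) nn by linarith
  then have m: "125 \<le> m" using n1000 by linarith
  have "n\<^sup>2 \<le> (8 * m)\<^sup>2" using nm n1000 by (intro power_mono) auto
  then have "2 * \<gamma> * n\<^sup>2 \<le> 2 * \<gamma> * (8 * m)\<^sup>2" using \<gamma> by (intro mult_left_mono) auto
  then have cr: "m\<^sup>2 - real crossings \<le> 128 * \<gamma> * m\<^sup>2" using d(1) by (simp add: power2_eq_square)
  \<comment> \<open>A tile outside \<open>G\<close> lacks at least half of its possible crossings,
    so there are at most 256 \<gamma> m such tiles. With \<gamma> \<le> 1/2048 this is at most m/8,
    and tiles in \<open>G\<close> keep at least m/2 - m/8 \<ge> 20 partners within
    \<open>G\<close>.\<close>
  define G where "G = {X\<in>P. m / 2 \<le> real (card (partners X))}"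
  have GP: "G \<subseteq> P" "finite G" using finP by (auto simp: G_def)
  have part: "card (partners X) \<le> card P" for X using finP by (intro card_mono) (auto simp: partners_def)
  define b where "b = real (card (P - G))"
  have cG: "m = real (card G) + b"
    using GP finP card_mono[OF finP GP(1)] unfolding m_def b_def by (simp add: card_Diff_subset of_nat_diff)
  have "real crossings = (\<Sum>X\<in>P. real (card (partners X)))" unfolding crossings_sum by simp
  also have "\<dots> = (\<Sum>X\<in>G. real (card (partners X))) + (\<Sum>X\<in>P - G. real (card (partners X)))"
    using GP finP by (simp add: sum.subset_diff)
  also have "\<dots> \<le> (\<Sum>X\<in>G. m) + (\<Sum>X\<in>P - G. m / 2)"
    using part by (intro add_mono sum_mono) (auto simp: G_def m_def)
  also have "\<dots> = real (card G) * m + b * (m / 2)" by (simp add: b_def)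
  also have "\<dots> = m\<^sup>2 - b * m / 2" using cG by (simp add: power2_eq_square algebra_simps)
  finally have "m * (b / 2) \<le> m * (128 * \<gamma> * m)" using cr by (simp add: power2_eq_square algebra_simps)
  then have b: "b \<le> 256 * \<gamma> * m" using m by simp
  have "256 * \<gamma> * m \<le> 1 / 8 * m" using \<gamma> m by (intro mult_right_mono) auto
  then have b8: "b \<le> m / 8" using b by linarith
  have "256 * \<gamma> * m \<le> \<epsilon> * m" using \<gamma> m by (intro mult_right_mono) auto
  then have be: "b \<le> \<epsilon> * m" using b by linarith
  have many: "20 \<le> card (partners X \<inter> G)" if X: "X \<in> G" for X
  proof -
    have fp: "finite (partners X)" using finP by (auto simp: partners_def)
    have "partners X \<subseteq> (partners X \<inter> G) \<union> (P - G)" by (auto simp: partners_def)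
    then have "card (partners X) \<le> card ((partners X \<inter> G) \<union> (P - G))" using fp finP by (intro card_mono) auto
    also have "\<dots> \<le> card (partners X \<inter> G) + card (P - G)" by (rule card_Un_le)
    finally have "real (card (partners X)) \<le> real (card (partners X \<inter> G)) + b" unfolding b_def by linarith
    moreover have "m / 2 \<le> real (card (partners X))" using X by (simp add: G_def)
    ultimately show ?thesis using b8 m by linarith
  qed
  have cen: "centre X \<in> X" if X: "X \<in> G" for X
  proof -
    have "partners X \<inter> G \<noteq> {}" using many[OF X] by force
    then obtain T where "T \<in> partners X" by auto
    then show ?thesis using partner_cross[of X T] X GP by (auto simp: cross_def)
  qed
  \<comment> \<open>Adding \<open>U\<close> keeps the size above (1 - \<epsilon>) 3n/4: only 3b
    vertices are lost from the non-central ones, with b \<le> \<epsilon> m.\<close>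
  define S where "S = U \<union> (\<Union>X\<in>G. X - {centre X})"
  have cS: "real (card S) = real (card U) + 3 * real (card G)"
  proof -
    have "card (\<Union>X\<in>G. X - {centre X}) = (\<Sum>X\<in>G. card (X - {centre X}))"
    proof (rule card_UN_disjoint[OF GP(2)])
      show "\<forall>X\<in>G. finite (X - {centre X})" using P_fin GP by auto
      show "\<forall>X\<in>G. \<forall>Y\<in>G. X \<noteq> Y \<longrightarrow> (X - {centre X}) \<inter> (Y - {centre Y}) = {}" using P_disj GP by blast
    qed
    also have "\<dots> = (\<Sum>X\<in>G. 3)"
    proof (rule sum.cong[OF refl])
      fix X assume "X \<in> G"
      then show "card (X - {centre X}) = 3" using cen P_card GP by (simp add: subset_iff)
    qed
    finally have "card (\<Union>X\<in>G. X - {centre X}) = 3 * card G" by simp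
    moreover have "U \<inter> (\<Union>X\<in>G. X - {centre X}) = {}" using P_U GP by blast
    moreover have "finite (\<Union>X\<in>G. X - {centre X})" using P_fin GP by auto
    ultimately show ?thesis unfolding S_def using finU by (simp add: card_Un_disjoint)
  qed
  have "0 < \<epsilon>" using \<gamma> by linarith
  then have "(1 - \<epsilon>) * (3 * n / 4) \<le> real (card S)"
  proof -
    have "0 \<le> \<epsilon> * real (card U)" using \<open>0 < \<epsilon>\<close> by simp
    moreover have "(1 - \<epsilon>) * (3 * n / 4) = 3 * m - 3 * (\<epsilon> * m) + 3 / 4 * real (card U) - 3 / 4 * (\<epsilon> * real (card U))"
      unfolding nn by (simp add: field_simps)
    ultimately show ?thesis using cS cG be by simp
  qed
  moreover have SV: "S \<subseteq> V" using U_sub P_sub GP unfolding S_def by blast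
  ultimately have "\<not> C43_free S (induced_edges E S)"
    using nonext unfolding extremal_def n_def by blast
  then obtain W F where W: "C43_copy_in W F S (induced_edges E S)" unfolding C43_free_def by blast
  then have "quad E W" using copy_quad quad_induced by blast
  moreover have "W \<subseteq> S" using W unfolding C43_copy_in_def by auto
  ultimately show False using no_quad_avoiding_centres[OF GP(1) many] unfolding S_def by blast
qed

end

lemma (in tgraph) almost_tiling:
  assumes deg: "\<And>v. v \<in> V \<Longrightarrow> (7 / 16 - \<gamma>) * real (card V) * (real (card V) - 1) \<le> real (pdeg v)"
    and \<gamma>: "0 < \<gamma>" "\<gamma> \<le> 1 / 2048" "256 * \<gamma> \<le> \<epsilon>" and \<alpha>: "0 < \<alpha>"
    and n: "(71 + 32 / \<alpha>) / \<gamma> + 1000 \<le> real (card V)"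
    and nonext: "\<not> extremal \<epsilon> V E"
  shows "\<exists>S\<subseteq>V. tileable E S \<and> real (card (V - S)) \<le> \<alpha> * real (card V)"
proof -
  define TT where "TT = {P. finite P \<and> disjoint P \<and> (\<forall>X\<in>P. quad E X)}"
  have "TT \<subseteq> Pow (Pow V)" using quad_sub by (auto simp: TT_def)
  then have fT: "finite TT" using finV by (auto intro: finite_subset)
  have "{} \<in> TT" by (auto simp: TT_def)
  then have "TT \<noteq> {}" by auto
  then obtain P where P: "P \<in> TT" "card P = Max (card ` TT)"
    using Max_in[of "card ` TT"] fT by fastforce
  have max: "card P' \<le> card P" if "P' \<in> TT" for P' using P(2) that fT by simp
  interpret max_tiling V E P
    by unfold_locales (use P(1) max in \<open>auto simp: TT_def\<close>)
  have "tileable E (\<Union>X\<in>P. X)"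
    using finP quadP disjP by (intro tileable_UN) (auto simp: disjoint_family_on_def disjoint_def intro: quad_tileable)
  moreover have "\<Union>P \<subseteq> V" using P_sub by blast
  moreover have "real (card (V - \<Union>P)) \<le> \<alpha> * real (card V)"
    using few_uncovered[OF deg \<gamma> \<alpha> n nonext] unfolding U_def .
  ultimately show ?thesis by (intro exI[of _ "\<Union>P"]) simp
qed

subsection \<open>Perfect tilings\<close>

lemma pdeg_induced:
  assumes "three_graph V E" "A \<subseteq> V" "v \<in> V - A"
  shows "real (tgraph.pdeg V E v) \<le> real (tgraph.pdeg (V - A) (induced_edges E (V - A)) v) + 2 * real (card A) * real (card V)"
proof -
  interpret tgraph V E using assms(1) by unfold_locales
  interpret sub: tgraph "V - A" "induced_edges E (V - A)"
    using induced_tgraph[OF assms(1), of "V - A"] by unfold_locales auto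
  let ?L = "{(x, y) \<in> (V - A) \<times> (V - A). {v, x, y} \<in> induced_edges E (V - A)}"
  have fA: "finite A" using assms(2) finV finite_subset by auto
  have fL: "finite ?L" using finV by (intro finite_subset[of ?L "V \<times> V"]) auto
  have "{(x, y) \<in> V \<times> V. {v, x, y} \<in> E} \<subseteq> ?L \<union> (A \<times> V \<union> V \<times> A)"
    using assms(3) by (auto simp: induced_edges_def)
  then have "pdeg v \<le> card (?L \<union> (A \<times> V \<union> V \<times> A))"
    unfolding pdeg_def using finV fA fL by (intro card_mono) auto
  also have "\<dots> \<le> card ?L + (card (A \<times> V) + card (V \<times> A))"
    by (meson add_left_mono card_Un_le order_trans)
  also have "\<dots> = sub.pdeg v + 2 * card A * card V"
    unfolding sub.pdeg_def by (simp add: card_cartesian_product)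
  finally have "real (pdeg v) \<le> real (sub.pdeg v + 2 * card A * card V)" by (rule of_nat_mono)
  then show ?thesis by simp
qed

text \<open>One half of \<epsilon> pays for the deleted set \<open>A\<close>, the other half is the
  tolerance kept in \<open>V - A\<close>.\<close>

lemma extremal_induced:
  assumes "finite V" "A \<subseteq> V" "real (card A) \<le> \<epsilon> / 2 * real (card V)" "0 < \<epsilon>"
    and "extremal (\<epsilon> / 2) (V - A) (induced_edges E (V - A))"
  shows "extremal \<epsilon> V E"
proof -
  obtain S where S: "S \<subseteq> V - A" "(1 - \<epsilon> / 2) * (3 * real (card (V - A)) / 4) \<le> real (card S)"
    "C43_free S (induced_edges (induced_edges E (V - A)) S)"
    using assms(5) unfolding extremal_def by blast
  define n where "n = real (card V)"
  have "finite A" "card A \<le> card V" using assms(1,2) finite_subset card_mono by blast+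
  then have c: "real (card (V - A)) = n - real (card A)"
    using assms(2) by (simp add: card_Diff_subset of_nat_diff n_def)
  have "induced_edges (induced_edges E (V - A)) S = induced_edges E S"
    using S(1) by (auto simp: induced_edges_def)
  then have free: "C43_free S (induced_edges E S)" using S(3) by simp
  have "(1 - \<epsilon>) * (3 * n / 4) \<le> real (card S)"
  proof (cases "1 \<le> \<epsilon>")
    case True
    then have "(1 - \<epsilon>) * (3 * n / 4) \<le> 0" by (intro mult_nonpos_nonneg) (auto simp: n_def)
    then show ?thesis by (rule order_trans) simp
  next
    case False
    have "(1 - \<epsilon>) * n \<le> (1 - \<epsilon> / 2) * (n - real (card A))"
    proof -
      have e1: "(1 - \<epsilon> / 2) * (n - real (card A)) = n - real (card A) - \<epsilon> * n / 2 + \<epsilon> * real (card A) / 2"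
        by (simp add: field_simps)
      have e2: "(1 - \<epsilon>) * n = n - \<epsilon> * n" by (simp add: left_diff_distrib)
      have "real (card A) \<le> \<epsilon> * n / 2" using assms(3) unfolding n_def by simp
      moreover have "0 \<le> \<epsilon> * real (card A)" using assms(4) by simp
      ultimately show ?thesis unfolding e1 e2 by linarith
    qed
    then have "3 / 4 * ((1 - \<epsilon>) * n) \<le> 3 / 4 * ((1 - \<epsilon> / 2) * (n - real (card A)))" by linarith
    also have "\<dots> = (1 - \<epsilon> / 2) * (3 * (n - real (card A)) / 4)" by simp
    also have "\<dots> \<le> real (card S)" using S(2) unfolding c .
    finally show ?thesis by simp
  qed
  then show ?thesis unfolding extremal_def n_def using S(1) free by blast
qed

lemma perfect_tiling_tileable:
  fixes \<epsilon> :: real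
  assumes "0 < \<epsilon>"
  obtains \<gamma> :: real and N :: nat where "0 < \<gamma>"
    "\<And>(V :: 'a set) E. three_graph V E \<Longrightarrow> N \<le> card V \<Longrightarrow> 4 dvd card V \<Longrightarrow> \<not> extremal \<epsilon> V E \<Longrightarrow>
      (\<And>v. v \<in> V \<Longrightarrow> (7 / 16 - \<gamma>) * real (card V) * (real (card V) - 1) \<le> real (tgraph.pdeg V E v)) \<Longrightarrow>
      tileable E V"
proof -
  \<comment> \<open>The second bound is \<epsilon>/512 instead of \<epsilon>/256 because the almost
    perfect tiling is sought in \<open>V - A\<close>, where non-extremality holds with
    \<epsilon>/2.\<close>
  define g where "g = min (1 / 2048) (\<epsilon> / 512)"
  have g: "0 < g" "g \<le> 1 / 2048" "256 * g \<le> \<epsilon> / 2" unfolding g_def using assms by auto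
  \<comment> \<open>The bound g/8 limits the degree loss 2 |A| n to g/4 n^2; the bound \<epsilon>/2
    preserves non-extremality.\<close>
  define b where "b = min (g / 8) (\<epsilon> / 2)"
  have b: "0 < b" "b \<le> g / 8" "b \<le> \<epsilon> / 2" unfolding b_def using g assms by auto
  obtain \<alpha> N where \<alpha>: "0 < \<alpha>" and absorb: "\<And>(V :: 'a set) E. tgraph V E \<Longrightarrow> N \<le> card V \<Longrightarrow>
      (\<And>v. v \<in> V \<Longrightarrow> 2 / 5 * (real (card V))\<^sup>2 \<le> real (tgraph.pdeg V E v)) \<Longrightarrow>
      \<exists>A\<subseteq>V. tileable E A \<and> real (card A) \<le> b * real (card V) \<and>
        (\<forall>R\<subseteq>V - A. real (card R) \<le> \<alpha> * real (card V) \<longrightarrow> 4 dvd card R \<longrightarrow> tileable E (A \<union> R))"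
    using absorbing[OF b(1)] by blast
  define K where "K = (71 + 32 / \<alpha>) / g + 1000"
  \<comment> \<open>The threshold \<open>K\<close> is doubled because \<open>V - A\<close> is only
    known to have at least half of the vertices.\<close>
  define M where "M = N + 100 + nat \<lceil>2 * K\<rceil>"
  show ?thesis
  proof (rule that[of "g / 2" M])
    show "0 < g / 2" using g by simp
    fix V :: "'a set" and E
    assume tg: "three_graph V E" and M: "M \<le> card V" and dvd: "4 dvd card V" and ne: "\<not> extremal \<epsilon> V E"
      and deg: "\<And>v. v \<in> V \<Longrightarrow> (7 / 16 - g / 2) * real (card V) * (real (card V) - 1) \<le> real (tgraph.pdeg V E v)"
    interpret tgraph V E using tg by unfold_locales
    define n where "n = real (card V)"
    have n: "100 \<le> n" "N \<le> card V" "2 * K \<le> n"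
      using M unfolding M_def n_def by linarith+
    have deg25: "2 / 5 * (real (card V))\<^sup>2 \<le> real (pdeg v)" if v: "v \<in> V" for v
    proof -
      have "2 / 5 * (n * n) \<le> 43 / 100 * n * (n - 1)"
        using mult_right_mono[OF n(1), of n] n(1) by (simp add: algebra_simps)
      also have "\<dots> \<le> (7 / 16 - g / 2) * n * (n - 1)"
        using g n by (intro mult_right_mono) auto
      also have "\<dots> \<le> real (pdeg v)" using deg[OF v] unfolding n_def .
      finally show ?thesis unfolding n_def power2_eq_square .
    qed
    obtain A where A: "A \<subseteq> V" "tileable E A" "real (card A) \<le> b * n"
      "\<And>R. R \<subseteq> V - A \<Longrightarrow> real (card R) \<le> \<alpha> * n \<Longrightarrow> 4 dvd card R \<Longrightarrow> tileable E (A \<union> R)"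
      using absorb[OF tgraph_axioms n(2) deg25] unfolding n_def by blast
    define V' E' where "V' = V - A" and "E' = induced_edges E (V - A)"
    interpret sub: tgraph V' E'
      unfolding V'_def E'_def using induced_tgraph[OF tg, of "V - A"] by unfold_locales auto
    define n' where "n' = real (card V')"
    have fA: "finite A" using A(1) finV finite_subset by auto
    have n': "n' = n - real (card A)"
      unfolding n'_def n_def V'_def using A(1) fA finV by (simp add: card_Diff_subset of_nat_diff card_mono)
    have "b * n \<le> 1 / 2 * n" using b g n by (intro mult_right_mono) auto
    then have n'2: "n / 2 \<le> n'" "n' \<le> n" using n' A(3) by auto
    have "\<exists>S\<subseteq>V'. tileable E' S \<and> real (card (V' - S)) \<le> \<alpha> * real (card V')"
    proof (rule sub.almost_tiling[OF _ g \<alpha>])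
      fix v assume v: "v \<in> V'"
      have "(7 / 16 - g) * n' * (n' - 1) \<le> (7 / 16 - g) * n * (n - 1)"
        using n'2 n g by (intro mult_mono) auto
      also have "\<dots> = (7 / 16 - g / 2) * n * (n - 1) - g / 2 * (n * (n - 1))"
        by (simp add: left_diff_distrib)
      \<comment> \<open>The degree hypothesis has g/2 where g is wanted. As n - 1 \<ge> n/2, this
        reserve is at least g/4 n^2, which is just the possible loss from deleting
        \<open>A\<close>.\<close>
      also have "g / 2 * (n * (n / 2)) \<le> g / 2 * (n * (n - 1))"
        using g n by (intro mult_left_mono) auto
      then have "(7 / 16 - g / 2) * n * (n - 1) - g / 2 * (n * (n - 1)) \<le> (7 / 16 - g / 2) * n * (n - 1) - g / 4 * n * n"
        by simp
      also have "\<dots> \<le> real (pdeg v) - g / 4 * n * n"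
        using deg[of v] v unfolding n_def V'_def by simp
      also have "\<dots> \<le> real (sub.pdeg v) + 2 * real (card A) * n - g / 4 * n * n"
        using pdeg_induced[OF tg A(1), of v] v unfolding V'_def E'_def n_def by simp
      also have "2 * real (card A) * n \<le> 2 * (g / 8 * n) * n"
      proof -
        have "b * n \<le> g / 8 * n" using b n by (intro mult_right_mono) auto
        then have "real (card A) \<le> g / 8 * n" using A(3) by linarith
        then show ?thesis using n by (intro mult_right_mono mult_left_mono) auto
      qed
      finally show "(7 / 16 - g) * real (card V') * (real (card V') - 1) \<le> real (sub.pdeg v)"
        unfolding n'_def by simp
    next
      show "(71 + 32 / \<alpha>) / g + 1000 \<le> real (card V')" using n(3) n'2 unfolding n'_def K_def[symmetric] by linarith
      have "b * n \<le> \<epsilon> / 2 * n" using b n by (intro mult_right_mono) auto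
      then have "real (card A) \<le> \<epsilon> / 2 * real (card V)" using A(3) unfolding n_def by linarith
      then show "\<not> extremal (\<epsilon> / 2) V' E'"
        using extremal_induced[OF finV A(1) _ assms] ne unfolding V'_def E'_def by blast
    qed
    then obtain S where S: "S \<subseteq> V'" "tileable E' S" "real (card (V' - S)) \<le> \<alpha> * n'" unfolding n'_def by blast
    have tS: "tileable E S" using S(2) tileable_induced unfolding E'_def by blast
    define R where "R = V' - S"
    have fin: "finite S" "finite R" using S(1) finV unfolding R_def V'_def by (auto intro: finite_subset)
    have V: "V = (A \<union> R) \<union> S" "A \<inter> R = {}" "(A \<union> R) \<inter> S = {}"
      using A(1) S(1) unfolding R_def V'_def by auto
    have "card V = card A + card R + card S"
      using V fA fin by (simp add: card_Un_disjoint)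
    then have "4 dvd card R"
      using dvd tileable_card[OF A(2)] tileable_card[OF tS] by (simp add: dvd_add_right_iff dvd_add_left_iff)
    moreover have "real (card R) \<le> \<alpha> * n"
      using S(3) n'2 \<alpha> mult_left_mono[of n' n \<alpha>] unfolding R_def by linarith
    moreover have "R \<subseteq> V - A" unfolding R_def V'_def by auto
    ultimately have "tileable E (A \<union> R)" by (intro A(4))
    then have "tileable E ((A \<union> R) \<union> S)" using tS V(3) by (rule tileable_Un)
    then show "tileable E V" using V(1) by simp
  qed
qed

theorem theorem1p5:
  shows "\<forall>\<epsilon>::real. \<epsilon> > 0 \<longrightarrow> (\<exists>\<gamma>::real. \<exists>n0::nat. \<gamma> > 0 \<and>
    (\<forall>(n::nat) (V :: 'a set) (E :: 'a set set).
       three_graph V E \<and> card V = n \<and> n \<ge> n0 \<and> 4 dvd n \<and>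
       \<not> extremal \<epsilon> V E \<and>
       real (min_vertex_degree V E) \<ge> (7 / 16 - \<gamma>) * real (n choose 2)
       \<longrightarrow> (\<exists>T. perfect_C43_tiling T V E)))"
proof (intro allI impI)
  fix \<epsilon> :: real assume "0 < \<epsilon>"
  then obtain \<gamma> N where \<gamma>: "0 < \<gamma>" and tile: "\<And>(V :: 'a set) E. three_graph V E \<Longrightarrow> N \<le> card V \<Longrightarrow> 4 dvd card V \<Longrightarrow>
      \<not> extremal \<epsilon> V E \<Longrightarrow>
      (\<And>v. v \<in> V \<Longrightarrow> (7 / 16 - \<gamma>) * real (card V) * (real (card V) - 1) \<le> real (tgraph.pdeg V E v)) \<Longrightarrow>
      tileable E V"
    using perfect_tiling_tileable by blast
  show "\<exists>\<gamma>::real. \<exists>n0::nat. \<gamma> > 0 \<and>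
    (\<forall>(n::nat) (V :: 'a set) (E :: 'a set set).
       three_graph V E \<and> card V = n \<and> n \<ge> n0 \<and> 4 dvd n \<and>
       \<not> extremal \<epsilon> V E \<and>
       real (min_vertex_degree V E) \<ge> (7 / 16 - \<gamma>) * real (n choose 2)
       \<longrightarrow> (\<exists>T. perfect_C43_tiling T V E))"
  proof (intro exI[of _ \<gamma>] exI[of _ N] conjI allI impI \<gamma>)
    fix n and V :: "'a set" and E :: "'a set set"
    assume a: "three_graph V E \<and> card V = n \<and> n \<ge> N \<and> 4 dvd n \<and> \<not> extremal \<epsilon> V E \<and>
       real (min_vertex_degree V E) \<ge> (7 / 16 - \<gamma>) * real (n choose 2)"
    then interpret tgraph V E by unfold_locales simp
    have "tileable E V"
      by (rule tile) (use a pdeg_lower[of "7 / 16 - \<gamma>"] in auto)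
    then show "\<exists>T. perfect_C43_tiling T V E" by (rule tileable_perfect)
  qed
qed

end
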